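(* Let $p>2$ be a prime and let $(a,b,c)$ be a solution in the first case of Fermat's equation, i.e. nonzero pairwise relatively prime integers with $a^p+b^p+c^p=0$ and $p\nmid abc$. Put $e=\frac{b}{a+b}$. Let $\chi=\omega^m$, $m\in\{1,\ldots,p-1\}$, be a $p$-adic character of $g$ distinct from $\omega$. Then the pseudo-unit $(a+b\,\zeta)^{e_\chi}$ (or, equivalently, $(1+e(\zeta-1))^{e_\chi}$) is a $p$-th power in $K_{\mathfrak p}$ if and only if $$\sum_{k=1}^{p-1}\omega^{m-1}(k)\Big(\frac{-b}{a}\Big)^k\equiv 0 \pmod p ,$$ the congruence being in $\mathbb{Z}_p$.
   Context: $\zeta$ is a primitive $p$-th root of unity, $K=\mathbb{Q}(\zeta)$, $\mathfrak p=(1-\zeta)\mathbb{Z}[\zeta]$ is the unique prime of $K$ above $p$, and $K_{\mathfrak p}$ is the completion of $K$ at $\mathfrak p$. $g=\mathrm{Gal}(K/\mathbb{Q})=\{s_k: 1\le k\le p-1\}$ with $s_k(\zeta)=\zeta^k$. $\omega$ is the Teichmüller character: $\omega(k)=\omega(s_k)\in\mathbb{Z}_p^\times$ is the unique $(p-1)$-th root of unity congruent to $k$ modulo $p$. For a character $\chi$ of $g$, $e_\chi=\frac{1}{p-1}\sum_{k=1}^{p-1}\chi^{-1}(k)s_k\in\mathbb{Z}_p[g]$. For $\alpha\in K^\times$, $\alpha^{e_\chi}$ is understood modulo $p$-th powers (i.e. in $K^\times/K^{\times p}$): it is represented by $\prod_{k=1}^{p-1}s_k(\alpha)^{\lambda_k}$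 with integers $\lambda_k\equiv\frac{1}{p-1}\chi^{-1}(k)\pmod p$; being a $p$-th power in $K_{\mathfrak p}$ does not depend on the choice. A pseudo-unit is an element $\alpha\in K^\times$ prime to $p$ such that $\alpha\mathbb{Z}[\zeta]$ is the $p$-th power of a (fractional) ideal of $K$. *)

theory Defs
  imports
    Complex_Main
    "HOL-Computational_Algebra.Primes"
    "HOL-Algebra.Generated_Fields"
    "HOL-Algebra.Ideal_Product"
    "HOL-Algebra.QuotRing"
    "HOL-Algebra.Algebraic_Closure_Type"
begin

section \<open>The p-adic integers and the Teichmueller character\<close>

text \<open>\<open>\<int>\<^sub>p\<close> is the inverse limit of the rings \<open>\<int>/p\<^sup>n\<close>; the \<open>n\<close>-th entry of an element is its
  residue modulo \<open>p\<^sup>n\<close>, taken in \<open>{0..<p\<^sup>n}\<close>.\<close>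

definition Zp :: "nat \<Rightarrow> (nat \<Rightarrow> int) ring" where
  "Zp p = \<lparr>carrier = {x. \<forall>n. x n \<in> {0..<int p ^ n} \<and> x (Suc n) mod int p ^ n = x n},
           monoid.mult = (\<lambda>x y n. (x n * y n) mod int p ^ n),
           one = (\<lambda>n. 1 mod int p ^ n),
           ring.zero = (\<lambda>n. 0),
           ring.add = (\<lambda>x y n. (x n + y n) mod int p ^ n)\<rparr>"

definition Zp_of_int :: "nat \<Rightarrow> int \<Rightarrow> nat \<Rightarrow> int" where
  "Zp_of_int p k = (\<lambda>n. k mod int p ^ n)"

text \<open>Congruence modulo \<open>p\<close> in \<open>\<int>\<^sub>p\<close>.\<close>

definition Zp_cong :: "nat \<Rightarrow> (nat \<Rightarrow> int) \<Rightarrow> (nat \<Rightarrow> int) \<Rightarrow> bool" where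
  "Zp_cong p x y \<longleftrightarrow> x \<ominus>\<^bsub>Zp p\<^esub> y \<in> PIdl\<^bsub>Zp p\<^esub> (Zp_of_int p (int p))"

definition teichmueller :: "nat \<Rightarrow> nat \<Rightarrow> nat \<Rightarrow> int" where
  "teichmueller p k = (THE w. w \<in> carrier (Zp p) \<and> w [^]\<^bsub>Zp p\<^esub> (p - 1) = \<one>\<^bsub>Zp p\<^esub> \<and>
                              Zp_cong p w (Zp_of_int p (int k)))"

text \<open>A character of \<open>g = {s\<^sub>k | 1 \<le> k \<le> p - 1}\<close> is represented by the extensional function
  \<open>k \<mapsto> \<chi>(s\<^sub>k)\<close> on \<open>{1..p-1}\<close>.\<close>

definition teichmueller_char :: "nat \<Rightarrow> nat \<Rightarrow> nat \<Rightarrow> (nat \<Rightarrow> int)" where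
  "teichmueller_char p m = (\<lambda>k\<in>{1..p-1}. teichmueller p k [^]\<^bsub>Zp p\<^esub> m)"

text \<open>The coefficient of \<open>s\<^sub>k\<close> in the idempotent \<open>e\<^sub>\<chi> \<in> \<int>\<^sub>p[g]\<close>.\<close>

definition idem_coeff :: "nat \<Rightarrow> (nat \<Rightarrow> (nat \<Rightarrow> int)) \<Rightarrow> nat \<Rightarrow> (nat \<Rightarrow> int)" where
  "idem_coeff p \<chi> k = inv\<^bsub>Zp p\<^esub> (Zp_of_int p (int p - 1)) \<otimes>\<^bsub>Zp p\<^esub> inv\<^bsub>Zp p\<^esub> (\<chi> k)"


section \<open>The cyclotomic field\<close>

text \<open>\<open>\<zeta>\<close> is a complex number; \<open>\<rat>(\<zeta>)\<close> and \<open>\<int>[\<zeta>]\<close> are the subfield and the subring of \<open>\<complex>\<close> that it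
  generates.\<close>

definition cyc_field :: "complex \<Rightarrow> complex ring" where
  "cyc_field \<zeta> = ring_of_type_algebra\<lparr>carrier := generate_field ring_of_type_algebra {\<zeta>}\<rparr>"

definition cyc_int :: "complex \<Rightarrow> complex ring" where
  "cyc_int \<zeta> = ring_of_type_algebra\<lparr>carrier := generate_ring ring_of_type_algebra {\<zeta>}\<rparr>"

text \<open>The automorphism \<open>s\<^sub>k\<close> of \<open>\<rat>(\<zeta>)\<close> (extensional on \<open>\<rat>(\<zeta>)\<close>, so that it is unique).\<close>

definition gal :: "complex \<Rightarrow> nat \<Rightarrow> complex \<Rightarrow> complex" where
  "gal \<zeta> k = (THE \<sigma>. \<sigma> \<in> ring_iso (cyc_field \<zeta>) (cyc_field \<zeta>) \<and>
                     \<sigma> \<in> extensional (carrier (cyc_field \<zeta>)) \<and> \<sigma> \<zeta> = \<zeta> ^ k)"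

text \<open>The representatives of \<open>\<alpha>\<close> to the power \<open>e\<^sub>\<chi>\<close> in \<open>K\<^sup>\<times>/K\<^sup>\<times>\<^sup>p\<close>: one for each choice of integers
  \<open>l k\<close> congruent modulo \<open>p\<close> to the coefficients of \<open>e\<^sub>\<chi>\<close>.\<close>

definition idem_powers ::
  "nat \<Rightarrow> complex \<Rightarrow> (nat \<Rightarrow> (nat \<Rightarrow> int)) \<Rightarrow> complex \<Rightarrow> complex set" where
  "idem_powers p \<zeta> \<chi> \<alpha> = {\<Prod>k=1..p-1. gal \<zeta> k \<alpha> powi l k | l :: nat \<Rightarrow> int.
      \<forall>k\<in>{1..p-1}. Zp_cong p (Zp_of_int p (l k)) (idem_coeff p \<chi> k)}"


section \<open>The completion at the prime above p\<close>

definition cyc_prime :: "complex \<Rightarrow> complex set" where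
  "cyc_prime \<zeta> = PIdl\<^bsub>cyc_int \<zeta>\<^esub> (1 - \<zeta>)"

text \<open>The valuation at the prime ideal \<open>\<pp> = (1 - \<zeta>)\<int>[\<zeta>]\<close>. Elements of \<open>\<int>[\<zeta>]\<close> outside \<open>\<pp>\<close> are exactly
  those that become units in the localisation at \<open>\<pp>\<close>, where \<open>1 - \<zeta>\<close> is a uniformiser. The value
  is meaningful for nonzero elements of \<open>\<rat>(\<zeta>)\<close> only.\<close>

definition cyc_val :: "complex \<Rightarrow> complex \<Rightarrow> int" where
  "cyc_val \<zeta> x = (THE n. \<exists>u \<in> carrier (cyc_int \<zeta>) - cyc_prime \<zeta>.
                         \<exists>w \<in> carrier (cyc_int \<zeta>) - cyc_prime \<zeta>. x = (1 - \<zeta>) powi n * u / w)"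

definition cyc_abs :: "nat \<Rightarrow> complex \<Rightarrow> complex \<Rightarrow> real" where
  "cyc_abs p \<zeta> x = (if x = 0 then 0 else real p powi (- cyc_val \<zeta> x))"

text \<open>The completion of a ring \<open>R\<close> for an absolute value \<open>N\<close>: Cauchy sequences modulo null
  sequences.\<close>

definition cauchy_ring :: "'a ring \<Rightarrow> ('a \<Rightarrow> real) \<Rightarrow> (nat \<Rightarrow> 'a) ring" where
  "cauchy_ring R N =
     \<lparr>carrier = {s. (\<forall>n. s n \<in> carrier R) \<and>
                    (\<forall>\<epsilon>>0. \<exists>M. \<forall>i\<ge>M. \<forall>j\<ge>M. N (s i \<ominus>\<^bsub>R\<^esub> s j) < \<epsilon>)},
      monoid.mult = (\<lambda>s t n. s n \<otimes>\<^bsub>R\<^esub> t n),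
      one = (\<lambda>n. \<one>\<^bsub>R\<^esub>),
      ring.zero = (\<lambda>n. \<zero>\<^bsub>R\<^esub>),
      ring.add = (\<lambda>s t n. s n \<oplus>\<^bsub>R\<^esub> t n)\<rparr>"

definition null_seqs :: "'a ring \<Rightarrow> ('a \<Rightarrow> real) \<Rightarrow> (nat \<Rightarrow> 'a) set" where
  "null_seqs R N = {s \<in> carrier (cauchy_ring R N). (\<lambda>n. N (s n)) \<longlonglongrightarrow> 0}"

definition completion :: "'a ring \<Rightarrow> ('a \<Rightarrow> real) \<Rightarrow> (nat \<Rightarrow> 'a) set ring" where
  "completion R N = cauchy_ring R N Quot null_seqs R N"

definition completion_of :: "'a ring \<Rightarrow> ('a \<Rightarrow> real) \<Rightarrow> 'a \<Rightarrow> (nat \<Rightarrow> 'a) set" where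
  "completion_of R N x = null_seqs R N +>\<^bsub>cauchy_ring R N\<^esub> (\<lambda>n. x)"

definition local_pth_power :: "nat \<Rightarrow> complex \<Rightarrow> complex \<Rightarrow> bool" where
  "local_pth_power p \<zeta> x \<longleftrightarrow>
     (\<exists>y \<in> carrier (completion (cyc_field \<zeta>) (cyc_abs p \<zeta>)).
        y [^]\<^bsub>completion (cyc_field \<zeta>) (cyc_abs p \<zeta>)\<^esub> p =
          completion_of (cyc_field \<zeta>) (cyc_abs p \<zeta>) x)"


section \<open>Pseudo-units\<close>

definition fractional_ideal :: "complex \<Rightarrow> complex set \<Rightarrow> bool" where
  "fractional_ideal \<zeta> J \<longleftrightarrow>
     additive_subgroup J (cyc_field \<zeta>) \<and> J \<noteq> {0} \<and>
     (\<forall>x \<in> carrier (cyc_int \<zeta>). \<forall>y \<in> J. x * y \<in> J) \<and>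
     (\<exists>d \<in> carrier (cyc_int \<zeta>) - {0}. \<forall>y \<in> J. d * y \<in> carrier (cyc_int \<zeta>))"

text \<open>The library's \<open>ideal_prod\<close>, taken in the field \<open>\<rat>(\<zeta>)\<close>, forms the finite sums of products and so
  is the product of fractional ideals too.\<close>

definition frac_ideal_power :: "complex \<Rightarrow> complex set \<Rightarrow> nat \<Rightarrow> complex set" where
  "frac_ideal_power \<zeta> J n = (ideal_prod (cyc_field \<zeta>) J ^^ n) (carrier (cyc_int \<zeta>))"

text \<open>As \<open>\<pp>\<close> is the only prime above \<open>p\<close>, being prime to \<open>p\<close> means having \<open>\<pp>\<close>-valuation \<open>0\<close>.\<close>

definition pseudo_unit :: "nat \<Rightarrow> complex \<Rightarrow> complex \<Rightarrow> bool" where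
  "pseudo_unit p \<zeta> \<alpha> \<longleftrightarrow>
     \<alpha> \<in> carrier (cyc_field \<zeta>) \<and> \<alpha> \<noteq> 0 \<and> cyc_val \<zeta> \<alpha> = 0 \<and>
     (\<exists>J. fractional_ideal \<zeta> J \<and>
          (\<lambda>x. \<alpha> * x) ` carrier (cyc_int \<zeta>) = frac_ideal_power \<zeta> J p)"

end

theory Submission
  imports Defs "HOL-Number_Theory.Number_Theory" "HOL-Computational_Algebra.Nth_Powers"
begin

text \<open>
  Write \<open>\<pi> = 1 - \<zeta>\<close>. The two elements differ by the factor \<open>a + b\<close>, which is the \<open>p\<close>-th power of an
  integer, and changing the integral exponents modulo \<open>p\<close> changes the product by the \<open>p\<close>-th power of
  a unit at \<open>\<pp>\<close>. So it suffices to treat the product \<open>component m\<close> of the \<open>a + b \<zeta>\<^sup>k\<close> with the exponents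
  \<open>(p-1) k\<^bsup>p-1-m\<^esup>\<close>, which are natural numbers congruent to \<open>-k\<^sup>-\<^sup>m\<close>.

  It is a pseudo-unit because every \<open>x = a + b \<zeta>\<^sup>k\<close> generates the \<open>p\<close>-th power of the ideal \<open>(x, c)\<close>: one has
  \<open>x y = (-c)\<^sup>p\<close>, where \<open>y\<close> is congruent to \<open>p a\<^bsup>p-1\<^esup>\<close> modulo \<open>x\<close> and hence comaximal with \<open>x\<close>
  (\<open>factor_ideal_pth_power\<close>, \<open>ideal_pth_power_comaximal\<close>).

  Let \<open>2 \<le> m \<le> p - 2\<close>. A local \<open>p\<close>-th power is congruent to a rational integer modulo \<open>p\<close>, because the
  Frobenius map of \<open>\<int>[\<zeta>]/p\<close> has its image in the prime field. For \<open>component m\<close> the converse holds as well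
  (\<open>local_pth_power_of_cong_int\<close>): if it is \<open>r (1 + p (x + y \<pi>))\<close> modulo \<open>p \<pi>\<^sup>2\<close> with integers \<open>x\<close> and \<open>y\<close>, then applying the
  idempotent reproduces it up to a \<open>p\<close>-th power, but multiplies \<open>x\<close> by \<open>-\<Sum>\<^sub>k k\<^sup>-\<^sup>m\<close> and \<open>y\<close> by
  \<open>-\<Sum>\<^sub>k k\<^bsup>1-m\<^esup>\<close>. Both sums vanish modulo \<open>p\<close>, so that a \<open>p\<close>-th power modulo \<open>p \<pi>\<^sup>2\<close> is left, and Hensel's lemma
  applies.

  Whether \<open>F(\<zeta>)\<close> is congruent to an integer modulo \<open>p\<close> is read off from Kummer's logarithmic
  derivatives. With \<open>D = T d/dT\<close>, it means that \<open>(D\<^sup>i F)(1)\<close> is divisible by \<open>p\<close> for \<open>1 \<le> i \<le> p - 2\<close>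
  (\<open>cong_int_iff_moments\<close>). Modulo \<open>p\<close> and \<open>T\<^sup>p - 1\<close> the polynomial \<open>a + b T\<^sup>k\<close> is \<open>a (1 - x T\<^sup>k)\<close> with \<open>x = -b/a\<close>, its logarithmic
  derivative is a geometric sum, and adding these sums with the exponents as weights gives
  \<open>D F / F = S/(1-x) \<Sum>\<^sub>n n\<^bsup>1-m\<^esup> T\<^sup>n\<close> where \<open>S = \<Sum>\<^sub>k k\<^bsup>m-1\<^esup> x\<^sup>k\<close> is the sum of the
  criterion (\<open>moments_of_eigencomponent\<close>). The last sum has only one nonzero moment of order at most \<open>p - 3\<close>, so all
  \<open>(D\<^sup>i F)(1)\<close> vanish modulo \<open>p\<close> exactly if \<open>S\<close> does.

  For \<open>m = p - 1\<close> both sides are true: \<open>component m\<close> is a power of the norm \<open>(-c)\<^sup>p/(a+b)\<close>, and \<open>p S\<close> is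
  congruent modulo \<open>p\<^sup>2\<close> to \<open>1 - x\<^sup>p - (1-x)\<^sup>p\<close>, which vanishes modulo \<open>p\<^sup>2\<close> by Fermat's equation.
\<close>

section \<open>Arithmetic modulo prime powers and the p-adic integers\<close>

lemma Zp_carrier_iff:
  "x \<in> carrier (Zp p) \<longleftrightarrow>
     (\<forall>n. 0 \<le> x n \<and> x n < int p ^ n \<and> x (Suc n) mod int p ^ n = x n)"
  by (auto simp: Zp_def)

lemma Zp_sel:
  "x \<otimes>\<^bsub>Zp p\<^esub> y = (\<lambda>n. (x n * y n) mod int p ^ n)"
  "x \<oplus>\<^bsub>Zp p\<^esub> y = (\<lambda>n. (x n + y n) mod int p ^ n)"
  "\<one>\<^bsub>Zp p\<^esub> = (\<lambda>n. 1 mod int p ^ n)"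
  "\<zero>\<^bsub>Zp p\<^esub> = (\<lambda>n. 0)"
  by (auto simp: Zp_def)

text \<open>An element of the inverse limit is a compatible family of residues, however its entries are
  represented; this packages the reduction to representatives in the standard range.\<close>

lemma Zp_residues_in_carrier:
  assumes "p > 0" "\<And>n. [f (Suc n) = f n] (mod int p ^ n)"
  shows "(\<lambda>n. f n mod int p ^ n) \<in> carrier (Zp p)"
proof -
  have "f (Suc n) mod int p ^ Suc n mod int p ^ n = f n mod int p ^ n" for n
    using assms(2)[of n] by (simp add: mod_mod_cancel cong_def)
  then show ?thesis using assms(1) by (auto simp: Zp_carrier_iff)
qed

lemma Zp_carrier_compat:
  "x \<in> carrier (Zp p) \<Longrightarrow> [x (Suc n) = x n] (mod int p ^ n)"
  by (metis Zp_carrier_iff cong_def mod_mod_trivial)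

lemma Zp_carrier_mod: "x \<in> carrier (Zp p) \<Longrightarrow> x n mod int p ^ n = x n"
  by (simp add: Zp_carrier_iff)

lemma Zp_of_int_carrier: "p > 0 \<Longrightarrow> Zp_of_int p k \<in> carrier (Zp p)"
  unfolding Zp_of_int_def by (rule Zp_residues_in_carrier) auto

lemma Zp_cring:
  assumes "p > 0" shows "cring (Zp p)"
proof (rule cringI)
  show "abelian_group (Zp p)"
  proof (rule abelian_groupI)
    fix x y assume xy: "x \<in> carrier (Zp p)" "y \<in> carrier (Zp p)"
    show "x \<oplus>\<^bsub>Zp p\<^esub> y \<in> carrier (Zp p)"
      unfolding Zp_sel using xy
      by (intro Zp_residues_in_carrier[OF assms] cong_add Zp_carrier_compat)
  next
    fix x assume x: "x \<in> carrier (Zp p)"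
    have "(\<lambda>n. (- x n) mod int p ^ n) \<in> carrier (Zp p)"
      using x by (intro Zp_residues_in_carrier[OF assms])
        (simp add: Zp_carrier_compat cong_minus_minus_iff)
    moreover have "(\<lambda>n. (- x n) mod int p ^ n) \<oplus>\<^bsub>Zp p\<^esub> x = \<zero>\<^bsub>Zp p\<^esub>"
      by (auto simp: Zp_sel mod_add_left_eq)
    ultimately show "\<exists>y\<in>carrier (Zp p). y \<oplus>\<^bsub>Zp p\<^esub> x = \<zero>\<^bsub>Zp p\<^esub>" by blast
  qed (use assms in \<open>auto simp: Zp_sel Zp_carrier_iff algebra_simps mod_simps\<close>)
  show "comm_monoid (Zp p)"
  proof (rule comm_monoidI)
    fix x y assume xy: "x \<in> carrier (Zp p)" "y \<in> carrier (Zp p)"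
    show "x \<otimes>\<^bsub>Zp p\<^esub> y \<in> carrier (Zp p)"
      unfolding Zp_sel using xy
      by (intro Zp_residues_in_carrier[OF assms] cong_mult Zp_carrier_compat)
  next
    show "\<one>\<^bsub>Zp p\<^esub> \<in> carrier (Zp p)"
      unfolding Zp_sel by (intro Zp_residues_in_carrier[OF assms]) auto
  qed (auto simp: Zp_sel algebra_simps mod_simps Zp_carrier_mod)
qed (auto simp: Zp_sel algebra_simps mod_simps)

lemma Zp_pow_entry: "p > 0 \<Longrightarrow> (x [^]\<^bsub>Zp p\<^esub> (k::nat)) n = x n ^ k mod int p ^ n"
proof (induction k)
  case 0 then show ?case by (simp add: Zp_sel)
next
  case (Suc k)
  interpret cring "Zp p" by (rule Zp_cring) fact
  show ?case using Suc by (simp add: Zp_sel mod_simps mult.commute)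
qed

lemma Zp_finsum_entry:
  assumes "p > 0" "finite A" "\<And>k. k \<in> A \<Longrightarrow> f k \<in> carrier (Zp p)"
  shows "(\<Oplus>\<^bsub>Zp p\<^esub>k\<in>A. f k) n = (\<Sum>k\<in>A. f k n) mod int p ^ n"
  using assms(2,3)
proof (induction A rule: finite_induct)
  case empty
  interpret cring "Zp p" by (rule Zp_cring) fact
  show ?case by (simp add: Zp_sel)
next
  case (insert x A)
  interpret cring "Zp p" by (rule Zp_cring) fact
  show ?case using insert by (simp add: Pi_def Zp_sel(2) mod_simps)
qed

lemma Zp_minus_entry:
  assumes "p > 0" "x \<in> carrier (Zp p)" "y \<in> carrier (Zp p)"
  shows "(x \<ominus>\<^bsub>Zp p\<^esub> y) n = (x n - y n) mod int p ^ n"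
proof -
  interpret cring "Zp p" by (rule Zp_cring) fact
  define z where "z = x \<ominus>\<^bsub>Zp p\<^esub> y"
  have z: "z \<in> carrier (Zp p)" using assms by (simp add: z_def)
  have "z \<oplus>\<^bsub>Zp p\<^esub> y = x" using assms by (simp add: z_def a_minus_def a_assoc l_neg)
  hence "(z n + y n) mod int p ^ n = x n" by (metis Zp_sel(2))
  hence "[z n + y n - y n = x n - y n] (mod int p ^ n)"
    using Zp_carrier_mod[OF assms(2), of n] by (intro cong_diff) (auto simp: cong_def)
  thus ?thesis using Zp_carrier_mod[OF z, of n] by (simp add: cong_def z_def)
qed

text \<open>The quotient of a family divisible by \<open>p\<close> is the family of the quotients, shifted by one
  index; so divisibility by \<open>p\<close> is visible modulo \<open>p\<close>.\<close>

lemma Zp_cong_iff: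
  assumes "p > 0" "x \<in> carrier (Zp p)" "y \<in> carrier (Zp p)"
  shows "Zp_cong p x y \<longleftrightarrow> x 1 = y 1"
proof -
  interpret cring "Zp p" by (rule Zp_cring) fact
  define z where "z = x \<ominus>\<^bsub>Zp p\<^esub> y"
  have z: "z \<in> carrier (Zp p)" using assms by (simp add: z_def)
  have z1: "z 1 = (x 1 - y 1) mod int p" using Zp_minus_entry[OF assms, of 1] by (simp add: z_def)
  have bd: "x 1 mod int p = x 1" "y 1 mod int p = y 1"
    using Zp_carrier_mod[OF assms(2), of 1] Zp_carrier_mod[OF assms(3), of 1] by auto
  have "z 1 = 0 \<longleftrightarrow> x 1 = y 1"
    unfolding z1 by (metis bd cong_def cong_diff_iff_cong_0 mod_0)
  moreover have "z \<in> PIdl\<^bsub>Zp p\<^esub> (Zp_of_int p (int p)) \<longleftrightarrow> z 1 = 0"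
  proof
    assume "z \<in> PIdl\<^bsub>Zp p\<^esub> (Zp_of_int p (int p))"
    then obtain w where "z = w \<otimes>\<^bsub>Zp p\<^esub> Zp_of_int p (int p)" by (auto simp: cgenideal_def)
    thus "z 1 = 0" by (simp add: Zp_sel Zp_of_int_def)
  next
    assume z0: "z 1 = 0"
    have dv: "int p dvd z (Suc n)" for n
    proof (induction n)
      case 0 then show ?case using z0 by simp
    next
      case (Suc n)
      have "[z (Suc (Suc n)) = z (Suc n)] (mod int p)"
        using Zp_carrier_compat[OF z, of "Suc n"] by (rule cong_dvd_modulus) simp
      thus ?case using Suc cong_dvd_iff by blast
    qed
    define w where "w = (\<lambda>n. (z (Suc n) div int p) mod int p ^ n)"
    have "[z (Suc (Suc n)) div int p = z (Suc n) div int p] (mod int p ^ n)" for n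
    proof -
      have "[z (Suc (Suc n)) = z (Suc n)] (mod int p ^ Suc n)"
        using Zp_carrier_compat[OF z] .
      then have "[int p * (z (Suc (Suc n)) div int p) = int p * (z (Suc n) div int p)]
          (mod int p * int p ^ n)"
        using dv by simp
      then show ?thesis using assms(1)
        by (metis (no_types, opaque_lifting) cong_iff_dvd_diff dvd_mult_cancel_left
            of_nat_0_less_iff order_less_irrefl right_diff_distrib')
    qed
    then have "w \<in> carrier (Zp p)"
      unfolding w_def by (rule Zp_residues_in_carrier[OF assms(1)])
    moreover have "z = w \<otimes>\<^bsub>Zp p\<^esub> Zp_of_int p (int p)"
    proof
      fix n
      have "(w n * (int p mod int p ^ n)) mod int p ^ n = (z (Suc n) div int p * int p) mod int p ^ n"
        by (simp add: w_def mod_simps)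
      also have "\<dots> = z n"
        using dv Zp_carrier_iff[of z p] z by simp
      finally show "z n = (w \<otimes>\<^bsub>Zp p\<^esub> Zp_of_int p (int p)) n" by (simp add: Zp_sel Zp_of_int_def)
    qed
    ultimately show "z \<in> PIdl\<^bsub>Zp p\<^esub> (Zp_of_int p (int p))" by (auto simp: cgenideal_def)
  qed
  ultimately show ?thesis by (simp add: Zp_cong_def z_def)
qed

lemma cong_prime_power_lift:
  assumes "prime p" "[x = y] (mod int p)"
  shows "[x ^ (p ^ n) = y ^ (p ^ n)] (mod int p ^ Suc n)"
proof (induction n)
  case 0 then show ?case using assms by simp
next
  case (Suc n)
  define u v where "u = x ^ (p ^ n)" and "v = y ^ (p ^ n)"
  from Suc obtain t where t: "u = v + int p ^ Suc n * t"
    by (metis u_def v_def cong_iff_lin cong_sym)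
  have p2: "p \<ge> 2" using assms(1) by (rule prime_ge_2_nat)
  have "u ^ p = (\<Sum>k\<le>p. of_nat (p choose k) * (int p ^ Suc n * t) ^ k * v ^ (p - k))"
    unfolding t by (subst add.commute, subst binomial_ring) simp
  also have "{..p} = insert 0 {1..p}" by auto
  also have "(\<Sum>k\<in>insert 0 {1..p}. of_nat (p choose k) * (int p ^ Suc n * t) ^ k * v ^ (p - k))
      = v ^ p + (\<Sum>k=1..p. of_nat (p choose k) * (int p ^ Suc n * t) ^ k * v ^ (p - k))"
    by (subst sum.insert) auto
  finally have "u ^ p - v ^ p =
      (\<Sum>k=1..p. of_nat (p choose k) * (int p ^ Suc n * t) ^ k * v ^ (p - k))" by simp
  also have "int p ^ Suc (Suc n) dvd \<dots>"
  proof (rule dvd_sum)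
    fix k assume k: "k \<in> {1..p}"
    show "int p ^ Suc (Suc n) dvd of_nat (p choose k) * (int p ^ Suc n * t) ^ k * v ^ (p - k)"
    proof (cases "k = p")
      case False
      then have "p dvd (p choose k)" using k assms(1) by (intro dvd_choose_prime) auto
      then have a: "int p dvd of_nat (p choose k)" by simp
      have "int p ^ Suc n dvd (int p ^ Suc n * t) ^ k"
        using k by (metis One_nat_def atLeastAtMost_iff dvd_power dvd_triv_left dvd_trans less_le_trans zero_less_one)
      from mult_dvd_mono[OF a this] show ?thesis by simp
    next
      case True
      have "Suc (Suc n) \<le> Suc n * p" using p2
        by (metis Suc_leI add_Suc_right le_add1 less_Suc_eq_le mult_2_right mult_le_mono2 order_trans)
      then have "int p ^ Suc (Suc n) dvd (int p ^ Suc n) ^ p"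
        by (metis le_imp_power_dvd power_mult)
      then show ?thesis using True by (simp add: power_mult_distrib dvd_mult2)
    qed
  qed
  finally show ?case by (simp add: cong_iff_dvd_diff u_def v_def power_mult[symmetric] mult.commute)
qed

lemma fermat_little_int:
  assumes "prime p" "\<not> int p dvd x"
  shows "[x ^ (p - 1) = 1] (mod int p)"
proof -
  have p: "int p > 0" using assms(1) prime_gt_0_nat by simp
  define k where "k = nat (x mod int p)"
  have k: "int k = x mod int p" using p by (simp add: k_def)
  have "\<not> p dvd k"
    using assms(2) k by (metis dvd_mod_iff dvd_refl int_dvd_int_iff)
  then have "[k ^ (p - 1) = 1] (mod p)" by (rule fermat_theorem[OF assms(1)])
  then have "[int (k ^ (p - 1)) = int 1] (mod int p)" using cong_int_iff by blast
  then have "[(x mod int p) ^ (p - 1) = 1] (mod int p)" by (simp add: k)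
  then show ?thesis by (simp add: cong_def mod_simps)
qed

lemma fermat_euler_prime_power:
  assumes "prime p" "\<not> int p dvd x"
  shows "[x ^ (p ^ n * (p - 1)) = 1] (mod int p ^ n)"
proof -
  have "[(x ^ (p - 1)) ^ (p ^ n) = 1 ^ (p ^ n)] (mod int p ^ Suc n)"
    by (rule cong_prime_power_lift[OF assms(1) fermat_little_int[OF assms]])
  then have "[(x ^ (p - 1)) ^ (p ^ n) = 1 ^ (p ^ n)] (mod int p ^ n)"
    by (rule cong_dvd_modulus) simp
  moreover have "(x ^ (p - 1)) ^ (p ^ n) = x ^ (p ^ n * (p - 1))"
    by (metis mult.commute power_mult)
  ultimately show ?thesis by (metis power_one)
qed

text \<open>Euler's theorem writes the inverses modulo all \<open>p\<^sup>n\<close> as powers.\<close>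

lemma Zp_Unit:
  assumes "prime p" "x \<in> carrier (Zp p)" "\<not> int p dvd x 1"
  shows "x \<in> Units (Zp p)"
proof -
  have p0: "p > 0" and p1: "p > 1" using assms(1) prime_gt_0_nat prime_gt_1_nat by auto
  interpret cring "Zp p" by (rule Zp_cring) fact
  have nd: "\<not> int p dvd x (Suc n)" for n
  proof (induction n)
    case 0 then show ?case using assms by simp
  next
    case (Suc n)
    have "[x (Suc (Suc n)) = x (Suc n)] (mod int p)"
      using Zp_carrier_compat[OF assms(2), of "Suc n"] by (rule cong_dvd_modulus) simp
    thus ?case using Suc cong_dvd_iff by blast
  qed
  define y where "y = (\<lambda>n. x n ^ (p ^ n * (p - 1) - 1))"
  have xy: "[x n * y n = 1] (mod int p ^ n)" for n
  proof (cases n)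
    case 0 then show ?thesis by simp
  next
    case (Suc k)
    have "p ^ n * (p - 1) > 0" using p1 by simp
    then have "x n * y n = x n ^ (p ^ n * (p - 1))"
      using power_minus_mult[of "p ^ n * (p - 1)" "x n"] by (simp add: y_def mult.commute)
    thus ?thesis using fermat_euler_prime_power[OF assms(1) nd[of k], of n] Suc by simp
  qed
  have "[y (Suc n) = y n] (mod int p ^ n)" for n
  proof -
    have c: "coprime (x n) (int p ^ n)"
      using xy[of n] by (meson cong_imp_coprime cong_sym coprime_1_left coprime_mult_left_iff)
    have "[x (Suc n) * y (Suc n) = 1] (mod int p ^ n)"
      using xy[of "Suc n"] by (rule cong_dvd_modulus) simp
    moreover have "[x (Suc n) * y (Suc n) = x n * y (Suc n)] (mod int p ^ n)"
      by (rule cong_mult[OF Zp_carrier_compat[OF assms(2)] cong_refl])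
    ultimately have "[x n * y (Suc n) = x n * y n] (mod int p ^ n)"
      by (metis cong_sym cong_trans xy)
    thus ?thesis using c cong_mult_lcancel by blast
  qed
  then have yc: "(\<lambda>n. y n mod int p ^ n) \<in> carrier (Zp p)"
    by (rule Zp_residues_in_carrier[OF p0])
  have "x \<otimes>\<^bsub>Zp p\<^esub> (\<lambda>n. y n mod int p ^ n) = \<one>\<^bsub>Zp p\<^esub>"
    using xy unfolding Zp_sel cong_def by (simp only: mod_mult_right_eq)
  moreover from this have "(\<lambda>n. y n mod int p ^ n) \<otimes>\<^bsub>Zp p\<^esub> x = \<one>\<^bsub>Zp p\<^esub>"
    by (simp only: m_comm[OF yc assms(2)])
  ultimately show ?thesis using yc assms(2) unfolding Units_def by blast
qed

lemma Zp_inv_entry: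
  assumes "prime p" "x \<in> carrier (Zp p)" "\<not> int p dvd x 1"
  shows "inv\<^bsub>Zp p\<^esub> x \<in> carrier (Zp p)" "[x 1 * (inv\<^bsub>Zp p\<^esub> x) 1 = 1] (mod int p)"
proof -
  interpret cring "Zp p" by (rule Zp_cring) (use assms prime_gt_0_nat in auto)
  have u: "x \<in> Units (Zp p)" by (rule Zp_Unit) fact+
  show "inv\<^bsub>Zp p\<^esub> x \<in> carrier (Zp p)" using u by simp
  have "(x \<otimes>\<^bsub>Zp p\<^esub> inv\<^bsub>Zp p\<^esub> x) 1 = \<one>\<^bsub>Zp p\<^esub> 1" using u by simp
  thus "[x 1 * (inv\<^bsub>Zp p\<^esub> x) 1 = 1] (mod int p)" by (simp add: Zp_sel cong_def)
qed

text \<open>The limit of \<open>k^(p^n)\<close> is the Teichmueller representative; it is unique because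
  \<open>w\<^sup>p = w\<close> turns a congruence modulo \<open>p\<close> into one modulo every \<open>p\<^sup>n\<close>.\<close>

lemma teichmueller_properties:
  assumes "prime p" "k \<in> {1..p-1}"
  shows "teichmueller p k \<in> carrier (Zp p)" "teichmueller p k 1 = int k"
proof -
  have p0: "p > 0" using assms(1) prime_gt_0_nat by auto
  interpret cring "Zp p" by (rule Zp_cring) fact
  have nd: "\<not> int p dvd int k"
    using assms by (auto dest!: dvd_imp_le)
  let ?P = "\<lambda>w. w \<in> carrier (Zp p) \<and> w [^]\<^bsub>Zp p\<^esub> (p - 1) = \<one>\<^bsub>Zp p\<^esub> \<and>
                Zp_cong p w (Zp_of_int p (int k))"
  define w where "w = (\<lambda>n. int k ^ (p ^ n) mod int p ^ n)"
  have fer: "[int k ^ p = int k] (mod int p)"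
  proof -
    have "[int k ^ (p - 1) = 1] (mod int p)"
      using fermat_theorem[of p k] assms nd cong_int_iff[of "k ^ (p-1)" 1 p] by simp
    from cong_mult[OF this cong_refl[of "int k"]] show ?thesis
      using p0 power_minus_mult[of p "int k"] by simp
  qed
  have wc: "w \<in> carrier (Zp p)" unfolding w_def
  proof (rule Zp_residues_in_carrier[OF p0])
    fix n
    have "[(int k ^ p) ^ (p ^ n) = int k ^ (p ^ n)] (mod int p ^ Suc n)"
      by (rule cong_prime_power_lift[OF assms(1) fer])
    then have "[(int k ^ p) ^ (p ^ n) = int k ^ (p ^ n)] (mod int p ^ n)"
      by (rule cong_dvd_modulus) simp
    then show "[int k ^ p ^ Suc n = int k ^ p ^ n] (mod int p ^ n)"
      by (simp add: power_mult)
  qed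
  moreover have "w [^]\<^bsub>Zp p\<^esub> (p - 1) = \<one>\<^bsub>Zp p\<^esub>"
  proof
    fix n
    have "(w [^]\<^bsub>Zp p\<^esub> (p - 1)) n = int k ^ (p ^ n * (p - 1)) mod int p ^ n"
      by (simp add: Zp_pow_entry[OF p0] w_def mod_simps power_mult)
    also have "\<dots> = \<one>\<^bsub>Zp p\<^esub> n"
      using fermat_euler_prime_power[OF assms(1) nd, of n] by (simp add: cong_def Zp_sel)
    finally show "(w [^]\<^bsub>Zp p\<^esub> (p - 1)) n = \<one>\<^bsub>Zp p\<^esub> n" .
  qed
  moreover have cw: "Zp_cong p w (Zp_of_int p (int k))"
  proof (rule iffD2[OF Zp_cong_iff[OF p0 wc Zp_of_int_carrier[OF p0]]])
    have "w 1 = int k ^ p mod int p" by (simp add: w_def)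
    also have "\<dots> = Zp_of_int p (int k) 1" using fer by (simp add: Zp_of_int_def cong_def)
    finally show "w 1 = Zp_of_int p (int k) 1" .
  qed
  ultimately have Pw: "?P w" by blast
  have uniq: "v = w" if v: "?P v" for v
  proof
    fix n
    have pow: "u n ^ (p ^ j) mod int p ^ n = u n" if u: "?P u" for u j
    proof (induction j)
      case 0 then show ?case using Zp_carrier_mod u by simp
    next
      case (Suc j)
      have "(u [^]\<^bsub>Zp p\<^esub> (p - 1) \<otimes>\<^bsub>Zp p\<^esub> u) n = u n" using u by simp
      then have "u n ^ (p - 1) * u n mod int p ^ n = u n"
        by (simp add: Zp_sel Zp_pow_entry[OF p0] mod_simps)
      then have 1: "u n ^ p mod int p ^ n = u n" using p0 power_minus_mult[of p "u n"] by simp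
      have "u n ^ (p ^ Suc j) mod int p ^ n = (u n ^ p ^ j mod int p ^ n) ^ p mod int p ^ n"
        by (simp add: power_mult[symmetric] mod_simps mult.commute)
      then show ?case using Suc 1 by simp
    qed
    show "v n = w n"
    proof (cases n)
      case 0 then show ?thesis using v wc Zp_carrier_mod[of _ p 0] by (metis mod_by_1 power_0)
    next
      case (Suc m)
      have c1: "v 1 = w 1" 
        using v cw Zp_cong_iff[OF p0 _ Zp_of_int_carrier[OF p0]] wc by metis
      have red: "[u (Suc i) = u 1] (mod int p)" if "u \<in> carrier (Zp p)" for u i
      proof (induction i)
        case (Suc i)
        have "[u (Suc (Suc i)) = u (Suc i)] (mod int p)"
          using Zp_carrier_compat[OF that, of "Suc i"] by (rule cong_dvd_modulus) simp
        then show ?case using Suc cong_trans by blast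
      qed simp
      have "[v n = w n] (mod int p)"
        using cong_trans[OF red[of v m] cong_sym[OF red[of w m, folded c1]]] v wc Suc by simp
      then have "[v n ^ (p ^ m) = w n ^ (p ^ m)] (mod int p ^ n)"
        using cong_prime_power_lift[OF assms(1)] Suc by simp
      then show ?thesis using pow[OF v] pow[OF Pw] by (simp add: cong_def)
    qed
  qed
  have t: "teichmueller p k = w"
    unfolding teichmueller_def
  proof (rule the_equality)
    show "?P w" by (rule Pw)
    show "v = w" if "?P v" for v using that by (rule uniq)
  qed
  show "teichmueller p k \<in> carrier (Zp p)" using wc t by simp
  have "w 1 = Zp_of_int p (int k) 1"
    using cw Zp_cong_iff[OF p0 wc Zp_of_int_carrier[OF p0]] by simp
  also have "\<dots> = int k" using assms p0 by (auto simp: Zp_of_int_def intro!: mod_pos_pos_trivial)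
  finally show "teichmueller p k 1 = int k" using t by simp
qed


section \<open>Moments of integral polynomials\<close>

definition euler_deriv :: "int poly \<Rightarrow> int poly" where
  "euler_deriv f = monom 1 1 * pderiv f"

text \<open>On \<open>\<Sum>\<^sub>n c\<^sub>n T\<^sup>n\<close> this is \<open>\<Sum>\<^sub>n c\<^sub>n n\<^sup>i\<close>, the \<open>i\<close>-th derivative of \<open>f(exp v)\<close> at \<open>v = 0\<close>. Modulo \<open>p\<close> the
  moments depend on \<open>f\<close> modulo \<open>p\<close> and \<open>T\<^sup>p - 1\<close> only.\<close>

definition moment :: "nat \<Rightarrow> int poly \<Rightarrow> int" where
  "moment i f = poly ((euler_deriv ^^ i) f) 1"

lemma euler_deriv_add: "euler_deriv (f + g) = euler_deriv f + euler_deriv g"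
  by (simp add: euler_deriv_def pderiv_add algebra_simps)

lemma euler_deriv_smult: "euler_deriv (smult c f) = smult c (euler_deriv f)"
  by (simp add: euler_deriv_def pderiv_smult)

lemma euler_deriv_mult: "euler_deriv (f * g) = euler_deriv f * g + f * euler_deriv g"
  by (simp add: euler_deriv_def pderiv_mult algebra_simps)

lemma euler_deriv_monom: "euler_deriv (monom c n) = monom (c * int n) n"
  by (cases n) (simp_all add: euler_deriv_def pderiv_monom mult_monom ac_simps)

lemma moment_0: "moment 0 f = poly f 1"
  by (simp add: moment_def)

lemma moment_Suc: "moment (Suc i) f = moment i (euler_deriv f)"
  by (simp add: moment_def funpow_swap1)

lemma moment_add: "moment i (f + g) = moment i f + moment i g"
  by (induction i arbitrary: f g) (simp_all add: moment_0 moment_Suc euler_deriv_add)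

lemma moment_smult: "moment i (smult c f) = c * moment i f"
  by (induction i arbitrary: f) (simp_all add: moment_0 moment_Suc euler_deriv_smult)

lemma moment_zero [simp]: "moment i 0 = 0"
  using moment_smult[of i 0 0] by simp

lemma moment_uminus: "moment i (- f) = - moment i f"
  using moment_smult[of i "-1" f] by simp

lemma moment_diff: "moment i (f - g) = moment i f - moment i g"
  using moment_add[of i f "- g"] by (simp add: moment_uminus)

lemma moment_sum: "moment i (\<Sum>k\<in>A. f k) = (\<Sum>k\<in>A. moment i (f k))"
  by (induction A rule: infinite_finite_induct) (simp_all add: moment_add)

lemma moment_monom: "moment i (monom c n) = c * int n ^ i"
  by (induction i arbitrary: c) (simp_all add: moment_0 moment_Suc euler_deriv_monom poly_monom)

lemma moment_const: "moment i [:c:] = (if i = 0 then c else 0)"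
  using moment_monom[of i c 0] by (cases i) (simp_all add: monom_0)

lemma moment_mult:
  "moment i (f * g) = (\<Sum>j\<le>i. int (i choose j) * moment j f * moment (i - j) g)"
proof (induction i arbitrary: f g)
  case 0 then show ?case by (simp add: moment_0)
next
  case (Suc i)
  let ?t = "\<lambda>j. moment j f * moment (Suc i - j) g"
  have "moment (Suc i) (f * g) = moment i (euler_deriv f * g) + moment i (f * euler_deriv g)"
    by (simp add: moment_Suc euler_deriv_mult moment_add)
  also have "moment i (euler_deriv f * g) = (\<Sum>j\<le>i. int (i choose j) * ?t (Suc j))"
    by (simp add: Suc moment_Suc mult.assoc)
  also have "moment i (f * euler_deriv g) = (\<Sum>j\<le>Suc i. int (i choose j) * ?t j)"
    by (simp add: Suc moment_Suc[symmetric] mult.assoc Suc_diff_le)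
  also have "\<dots> = ?t 0 + (\<Sum>j\<le>i. int (i choose Suc j) * ?t (Suc j))"
    by (subst sum.atMost_Suc_shift) simp
  also have "(\<Sum>j\<le>i. int (i choose j) * ?t (Suc j)) + \<dots> =
      ?t 0 + (\<Sum>j\<le>i. int (Suc i choose Suc j) * ?t (Suc j))"
    by (simp add: sum.distrib algebra_simps)
  also have "\<dots> = (\<Sum>j\<le>Suc i. int (Suc i choose j) * ?t j)"
    by (subst sum.atMost_Suc_shift) simp
  finally show ?case by (simp add: mult.assoc)
qed

definition moment_cong :: "nat \<Rightarrow> int poly \<Rightarrow> int poly \<Rightarrow> bool" where
  "moment_cong p f g \<longleftrightarrow> (\<forall>i. [moment i f = moment i g] (mod int p))"

lemma moment_cong_refl: "moment_cong p f f"
  by (simp add: moment_cong_def)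

lemma moment_cong_trans: "\<lbrakk>moment_cong p f g; moment_cong p g h\<rbrakk> \<Longrightarrow> moment_cong p f h"
  unfolding moment_cong_def using cong_trans by blast

lemma moment_cong_add: "\<lbrakk>moment_cong p f g; moment_cong p h k\<rbrakk> \<Longrightarrow> moment_cong p (f + h) (g + k)"
  unfolding moment_cong_def moment_add using cong_add by blast

lemma moment_cong_mult: "\<lbrakk>moment_cong p f g; moment_cong p h k\<rbrakk> \<Longrightarrow> moment_cong p (f * h) (g * k)"
  unfolding moment_cong_def moment_mult by (intro allI cong_sum cong_mult cong_refl) auto

text \<open>The equation \<open>u T f'/f = h\<close>, multiplied by \<open>f\<close> and read in the moments modulo \<open>p\<close>. The integer \<open>u\<close>
  clears the common denominator \<open>1 - x\<close> of the logarithmic derivatives below.\<close>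

definition log_derivative :: "nat \<Rightarrow> int \<Rightarrow> int poly \<Rightarrow> int poly \<Rightarrow> bool" where
  "log_derivative p u f h \<longleftrightarrow> moment_cong p (smult u (euler_deriv f)) (f * h)"

lemma log_derivative_one: "log_derivative p u 1 0"
  by (simp add: log_derivative_def moment_cong_refl euler_deriv_def)

lemma log_derivative_mult:
  assumes "log_derivative p u f h" "log_derivative p u g k"
  shows "log_derivative p u (f * g) (h + k)"
proof -
  have "moment_cong p (smult u (euler_deriv f) * g + f * smult u (euler_deriv g)) (f * h * g + f * (g * k))"
    using assms unfolding log_derivative_def
    by (intro moment_cong_add moment_cong_mult moment_cong_refl)
  then show ?thesis by (simp add: log_derivative_def euler_deriv_mult algebra_simps smult_add_right)
qed

lemma log_derivative_power:
  "log_derivative p u f h \<Longrightarrow> log_derivative p u (f ^ n) (smult (int n) h)"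
proof (induction n)
  case 0 then show ?case by (simp add: log_derivative_one)
next
  case (Suc n)
  then have "log_derivative p u (f * f ^ n) (h + smult (int n) h)" by (intro log_derivative_mult)
  then show ?case by (simp add: smult_add_left)
qed

lemma log_derivative_prod:
  assumes "finite A" "\<And>k. k \<in> A \<Longrightarrow> log_derivative p u (f k) (h k)"
  shows "log_derivative p u (\<Prod>k\<in>A. f k) (\<Sum>k\<in>A. h k)"
  using assms by (induction A rule: finite_induct) (auto intro: log_derivative_one log_derivative_mult)

lemma geometric_telescope:
  "(1 - monom x k) * (\<Sum>j=1..n. monom (x ^ j) (j * k)) =
     monom x k - monom (x ^ Suc n) (Suc n * k :: nat)" for x :: int
proof (induction n)
  case 0 then show ?case by simp
next
  case (Suc n)
  have "(1 - monom x k) * monom (x ^ Suc n) (Suc n * k) =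
     monom (x ^ Suc n) (Suc n * k) - monom (x ^ Suc (Suc n)) (Suc (Suc n) * k)"
    by (simp add: left_diff_distrib mult_monom)
  then show ?case using Suc by (simp add: distrib_left)
qed

lemma power_prime_cong:
  assumes "prime p" shows "[x ^ p = x] (mod int p)"
proof (cases "int p dvd x")
  case True
  then have "int p dvd x ^ p" using assms prime_gt_0_nat[of p] by (simp add: dvd_power dvd_trans)
  then show ?thesis using True by (simp add: cong_iff_dvd_diff)
next
  case False
  have "[x ^ (p - 1) * x = 1 * x] (mod int p)"
    by (intro cong_mult cong_refl fermat_little_int assms False)
  then show ?thesis using power_minus_mult[of p x] assms prime_gt_0_nat by simp
qed

text \<open>Here \<open>x\<close> plays the role of \<open>-b/a\<close>: modulo \<open>p\<close> and \<open>T\<^sup>p - 1\<close> the inverse of \<open>1 - x T\<^sup>k\<close> is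
  \<open>(\<Sum>j<p. x\<^sup>j T\<^sup>j\<^sup>k) / (1 - x)\<close>.\<close>

lemma log_derivative_linear:
  assumes "prime p" "[a * x = - b] (mod int p)"
  shows "log_derivative p (1 - x) ([:a:] + monom b k)
           (smult (- int k) (\<Sum>j=1..p. monom (x ^ j) (j * k)))"
  unfolding log_derivative_def
proof (rule moment_cong_trans)
  let ?h = "smult (- int k) (\<Sum>j=1..p. monom (x ^ j) (j * k))"
  have ab: "[b = - (a * x)] (mod int p)" using cong_minus_minus_iff[of "a * x" "- b"] assms(2)
    by (simp add: cong_sym)
  have eq: "smult a (1 - monom x k) * ?h = smult (- (a * int k)) (monom x k - monom (x ^ Suc p) (Suc p * k))"
    using geometric_telescope[of x k p] by (simp add: mult.commute)
  show "moment_cong p (smult a (1 - monom x k) * ?h) (([:a:] + monom b k) * ?h)"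
  proof (rule moment_cong_mult[OF _ moment_cong_refl])
    show "moment_cong p (smult a (1 - monom x k)) ([:a:] + monom b k)"
      unfolding moment_cong_def
    proof
      fix i
      have "[(- (a * x)) * int k ^ i = b * int k ^ i] (mod int p)"
        by (intro cong_mult cong_refl cong_sym[OF ab])
      then have "[a * moment i 1 + (- (a * x)) * int k ^ i = a * moment i 1 + b * int k ^ i] (mod int p)"
        by (intro cong_add cong_refl)
      moreover have "moment i [:a:] = a * moment i 1" using moment_smult[of i a 1] by simp
      ultimately show "[moment i (smult a (1 - monom x k)) = moment i ([:a:] + monom b k)] (mod int p)"
        by (simp add: moment_smult moment_diff moment_add moment_monom algebra_simps)
    qed
  qed
  show "moment_cong p (smult (1 - x) (euler_deriv ([:a:] + monom b k))) (smult a (1 - monom x k) * ?h)"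
    unfolding moment_cong_def
  proof
    fix i
    have D: "euler_deriv ([:a:] + monom b k) = monom (b * int k) k"
      using euler_deriv_monom[of a 0] by (simp add: euler_deriv_add euler_deriv_monom monom_0)
    have "[x ^ Suc p = x * x] (mod int p)"
      using cong_mult[OF cong_refl[of x] power_prime_cong[OF assms(1), of x]] by simp
    moreover have "[int (Suc p * k) ^ i = int k ^ i] (mod int p)"
      by (intro cong_pow) (simp add: cong_iff_dvd_diff algebra_simps)
    ultimately have 1: "[- (a * int k) * (x * int k ^ i - x ^ Suc p * int (Suc p * k) ^ i) =
        - (a * int k) * (x * int k ^ i - (x * x) * int k ^ i)] (mod int p)"
      by (intro cong_mult cong_diff cong_refl)
    have 2: "- (a * int k) * (x * int k ^ i - (x * x) * int k ^ i) =
        - (a * x) * ((1 - x) * int k * int k ^ i)" by (simp add: algebra_simps)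
    have 3: "[b * ((1 - x) * int k * int k ^ i) = - (a * x) * ((1 - x) * int k * int k ^ i)] (mod int p)"
      by (intro cong_mult cong_refl ab)
    have "[b * ((1 - x) * int k * int k ^ i) =
       - (a * int k) * (x * int k ^ i - x ^ Suc p * int (Suc p * k) ^ i)] (mod int p)"
      by (rule cong_trans[OF 3 cong_sym[OF 1[unfolded 2]]])
    then show "[moment i (smult (1 - x) (euler_deriv ([:a:] + monom b k))) = moment i (smult a (1 - monom x k) * ?h)] (mod int p)"
      unfolding D eq by (simp add: moment_smult moment_diff moment_monom moment_uminus mult.assoc mult.left_commute)
  qed
qed


lemma bij_betw_mult_mod_prime:
  fixes p g :: nat
  assumes "prime p" "\<not> p dvd g"
  shows "bij_betw (\<lambda>k. g * k mod p) {1..p-1} {1..p-1}"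
proof -
  have p1: "p > 1" using assms(1) prime_gt_1_nat by simp
  have cop: "coprime p g" using assms prime_imp_coprime by blast
  have "inj_on (\<lambda>k. g * k mod p) {1..p-1}"
  proof (rule inj_onI)
    fix k l assume kl: "k \<in> {1..p-1}" "l \<in> {1..p-1}" and "g * k mod p = g * l mod p"
    then have "[k = l] (mod p)" using cop cong_mult_lcancel_nat[of g p k l]
      by (simp add: cong_def coprime_commute)
    then show "k = l" using kl p1 by (auto simp: cong_def)
  qed
  moreover have "(\<lambda>k. g * k mod p) ` {1..p-1} \<subseteq> {1..p-1}"
  proof clarify
    fix k assume k: "k \<in> {1..p-1}"
    then have "\<not> p dvd k" by (auto dest!: dvd_imp_le)
    moreover have "\<not> p dvd g" by (rule assms(2))
    ultimately have "\<not> p dvd g * k" using assms(1) prime_dvd_mult_iff by blast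
    then have "g * k mod p > 0" by (simp add: dvd_eq_mod_eq_0)
    moreover have "g * k mod p < p" using p1 by simp
    ultimately show "g * k mod p \<in> {1..p-1}" by simp
  qed
  ultimately show ?thesis by (simp add: bij_betw_def endo_inj_surj)
qed

text \<open>If \<open>g\<close> is a primitive root, replacing \<open>k\<close> by \<open>g k\<close> multiplies the sum by \<open>g\<^sup>r\<close>.\<close>

lemma sum_powers_mod_prime:
  assumes "prime p"
  shows "[(\<Sum>k=1..p-1. int k ^ r) = (if (p - 1) dvd r then - 1 else 0)] (mod int p)"
proof (cases "(p - 1) dvd r")
  case True
  have p0: "p > 0" using assms prime_gt_0_nat by simp
  from True obtain d where d: "r = (p - 1) * d" by blast
  have "[int k ^ r = 1] (mod int p)" if "k \<in> {1..p-1}" for k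
  proof -
    have "\<not> int p dvd int k" using that by (auto dest!: dvd_imp_le)
    from cong_pow[OF fermat_little_int[OF assms this], of d] show ?thesis
      by (simp add: d power_mult)
  qed
  then have "[(\<Sum>k=1..p-1. int k ^ r) = (\<Sum>k=1..p-1. 1)] (mod int p)" by (rule cong_sum)
  moreover have "[(\<Sum>k=1..p-1. 1 :: int) = - 1] (mod int p)"
    using p0 by (simp add: cong_iff_dvd_diff of_nat_diff)
  ultimately show ?thesis using True cong_trans by auto
next
  case False
  have p1: "p > 1" using assms prime_gt_1_nat by simp
  obtain g where g: "residue_primroot p g"
    using prime_primitive_root_exists[of p] assms p1 by auto
  then have cop: "coprime p g" and ord: "ord p g = p - 1"
    using totient_prime[OF assms] by (auto simp: residue_primroot_def)
  have gr: "\<not> [g ^ r = 1] (mod p)" using False ord ord_divides[of g r p] by simp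
  let ?S = "\<Sum>k=1..p-1. int k ^ r"
  have bij: "bij_betw (\<lambda>k. g * k mod p) {1..p-1} {1..p-1}"
    using cop p1 by (intro bij_betw_mult_mod_prime assms) auto
  have "[int g ^ r * ?S = ?S] (mod int p)"
  proof -
    have "?S = (\<Sum>k=1..p-1. int (g * k mod p) ^ r)"
      using sum.reindex_bij_betw[OF bij, of "\<lambda>k. int k ^ r"] by simp
    also have "[\<dots> = (\<Sum>k=1..p-1. (int g * int k) ^ r)] (mod int p)"
      by (intro cong_sum cong_pow) (simp add: zmod_int cong_def)
    finally show ?thesis
      by (simp add: power_mult_distrib sum_distrib_left cong_sym)
  qed
  then have "int p dvd (int g ^ r - 1) * ?S" by (simp add: cong_iff_dvd_diff algebra_simps)
  moreover have "\<not> int p dvd int g ^ r - 1"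
  proof
    assume "int p dvd int g ^ r - 1"
    then have "[int (g ^ r) = int 1] (mod int p)" by (simp add: cong_iff_dvd_diff)
    then have "[g ^ r = 1] (mod p)" using cong_int_iff by blast
    then show False using gr by simp
  qed
  ultimately have "int p dvd ?S" using assms prime_dvd_mult_iff[of "int p"] by simp
  then show ?thesis using False by (simp add: cong_0_iff)
qed

text \<open>The logarithmic derivative of the product, times \<open>1 - x\<close>, is a polynomial \<open>G\<close> whose moment of order \<open>q\<close> is, up to sign,
  the product of \<open>\<Sum>\<^sub>k k\<^bsup>q+1-m\<^esup>\<close> and \<open>\<Sum>\<^sub>j j\<^sup>q x\<^sup>j\<close>. For \<open>q \<le> p - 3\<close> the first factor vanishes modulo \<open>p\<close> except at
  \<open>q = m - 1\<close>, where the second one is the sum of the statement. So the moments of \<open>F\<close> satisfy a recursion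
  driven by this sum alone.\<close>

lemma moments_of_eigencomponent:
  fixes a b x :: int and p m :: nat
  defines "F \<equiv> \<Prod>k=1..p-1. ([:a:] + monom b k) ^ ((p - 1) * k ^ (p - 1 - m))"
  assumes "prime p" "[a * x = - b] (mod int p)" "\<not> int p dvd a + b" "m \<ge> 2" "m \<le> p - 2"
  shows "(\<forall>i\<in>{1..p-2}. int p dvd moment i F) \<longleftrightarrow> int p dvd (\<Sum>k=1..p-1. int k ^ (m - 1) * x ^ k)"
proof -
  have p1: "p > 1" using assms(2) prime_gt_1_nat by simp
  have pr: "prime (int p)" using assms(2) by simp
  define S where "S = (\<Sum>k=1..p-1. int k ^ (m - 1) * x ^ k)"
  define h where "h = (\<lambda>k. smult (- int k) (\<Sum>j=1..p. monom (x ^ j) (j * k)))"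
  define l where "l = (\<lambda>k. (p - 1) * k ^ (p - 1 - m))"
  define G where "G = (\<Sum>k=1..p-1. smult (int (l k)) (h k))"
  define W where "W = (\<lambda>q. \<Sum>k=1..p-1. int (l k) * int k ^ Suc q)"
  have LD: "log_derivative p (1 - x) F G"
    unfolding F_def G_def h_def l_def
    by (intro log_derivative_prod log_derivative_power log_derivative_linear assms) auto
  have rec: "[(1 - x) * moment (Suc i) F =
      (\<Sum>j\<le>i. int (i choose j) * moment j F * moment (i - j) G)] (mod int p)" for i
    using LD unfolding log_derivative_def moment_cong_def moment_mult[symmetric]
    by (simp add: moment_smult moment_Suc)
  have G: "moment q G = - (W q * (\<Sum>j=1..p. int j ^ q * x ^ j))" for q
  proof -
    have "moment q G = (\<Sum>k=1..p-1. int (l k) * (- int k * (\<Sum>j=1..p. x ^ j * (int j * int k) ^ q)))"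
      by (simp add: G_def h_def moment_sum moment_smult moment_monom moment_uminus mult.assoc)
    also have "\<dots> = (\<Sum>k=1..p-1. - (int (l k) * int k ^ Suc q * (\<Sum>j=1..p. int j ^ q * x ^ j)))"
      by (rule sum.cong) (simp_all add: power_mult_distrib sum_distrib_left mult_ac sum_negf)
    finally show ?thesis by (simp add: W_def sum_negf sum_distrib_right)
  qed
  have W: "W q = int (p - 1) * (\<Sum>k=1..p-1. int k ^ (p - m + q))" for q
  proof -
    have "int (l k) * int k ^ Suc q = int (p - 1) * int k ^ (p - m + q)" for k
    proof -
      have "p - m + q = (p - 1 - m) + Suc q" using assms(5,6) by simp
      then show ?thesis by (simp only: l_def power_add of_nat_mult of_nat_power mult.assoc)
    qed
    then show ?thesis by (simp add: W_def sum_distrib_left)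
  qed
  have W0: "int p dvd W q" if "q \<le> p - 3" "q \<noteq> m - 1" for q
  proof -
    have "\<not> (p - 1) dvd (p - m + q)"
    proof
      assume "(p - 1) dvd (p - m + q)"
      then obtain d where d: "p - m + q = (p - 1) * d" by blast
      have "p - m + q > 0" "p - m + q < (p - 1) * 2" using that assms(5,6) by auto
      then have "d = 1" using d by (metis One_nat_def Suc_leI Suc_1 le_less_Suc_eq mult_0_right mult_less_cancel1 neq0_conv)
      then show False using d that assms(5,6) by simp
    qed
    then have "int p dvd (\<Sum>k=1..p-1. int k ^ (p - m + q))"
      using sum_powers_mod_prime[OF assms(2), of "p - m + q"] by (simp add: cong_0_iff)
    then show ?thesis by (simp add: W)
  qed
  have Wm: "[W (m - 1) = 1] (mod int p)"
  proof -
    have e: "p - m + (m - 1) = p - 1" using assms(5,6) by simp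
    have "[int (p - 1) = - 1] (mod int p)" using p1 by (simp add: cong_iff_dvd_diff of_nat_diff)
    from cong_mult[OF this sum_powers_mod_prime[OF assms(2), of "p - 1"]]
    show ?thesis unfolding W e by simp
  qed
  have S: "[(\<Sum>j=1..p. int j ^ (m - 1) * x ^ j) = S] (mod int p)"
  proof -
    have "{1..p} = insert p {1..p-1}" using p1 by auto
    moreover have "int p dvd int p ^ (m - 1)" using assms(5) by (intro dvd_power) auto
    ultimately show ?thesis using p1 by (simp add: S_def cong_iff_dvd_diff)
  qed
  have Gm: "[moment (m - 1) G = - S] (mod int p)"
    unfolding G using cong_mult[OF Wm S] by (simp add: cong_minus_minus_iff)
  have G0: "int p dvd moment q G" if "q \<le> p - 3" "q \<noteq> m - 1" for q
    using W0[OF that] by (simp add: G)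
  have F0: "\<not> int p dvd moment 0 F"
  proof -
    have "moment 0 F = (a + b) ^ (\<Sum>k=1..p-1. l k)"
      by (simp add: moment_0 F_def poly_prod poly_monom l_def power_sum)
    then show ?thesis using assms(4) pr prime_dvd_power[of "int p" "a + b"] by metis
  qed
  have x1: "\<not> int p dvd 1 - x"
  proof
    assume "int p dvd 1 - x"
    then have "int p dvd a * (1 - x)" by simp
    moreover have "int p dvd a * x + b" using assms(3) by (simp add: cong_iff_dvd_diff)
    ultimately have "int p dvd a * (1 - x) + (a * x + b)" by (rule dvd_add)
    then show False using assms(4) by (simp add: algebra_simps)
  qed
  show ?thesis unfolding S_def[symmetric]
  proof
    assume L: "\<forall>i\<in>{1..p-2}. int p dvd moment i F"
    have sm: "Suc (m - 1) = m" using assms(5) by simp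
    have "int p dvd moment m F" using L assms(5,6) by auto
    then have "int p dvd (1 - x) * moment (Suc (m - 1)) F" unfolding sm by simp
    then have "int p dvd (\<Sum>j\<le>m-1. int ((m-1) choose j) * moment j F * moment (m-1-j) G)"
      using rec[of "m - 1"] cong_dvd_iff by blast
    also have "(\<Sum>j\<le>m-1. int ((m-1) choose j) * moment j F * moment (m-1-j) G) =
        moment 0 F * moment (m - 1) G +
        (\<Sum>j\<in>{..m-1} - {0}. int ((m-1) choose j) * moment j F * moment (m-1-j) G)"
      by (subst sum.remove[of _ 0]) auto
    finally have 1: "int p dvd \<dots>" .
    have 2: "int p dvd (\<Sum>j\<in>{..m-1} - {0}. int ((m-1) choose j) * moment j F * moment (m-1-j) G)"
      by (intro dvd_sum dvd_mult G0) (use assms(5,6) in auto)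
    have "int p dvd moment 0 F * moment (m - 1) G"
      using 1 unfolding dvd_add_left_iff[OF 2] .
    then have "int p dvd moment (m - 1) G" using F0 pr prime_dvd_mult_iff by blast
    then have "int p dvd - S" using Gm cong_dvd_iff by blast
    then show "int p dvd S" by simp
  next
    assume "int p dvd S"
    then have "int p dvd moment (m - 1) G" using Gm cong_dvd_iff dvd_minus_iff by metis
    then have Gall: "int p dvd moment q G" if "q \<le> p - 3" for q using G0[OF that] by (cases "q = m - 1") auto
    show "\<forall>i\<in>{1..p-2}. int p dvd moment i F"
    proof
      fix i assume i: "i \<in> {1..p-2}"
      then obtain n where n: "i = Suc n" "n \<le> p - 3" by (cases i) auto
      have "int p dvd (\<Sum>j\<le>n. int (n choose j) * moment j F * moment (n - j) G)"
        by (intro dvd_sum dvd_mult Gall) (use n in auto)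
      then have "int p dvd (1 - x) * moment i F" using rec[of n] n cong_dvd_iff by blast
      then show "int p dvd moment i F" using x1 pr prime_dvd_mult_iff by blast
    qed
  qed
qed


section \<open>Completions for ultrametric absolute values\<close>

locale ultrametric_ring = cring R for R :: "'a ring" (structure) +
  fixes N :: "'a \<Rightarrow> real"
  assumes N_nonneg: "x \<in> carrier R \<Longrightarrow> N x \<ge> 0"
    and N_zero: "N \<zero> = 0"
    and N_mult: "\<lbrakk>x \<in> carrier R; y \<in> carrier R\<rbrakk> \<Longrightarrow> N (x \<otimes> y) = N x * N y"
    and N_add: "\<lbrakk>x \<in> carrier R; y \<in> carrier R\<rbrakk> \<Longrightarrow> N (x \<oplus> y) \<le> max (N x) (N y)"
    and N_uminus: "x \<in> carrier R \<Longrightarrow> N (\<ominus> x) = N x"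
begin

definition is_cauchy :: "(nat \<Rightarrow> 'a) \<Rightarrow> bool" where
  "is_cauchy s \<longleftrightarrow> (\<forall>n. s n \<in> carrier R) \<and> (\<forall>\<epsilon>>0. \<exists>M. \<forall>i\<ge>M. \<forall>j\<ge>M. N (s i \<ominus> s j) < \<epsilon>)"

lemma cauchy_ring_simps:
  "s \<in> carrier (cauchy_ring R N) \<longleftrightarrow> is_cauchy s"
  "s \<otimes>\<^bsub>cauchy_ring R N\<^esub> t = (\<lambda>n. s n \<otimes> t n)"
  "s \<oplus>\<^bsub>cauchy_ring R N\<^esub> t = (\<lambda>n. s n \<oplus> t n)"
  "\<one>\<^bsub>cauchy_ring R N\<^esub> = (\<lambda>n. \<one>)"
  "\<zero>\<^bsub>cauchy_ring R N\<^esub> = (\<lambda>n. \<zero>)"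
  by (auto simp: cauchy_ring_def is_cauchy_def)

lemma is_cauchyD: "is_cauchy s \<Longrightarrow> s n \<in> carrier R" by (simp add: is_cauchy_def)

lemma is_cauchy_bounded:
  assumes "is_cauchy s" shows "\<exists>B>0. \<forall>n. N (s n) \<le> B"
proof -
  obtain M where M: "\<And>i j. i \<ge> M \<Longrightarrow> j \<ge> M \<Longrightarrow> N (s i \<ominus> s j) < 1"
    using assms unfolding is_cauchy_def by (metis zero_less_one)
  define B where "B = max 1 (Max (N ` s ` {..M}))"
  have le: "N (s i) \<le> B" if "i \<le> M" for i
    using that by (auto simp: B_def intro!: max.coboundedI2 Max_ge)
  have "N (s n) \<le> B" for n
  proof (cases "n \<le> M")
    case False
    have c: "s n \<in> carrier R" "s M \<in> carrier R" using assms by (auto dest: is_cauchyD)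
    have "s n = (s n \<ominus> s M) \<oplus> s M" using c by (simp add: a_minus_def a_assoc l_neg)
    then have "N (s n) \<le> max (N (s n \<ominus> s M)) (N (s M))"
      using N_add[of "s n \<ominus> s M" "s M"] c by simp
    also have "\<dots> \<le> B" using M[of n M] le[of M] False by (simp add: B_def)
    finally show ?thesis .
  qed (rule le)
  moreover have "B > 0" by (simp add: B_def)
  ultimately show ?thesis by blast
qed

lemma is_cauchy_const: "x \<in> carrier R \<Longrightarrow> is_cauchy (\<lambda>n. x)"
  by (simp add: is_cauchy_def r_neg a_minus_def N_zero)

lemma is_cauchy_add:
  assumes "is_cauchy s" "is_cauchy t" shows "is_cauchy (\<lambda>n. s n \<oplus> t n)"
  unfolding is_cauchy_def
proof (intro conjI allI impI)
  fix e :: real assume "e > 0"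
  then obtain M1 M2 where M: "\<And>i j. i \<ge> M1 \<Longrightarrow> j \<ge> M1 \<Longrightarrow> N (s i \<ominus> s j) < e"
    "\<And>i j. i \<ge> M2 \<Longrightarrow> j \<ge> M2 \<Longrightarrow> N (t i \<ominus> t j) < e"
    using assms unfolding is_cauchy_def by metis
  have "N ((s i \<oplus> t i) \<ominus> (s j \<oplus> t j)) < e" if "i \<ge> max M1 M2" "j \<ge> max M1 M2" for i j
  proof -
    have c: "s i \<in> carrier R" "s j \<in> carrier R" "t i \<in> carrier R" "t j \<in> carrier R"
      using assms by (auto dest: is_cauchyD)
    have "(s i \<oplus> t i) \<ominus> (s j \<oplus> t j) = (s i \<ominus> s j) \<oplus> (t i \<ominus> t j)" using c by algebra
    then have "N ((s i \<oplus> t i) \<ominus> (s j \<oplus> t j)) \<le> max (N (s i \<ominus> s j)) (N (t i \<ominus> t j))"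
      using N_add[of "s i \<ominus> s j" "t i \<ominus> t j"] c by simp
    also have "\<dots> < e" using M that by simp
    finally show ?thesis .
  qed
  then show "\<exists>M. \<forall>i\<ge>M. \<forall>j\<ge>M. N ((s i \<oplus> t i) \<ominus> (s j \<oplus> t j)) < e" by blast
qed (use assms in \<open>auto dest: is_cauchyD\<close>)

lemma is_cauchy_uminus:
  assumes "is_cauchy s" shows "is_cauchy (\<lambda>n. \<ominus> s n)"
  unfolding is_cauchy_def
proof (intro conjI allI impI)
  fix e :: real assume "e > 0"
  then obtain M where M: "\<And>i j. i \<ge> M \<Longrightarrow> j \<ge> M \<Longrightarrow> N (s i \<ominus> s j) < e"
    using assms unfolding is_cauchy_def by metis
  have "\<ominus> s i \<ominus> (\<ominus> s j) = s j \<ominus> s i" for i j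
  proof -
    have "s i \<in> carrier R" "s j \<in> carrier R" using assms by (auto dest: is_cauchyD)
    then show ?thesis by algebra
  qed
  then show "\<exists>M. \<forall>i\<ge>M. \<forall>j\<ge>M. N (\<ominus> s i \<ominus> (\<ominus> s j)) < e" using M by metis
qed (use assms in \<open>auto dest: is_cauchyD\<close>)

lemma is_cauchy_mult:
  assumes "is_cauchy s" "is_cauchy t" shows "is_cauchy (\<lambda>n. s n \<otimes> t n)"
  unfolding is_cauchy_def
proof (intro conjI allI impI)
  fix e :: real assume "e > 0"
  obtain B C where B: "B > 0" "\<And>n. N (s n) \<le> B" and C: "C > 0" "\<And>n. N (t n) \<le> C"
    using is_cauchy_bounded assms by metis
  have "e / B > 0" "e / C > 0" using B C \<open>e > 0\<close> by auto
  then obtain M1 M2 where M: "\<And>i j. i \<ge> M1 \<Longrightarrow> j \<ge> M1 \<Longrightarrow> N (s i \<ominus> s j) < e / C"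
    "\<And>i j. i \<ge> M2 \<Longrightarrow> j \<ge> M2 \<Longrightarrow> N (t i \<ominus> t j) < e / B"
    using assms unfolding is_cauchy_def by metis
  have "N ((s i \<otimes> t i) \<ominus> (s j \<otimes> t j)) < e" if "i \<ge> max M1 M2" "j \<ge> max M1 M2" for i j
  proof -
    have c: "s i \<in> carrier R" "s j \<in> carrier R" "t i \<in> carrier R" "t j \<in> carrier R"
      using assms by (auto dest: is_cauchyD)
    have "(s i \<otimes> t i) \<ominus> (s j \<otimes> t j) = (s i \<ominus> s j) \<otimes> t i \<oplus> s j \<otimes> (t i \<ominus> t j)"
      using c by algebra
    then have "N ((s i \<otimes> t i) \<ominus> (s j \<otimes> t j)) \<le> max (N (s i \<ominus> s j) * N (t i)) (N (s j) * N (t i \<ominus> t j))"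
      using N_add[of "(s i \<ominus> s j) \<otimes> t i" "s j \<otimes> (t i \<ominus> t j)"] c by (simp add: N_mult)
    moreover have "N (s i \<ominus> s j) * N (t i) \<le> N (s i \<ominus> s j) * C"
      by (rule mult_left_mono) (use C c N_nonneg in auto)
    moreover have "N (s i \<ominus> s j) * C < e"
      using M(1)[of i j] that C by (simp add: pos_less_divide_eq)
    moreover have "N (s j) * N (t i \<ominus> t j) \<le> B * N (t i \<ominus> t j)"
      by (rule mult_right_mono) (use B c N_nonneg in auto)
    moreover have "B * N (t i \<ominus> t j) < e"
      using M(2)[of i j] that B by (simp add: pos_less_divide_eq mult.commute)
    ultimately show ?thesis by linarith
  qed
  then show "\<exists>M. \<forall>i\<ge>M. \<forall>j\<ge>M. N ((s i \<otimes> t i) \<ominus> (s j \<otimes> t j)) < e" by blast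
qed (use assms in \<open>auto dest: is_cauchyD\<close>)

lemma cauchy_ring_cring: "cring (cauchy_ring R N)"
proof (rule cringI)
  show "abelian_group (cauchy_ring R N)"
  proof (rule abelian_groupI)
    fix s assume s: "s \<in> carrier (cauchy_ring R N)"
    then have "(\<lambda>n. \<ominus> s n) \<in> carrier (cauchy_ring R N)"
      by (simp add: cauchy_ring_simps is_cauchy_uminus)
    moreover have "(\<lambda>n. \<ominus> s n) \<oplus>\<^bsub>cauchy_ring R N\<^esub> s = \<zero>\<^bsub>cauchy_ring R N\<^esub>"
      using s by (auto simp: cauchy_ring_simps is_cauchyD l_neg)
    ultimately show "\<exists>t\<in>carrier (cauchy_ring R N). t \<oplus>\<^bsub>cauchy_ring R N\<^esub> s = \<zero>\<^bsub>cauchy_ring R N\<^esub>"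
      by blast
  qed (auto simp: cauchy_ring_simps is_cauchy_const is_cauchy_add is_cauchyD a_ac)
  show "Group.comm_monoid (cauchy_ring R N)"
    by (rule comm_monoidI)
      (auto simp: cauchy_ring_simps is_cauchy_const is_cauchy_mult is_cauchyD m_ac)
qed (auto simp: cauchy_ring_simps is_cauchyD l_distr)

lemma null_seqs_iff: "s \<in> null_seqs R N \<longleftrightarrow> is_cauchy s \<and> (\<lambda>n. N (s n)) \<longlonglongrightarrow> 0"
  by (simp add: null_seqs_def cauchy_ring_simps)

lemma null_seqs_ideal: "ideal (null_seqs R N) (cauchy_ring R N)"
proof -
  interpret C: cring "cauchy_ring R N" by (rule cauchy_ring_cring)
  have neg: "inv\<^bsub>add_monoid (cauchy_ring R N)\<^esub> s = (\<lambda>n. \<ominus> s n)" if "is_cauchy s" for s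
  proof -
    have "\<ominus>\<^bsub>cauchy_ring R N\<^esub> s = (\<lambda>n. \<ominus> s n)"
      by (rule C.minus_equality)
        (use that in \<open>auto simp: cauchy_ring_simps is_cauchyD l_neg is_cauchy_uminus\<close>)
    then show ?thesis by (simp add: a_inv_def)
  qed
  have mult: "(\<lambda>n. N (s n \<otimes> t n)) \<longlonglongrightarrow> 0" if s: "is_cauchy s" and t: "t \<in> null_seqs R N" for s t
  proof -
    obtain B where B: "B > 0" "\<And>n. N (s n) \<le> B" using is_cauchy_bounded s by metis
    have t': "is_cauchy t" "(\<lambda>n. N (t n)) \<longlonglongrightarrow> 0" using t by (auto simp: null_seqs_iff)
    show ?thesis
    proof (rule tendsto_sandwich[OF _ _ tendsto_const tendsto_mult_right_zero[OF t'(2), of B]])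
      show "\<forall>\<^sub>F n in sequentially. 0 \<le> N (s n \<otimes> t n)"
        using s t' by (auto simp: N_nonneg is_cauchyD)
      show "\<forall>\<^sub>F n in sequentially. N (s n \<otimes> t n) \<le> B * N (t n)"
        using s t' B
        by (intro always_eventually) (auto simp: N_mult N_nonneg is_cauchyD intro!: mult_right_mono)
    qed
  qed
  show ?thesis
  proof (rule idealI)
    show "subgroup (null_seqs R N) (add_monoid (cauchy_ring R N))"
    proof (rule subgroup.intro)
      show "null_seqs R N \<subseteq> carrier (add_monoid (cauchy_ring R N))"
        by (auto simp: null_seqs_def)
      show "\<one>\<^bsub>add_monoid (cauchy_ring R N)\<^esub> \<in> null_seqs R N"
        by (simp add: null_seqs_iff cauchy_ring_simps is_cauchy_const N_zero)
      fix s assume s: "s \<in> null_seqs R N"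
      then have "(\<lambda>n. \<ominus> s n) \<in> null_seqs R N"
        by (auto simp: null_seqs_iff is_cauchy_uminus N_uminus is_cauchyD)
      then show "inv\<^bsub>add_monoid (cauchy_ring R N)\<^esub> s \<in> null_seqs R N"
        by (subst neg) (use s in \<open>auto simp: null_seqs_iff\<close>)
      fix t assume t: "t \<in> null_seqs R N"
      have st: "is_cauchy s" "is_cauchy t" using s t by (auto simp: null_seqs_iff)
      have lim: "(\<lambda>n. max (N (s n)) (N (t n))) \<longlonglongrightarrow> 0"
        using tendsto_max[of "\<lambda>n. N (s n)" 0 sequentially "\<lambda>n. N (t n)" 0] s t
        by (simp add: null_seqs_iff)
      have "(\<lambda>n. N (s n \<oplus> t n)) \<longlonglongrightarrow> 0"
        by (rule tendsto_sandwich[OF _ _ tendsto_const lim])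
          (use st in \<open>auto simp: N_nonneg N_add is_cauchyD\<close>)
      then show "s \<otimes>\<^bsub>add_monoid (cauchy_ring R N)\<^esub> t \<in> null_seqs R N"
        using st by (simp add: null_seqs_iff cauchy_ring_simps is_cauchy_add)
    qed
    fix s t assume st: "s \<in> null_seqs R N" "t \<in> carrier (cauchy_ring R N)"
    then have "(\<lambda>n. N (t n \<otimes> s n)) \<longlonglongrightarrow> 0" by (intro mult) (auto simp: cauchy_ring_simps)
    then show ts: "t \<otimes>\<^bsub>cauchy_ring R N\<^esub> s \<in> null_seqs R N"
      using st by (auto simp: null_seqs_iff cauchy_ring_simps is_cauchy_mult)
    then show "s \<otimes>\<^bsub>cauchy_ring R N\<^esub> t \<in> null_seqs R N"
      using st C.m_comm[of s t] by (auto simp: null_seqs_def)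
  qed (rule C.ring_axioms)
qed

text \<open>Powers in the completion are computed on representatives, because the quotient map is a ring
  homomorphism.\<close>

lemma completion_root_iff:
  assumes "x \<in> carrier R"
  shows "(\<exists>y \<in> carrier (completion R N). y [^]\<^bsub>completion R N\<^esub> (k::nat) = completion_of R N x)
     \<longleftrightarrow> (\<exists>s. is_cauchy s \<and> (\<lambda>n. N (s n [^] k \<ominus> x)) \<longlonglongrightarrow> 0)"
proof -
  let ?C = "cauchy_ring R N" and ?I = "null_seqs R N"
  interpret C: cring ?C by (rule cauchy_ring_cring)
  interpret I: ideal ?I ?C by (rule null_seqs_ideal)
  interpret h: ring_hom_cring ?C "?C Quot ?I" "(+>\<^bsub>?C\<^esub>) ?I"
    by (rule I.rcos_ring_hom_cring[OF C.cring_axioms])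
  have pow: "s [^]\<^bsub>?C\<^esub> k = (\<lambda>n. s n [^] k)" if "is_cauchy s" for s
    by (induction k) (auto simp: cauchy_ring_simps)
  have xc: "(\<lambda>n. x) \<in> carrier ?C" using assms by (simp add: cauchy_ring_simps is_cauchy_const)
  have key: "(?I +>\<^bsub>?C\<^esub> s) [^]\<^bsub>?C Quot ?I\<^esub> k = ?I +>\<^bsub>?C\<^esub> (\<lambda>n. x) \<longleftrightarrow>
      (\<lambda>n. N (s n [^] k \<ominus> x)) \<longlonglongrightarrow> 0" if s: "is_cauchy s" for s
  proof -
    have sc: "s \<in> carrier ?C" using s by (simp add: cauchy_ring_simps)
    have "\<ominus>\<^bsub>?C\<^esub> (\<lambda>n. x) = (\<lambda>n. \<ominus> x)"
      by (rule C.minus_equality)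
        (use assms in \<open>auto simp: cauchy_ring_simps l_neg is_cauchy_const\<close>)
    then have diff: "s [^]\<^bsub>?C\<^esub> k \<ominus>\<^bsub>?C\<^esub> (\<lambda>n. x) = (\<lambda>n. s n [^] k \<ominus> x)"
      using pow[OF s] by (simp add: a_minus_def cauchy_ring_simps)
    have diffc: "(\<lambda>n. s n [^] k \<ominus> x) \<in> carrier ?C"
      unfolding diff[symmetric] using sc xc by (intro C.minus_closed C.nat_pow_closed)
    have "(?I +>\<^bsub>?C\<^esub> s) [^]\<^bsub>?C Quot ?I\<^esub> k = ?I +>\<^bsub>?C\<^esub> (s [^]\<^bsub>?C\<^esub> k)"
      by (rule sym[OF ring_hom_ring.hom_nat_pow[OF I.rcos_ring_hom_ring sc]])
    also have "\<dots> = ?I +>\<^bsub>?C\<^esub> (\<lambda>n. x) \<longleftrightarrow> s [^]\<^bsub>?C\<^esub> k \<ominus>\<^bsub>?C\<^esub> (\<lambda>n. x) \<in> ?I"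
      by (rule sym[OF C.quotient_eq_iff_same_a_r_cos[OF I.ideal_axioms _ xc]]) (use sc in blast)
    also have "\<dots> \<longleftrightarrow> (\<lambda>n. s n [^] k \<ominus> x) \<in> ?I" by (simp only: diff)
    also have "\<dots> \<longleftrightarrow> (\<lambda>n. N (s n [^] k \<ominus> x)) \<longlonglongrightarrow> 0"
      by (simp only: null_seqs_def mem_Collect_eq diffc simp_thms)
    finally show ?thesis .
  qed
  have carr: "y \<in> carrier (?C Quot ?I) \<longleftrightarrow> (\<exists>s. is_cauchy s \<and> y = ?I +>\<^bsub>?C\<^esub> s)" for y
    by (auto simp: FactRing_def A_RCOSETS_def' cauchy_ring_simps)
  show ?thesis
    unfolding completion_def completion_of_def Bex_def carr using key by blast
qed

end


section \<open>The ring of integers of the cyclotomic field\<close>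

definition ev :: "int poly \<Rightarrow> complex \<Rightarrow> complex" where
  "ev f z = poly (map_poly of_int f) z"

lemma ev_pCons: "ev (pCons c f) z = of_int c + z * ev f z"
  by (cases "c = 0 \<and> f = 0") (simp_all add: ev_def map_poly_pCons)

lemma ev_0 [simp]: "ev 0 z = 0"
  by (simp add: ev_def)

lemma ev_const [simp]: "ev [:c:] z = of_int c"
  by (simp add: ev_pCons)

lemma ev_1 [simp]: "ev 1 z = 1"
  using ev_const[of 1] by (simp add: one_pCons)

lemma ev_add [simp]: "ev (f + g) z = ev f z + ev g z"
  by (induction f g rule: poly_induct2) (simp_all add: ev_pCons algebra_simps)

lemma ev_smult [simp]: "ev (smult c f) z = of_int c * ev f z"
  by (induction f) (simp_all add: ev_pCons algebra_simps)

lemma ev_uminus [simp]: "ev (- f) z = - ev f z"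
  using ev_smult[of "-1" f] by simp

lemma ev_diff [simp]: "ev (f - g) z = ev f z - ev g z"
  using ev_add[of f "- g"] by simp

lemma ev_mult [simp]: "ev (f * g) z = ev f z * ev g z"
  by (induction f) (simp_all add: ev_pCons algebra_simps)

lemma ev_power [simp]: "ev (f ^ n) z = ev f z ^ n"
  by (induction n) simp_all

lemma ev_monom [simp]: "ev (monom c n) z = of_int c * z ^ n"
  by (induction n) (simp_all add: monom_0 monom_Suc ev_pCons)

lemma ev_sum [simp]: "ev (\<Sum>k\<in>A. f k) z = (\<Sum>k\<in>A. ev (f k) z)"
  by (induction A rule: infinite_finite_induct) simp_all

lemma ev_prod [simp]: "ev (\<Prod>k\<in>A. f k) z = (\<Prod>k\<in>A. ev (f k) z)"
  by (induction A rule: infinite_finite_induct) simp_all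

lemma ev_pcompose [simp]: "ev (f \<circ>\<^sub>p g) z = ev f (ev g z)"
  by (induction f) (simp_all add: pcompose_pCons ev_pCons)

lemma int_dvd_all_powers_imp_0:
  fixes c :: int
  assumes "p > 1" "\<And>n. int p ^ n dvd c"
  shows "c = 0"
proof (rule ccontr)
  assume "c \<noteq> 0"
  then have "int p ^ nat \<bar>c\<bar> \<le> \<bar>c\<bar>"
    using dvd_imp_le_int[OF _ assms(2)[of "nat \<bar>c\<bar>"]] by simp
  moreover have "nat \<bar>c\<bar> < p ^ nat \<bar>c\<bar>" using power_gt_expt[of p "nat \<bar>c\<bar>"] assms(1) by simp
  then have "\<bar>c\<bar> < int p ^ nat \<bar>c\<bar>"
    by (metis nat_less_iff abs_ge_zero of_nat_power)
  ultimately show False by simp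
qed

locale prime_cyclotomic =
  fixes p :: nat and \<zeta> :: complex
  assumes p_prime: "prime p" and p_gt_2: "p > 2"
    and zeta_pow_p: "\<zeta> ^ p = 1" and zeta_primitive: "\<forall>j\<in>{1..<p}. \<zeta> ^ j \<noteq> 1"
begin

lemma zeta_nonzero [simp]: "\<zeta> \<noteq> 0"
  using zeta_pow_p p_gt_2 by (auto simp: power_0_left)

lemma zeta_pow_mod: "\<zeta> ^ (n mod p) = \<zeta> ^ n"
proof -
  have "\<zeta> ^ n = \<zeta> ^ (p * (n div p) + n mod p)" by simp
  also have "\<dots> = \<zeta> ^ (n mod p)" by (simp only: power_add power_mult zeta_pow_p power_one mult_1)
  finally show ?thesis by simp
qed

lemma zeta_pow_cong: "[m = n] (mod p) \<Longrightarrow> \<zeta> ^ m = \<zeta> ^ n"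
  by (metis cong_def zeta_pow_mod)

lemma zeta_pow_eq_1_iff: "\<zeta> ^ n = 1 \<longleftrightarrow> p dvd n"
proof -
  have "n mod p \<in> {1..<p}" if "\<not> p dvd n"
    using that p_gt_2 by (auto simp: dvd_eq_mod_eq_0)
  then show ?thesis using zeta_primitive zeta_pow_mod[of n] by (auto simp: dvd_eq_mod_eq_0) 
qed

lemma zeta_pow_inj: "inj_on (\<lambda>k. \<zeta> ^ k) {..<p}"
proof (rule linorder_inj_onI')
  fix i j assume ij: "i \<in> {..<p}" "j \<in> {..<p}" "i < j"
  have "\<zeta> ^ j = \<zeta> ^ i * \<zeta> ^ (j - i)" using ij by (simp flip: power_add)
  moreover have "j - i \<in> {1..<p}" using ij by auto
  then have "\<zeta> ^ (j - i) \<noteq> 1" using zeta_primitive by blast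
  ultimately show "\<zeta> ^ i \<noteq> \<zeta> ^ j" by simp
qed

definition zint :: "complex set" where "zint = range (\<lambda>f. ev f \<zeta>)"

lemma ev_in_zint [simp, intro]: "ev f \<zeta> \<in> zint"
  by (simp add: zint_def)

lemma zintE: "x \<in> zint \<Longrightarrow> (\<And>f. x = ev f \<zeta> \<Longrightarrow> P) \<Longrightarrow> P"
  by (auto simp: zint_def)

lemma zint_of_int [simp, intro]: "of_int c \<in> zint"
  using ev_in_zint[of "[:c:]"] by simp

lemma zint_of_nat [simp, intro]: "of_nat c \<in> zint"
  using zint_of_int[of "int c"] by simp

lemma zint_0 [simp, intro]: "0 \<in> zint" and zint_1 [simp, intro]: "1 \<in> zint"
  using zint_of_int[of 0] zint_of_int[of 1] by simp_all

lemma zint_add [simp, intro]: "x \<in> zint \<Longrightarrow> y \<in> zint \<Longrightarrow> x + y \<in> zint"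
  by (elim zintE) (simp flip: ev_add)

lemma zint_mult [simp, intro]: "x \<in> zint \<Longrightarrow> y \<in> zint \<Longrightarrow> x * y \<in> zint"
  by (elim zintE) (simp flip: ev_mult)

lemma zint_uminus [simp, intro]: "x \<in> zint \<Longrightarrow> - x \<in> zint"
  by (elim zintE) (simp flip: ev_uminus)

lemma zint_diff [simp, intro]: "x \<in> zint \<Longrightarrow> y \<in> zint \<Longrightarrow> x - y \<in> zint"
  by (elim zintE) (simp flip: ev_diff)

lemma zint_power [simp, intro]: "x \<in> zint \<Longrightarrow> x ^ n \<in> zint"
  by (elim zintE) (simp flip: ev_power)

lemma zint_zeta [simp, intro]: "\<zeta> \<in> zint"
  using ev_in_zint[of "monom 1 1"] by simp

lemma zint_sum [simp, intro]: "(\<And>k. k \<in> A \<Longrightarrow> f k \<in> zint) \<Longrightarrow> (\<Sum>k\<in>A. f k) \<in> zint"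
  by (induction A rule: infinite_finite_induct) auto

lemma zint_prod [simp, intro]: "(\<And>k. k \<in> A \<Longrightarrow> f k \<in> zint) \<Longrightarrow> (\<Prod>k\<in>A. f k) \<in> zint"
  by (induction A rule: infinite_finite_induct) auto

lemma zint_ev [simp, intro]: "x \<in> zint \<Longrightarrow> ev f x \<in> zint"
  by (induction f) (auto simp: ev_pCons)

definition zdvd :: "complex \<Rightarrow> complex \<Rightarrow> bool" (infix "zdvd" 50) where
  "x zdvd y \<longleftrightarrow> (\<exists>z\<in>zint. y = x * z)"

lemma zdvd_0 [simp]: "x zdvd 0" and zdvd_refl [simp]: "x zdvd x"
  unfolding zdvd_def by (auto intro: bexI[of _ 0] bexI[of _ 1])

lemma zdvd_add [intro]: "x zdvd y \<Longrightarrow> x zdvd z \<Longrightarrow> x zdvd y + z"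
  unfolding zdvd_def by (metis distrib_left zint_add)

lemma zdvd_uminus_iff [simp]: "x zdvd - y \<longleftrightarrow> x zdvd y"
  unfolding zdvd_def by (metis minus_minus mult_minus_right zint_uminus)

lemma zdvd_diff [intro]: "x zdvd y \<Longrightarrow> x zdvd z \<Longrightarrow> x zdvd y - z"
  using zdvd_add[of x y "- z"] by simp

lemma zdvd_mult [intro]: "x zdvd y \<Longrightarrow> z \<in> zint \<Longrightarrow> x zdvd y * z"
  unfolding zdvd_def by (metis mult.assoc zint_mult)

lemma zdvd_mult2 [intro]: "x zdvd y \<Longrightarrow> z \<in> zint \<Longrightarrow> x zdvd z * y"
  using zdvd_mult[of x y z] by (simp add: mult.commute)

lemma zdvd_trans [trans]: "x zdvd y \<Longrightarrow> y zdvd z \<Longrightarrow> x zdvd z"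
  by (metis zdvd_def zdvd_mult)

lemma zdvd_mult_mono: "x zdvd y \<Longrightarrow> z zdvd w \<Longrightarrow> x * z zdvd y * w"
  unfolding zdvd_def by (metis mult.assoc mult.left_commute zint_mult)

lemma zdvd_mult_cancel: "x \<noteq> 0 \<Longrightarrow> x * y zdvd x * z \<longleftrightarrow> y zdvd z"
  unfolding zdvd_def by (auto simp: mult.assoc)

lemma zdvd_power_le: "m \<le> n \<Longrightarrow> x \<in> zint \<Longrightarrow> x ^ m zdvd x ^ n"
  unfolding zdvd_def by (intro bexI[of _ "x ^ (n - m)"]) (auto simp flip: power_add)

lemma zdvd_power_mono: "x zdvd y \<Longrightarrow> x ^ n zdvd y ^ n"
  unfolding zdvd_def by (metis power_mult_distrib zint_power)

lemma zdvd_sum: "(\<And>k. k \<in> A \<Longrightarrow> x zdvd f k) \<Longrightarrow> x zdvd (\<Sum>k\<in>A. f k)"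
  by (induction A rule: infinite_finite_induct) auto

lemma zdvd_of_int: "a dvd b \<Longrightarrow> of_int a zdvd of_int b"
  unfolding zdvd_def by (auto elim!: dvdE)

definition cyclotomic :: "int poly" where
  "cyclotomic = (\<Sum>i<p. monom 1 i)"

lemma coeff_cyclotomic: "coeff cyclotomic n = (if n < p then 1 else 0)"
  by (simp add: cyclotomic_def coeff_sum)

lemma degree_cyclotomic: "degree cyclotomic = p - 1"
  using p_gt_2 by (intro antisym degree_le le_degree) (auto simp: coeff_cyclotomic)

lemma cyclotomic_root:
  assumes "\<not> p dvd j" shows "ev cyclotomic (\<zeta> ^ j) = 0"
proof -
  have "(\<zeta> ^ j - 1) * ev cyclotomic (\<zeta> ^ j) = (\<zeta> ^ j) ^ p - 1"
    by (simp add: cyclotomic_def power_diff_1_eq)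
  also have "\<dots> = 0" by (simp add: power_mult[symmetric] zeta_pow_eq_1_iff)
  finally show ?thesis using assms zeta_pow_eq_1_iff by auto
qed

lemma cyclotomic_division:
  obtains q r where "f = cyclotomic * q + r" "r = 0 \<or> degree r < p - 1"
proof -
  obtain q r where qr: "pseudo_divmod f cyclotomic = (q, r)" by force
  have nz: "cyclotomic \<noteq> 0" using coeff_cyclotomic[of 0] p_gt_2 by auto
  show ?thesis
    using pseudo_divmod[OF nz qr] that[of q r] p_gt_2
    by (simp add: degree_cyclotomic coeff_cyclotomic)
qed

lemma few_roots_imp_0:
  fixes g :: "complex poly"
  assumes "g = 0 \<or> degree g < p - 1" "\<And>j. j \<in> {1..p-1} \<Longrightarrow> poly g (\<zeta> ^ j) = 0"
  shows "g = 0"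
proof (rule ccontr)
  assume g: "g \<noteq> 0"
  have "inj_on (\<lambda>k. \<zeta> ^ k) {1..p-1}"
    by (rule inj_on_subset[OF zeta_pow_inj]) (use p_gt_2 in auto)
  then have "p - 1 = card ((\<lambda>k. \<zeta> ^ k) ` {1..p-1})" by (simp add: card_image)
  also have "\<dots> \<le> card {z. poly g z = 0}"
    using assms(2) g by (intro card_mono poly_roots_finite) auto
  also have "\<dots> \<le> degree g" using g by (rule card_poly_roots_bound)
  finally show False using assms(1) g by simp
qed

lemma inverse_mod_p:
  assumes "\<not> p dvd k" obtains k' where "[k * k' = 1] (mod p)" "\<not> p dvd k'"
proof -
  have "coprime k p" using assms p_prime prime_imp_coprime coprime_commute by blast
  then obtain k' where k': "[k * k' = 1] (mod p)" using cong_solve_coprime_nat by auto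
  moreover have "\<not> p dvd k'"
    using k' p_gt_2 by (metis cong_dvd_iff dvd_mult nat_dvd_1_iff_1 numeral_less_iff less_irrefl one_less_numeral_iff semiring_norm(76) less_trans)
  ultimately show ?thesis using that by blast
qed

text \<open>The polynomial \<open>\<Prod>\<^sub>i f(T\<^sup>i)\<close>, whose value at \<open>\<zeta>\<close> is the norm of \<open>f(\<zeta>)\<close>, vanishes at all primitive
  \<open>p\<close>-th roots of unity. Hence the cyclotomic polynomial divides it, and the value \<open>f(1)\<^bsup>p-1\<^esup>\<close> at \<open>1\<close> is divisible by \<open>p\<close>. This
  is the form in which rational integers are separated from \<open>\<pp>\<close>; that the cyclotomic polynomial is the minimal
  polynomial of \<open>\<zeta>\<close> is a consequence.\<close>

lemma dvd_value_at_1: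
  assumes "ev f \<zeta> = 0" shows "int p dvd poly f 1"
proof -
  define F where "F = (\<Prod>i=1..p-1. f \<circ>\<^sub>p monom 1 i)"
  have F_root: "ev F (\<zeta> ^ j) = 0" if j: "j \<in> {1..p-1}" for j
  proof -
    have "\<not> p dvd j" using j by (auto dest!: dvd_imp_le)
    then obtain k where k: "[j * k = 1] (mod p)" "\<not> p dvd k" by (rule inverse_mod_p)
    define i where "i = k mod p"
    have i: "i \<in> {1..p-1}" using k p_gt_2 by (auto simp: i_def dvd_eq_mod_eq_0 Suc_le_eq less_Suc_eq_le[symmetric])
    have "[j * i = 1] (mod p)" using k(1) by (simp add: i_def cong_def mod_simps)
    then have "(\<zeta> ^ j) ^ i = \<zeta>" using zeta_pow_cong[of "j * i" 1] by (simp add: power_mult)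
    then have "ev (f \<circ>\<^sub>p monom 1 i) (\<zeta> ^ j) = 0" using assms by simp
    then show ?thesis unfolding F_def ev_prod using i by (intro prod_zero) auto
  qed
  obtain q r where qr: "F = cyclotomic * q + r" "r = 0 \<or> degree r < p - 1"
    by (rule cyclotomic_division)
  have "map_poly of_int r = (0 :: complex poly)"
  proof (rule few_roots_imp_0)
    show "map_poly of_int r = (0 :: complex poly) \<or> degree (map_poly of_int r :: complex poly) < p - 1"
      using qr(2) by (auto simp: degree_map_poly)
    fix j assume j: "j \<in> {1..p-1}"
    then have "\<not> p dvd j" by (auto dest!: dvd_imp_le)
    then have "ev r (\<zeta> ^ j) = 0" using F_root[OF j] by (simp add: qr(1) cyclotomic_root)
    then show "poly (map_poly of_int r) (\<zeta> ^ j) = 0" by (simp add: ev_def)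
  qed
  then have "r = 0" by (simp add: map_poly_eq_0_iff)
  then have "poly F 1 = int p * poly q 1"
    by (simp add: qr(1) cyclotomic_def poly_sum poly_monom)
  moreover have "poly F 1 = poly f 1 ^ (p - 1)"
    by (simp add: F_def poly_prod poly_pcompose poly_monom)
  ultimately have "int p dvd poly f 1 ^ (p - 1)" by (metis dvd_triv_left)
  then show ?thesis using p_prime prime_dvd_power[of "int p"] by auto
qed

lemma prod_root_differences: "(\<Prod>i=1..p-1. z - \<zeta> ^ i) = (\<Sum>i<p. z ^ i)"
proof -
  define P where "P = (\<Prod>i=1..p-1. [:- (\<zeta> ^ i), 1:])"
  define Q :: "complex poly" where "Q = (\<Sum>i<p. monom 1 i)"
  have P: "degree P = p - 1" "lead_coeff P = 1"
    unfolding P_def by (simp add: degree_prod_eq_sum_degree, subst lead_coeff_prod, simp)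
  have cQ: "coeff Q n = (if n < p then 1 else 0)" for n by (simp add: Q_def coeff_sum)
  have "degree (P - Q) \<le> p - 2"
  proof (rule degree_le, intro allI impI)
    fix n assume n: "n > p - 2"
    show "coeff (P - Q) n = 0"
    proof (cases "n = p - 1")
      case True then show ?thesis using P cQ p_gt_2 by simp
    next
      case False
      then have "n > p - 1" using n by simp
      then show ?thesis using P cQ[of n] coeff_eq_0[of P n] by simp
    qed
  qed
  then have "P - Q = 0 \<or> degree (P - Q) < p - 1" using p_gt_2 by linarith
  moreover have "poly (P - Q) (\<zeta> ^ j) = 0" if j: "j \<in> {1..p-1}" for j
  proof -
    have "\<not> p dvd j" using j by (auto dest!: dvd_imp_le)
    then have "poly Q (\<zeta> ^ j) = 0"
      using cyclotomic_root[of j] by (simp add: Q_def cyclotomic_def poly_sum poly_monom)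
    moreover have "poly P (\<zeta> ^ j) = 0"
      unfolding P_def poly_prod using j by (intro prod_zero) auto
    ultimately show ?thesis by simp
  qed
  ultimately have "P - Q = 0" by (rule few_roots_imp_0)
  then have "poly P z = poly Q z" by simp
  then show ?thesis by (simp add: P_def Q_def poly_prod poly_sum poly_monom)
qed

definition \<pi> :: complex where "\<pi> = 1 - \<zeta>"

lemma zint_pi [simp, intro]: "\<pi> \<in> zint" by (simp add: \<pi>_def)

lemma pi_nonzero [simp]: "\<pi> \<noteq> 0"
  using zeta_primitive p_gt_2 by (auto simp: \<pi>_def dest: bspec[of _ _ 1])

lemma one_minus_power_zdvd: "x \<in> zint \<Longrightarrow> 1 - x zdvd 1 - x ^ n"
  unfolding zdvd_def using one_diff_power_eq[of x n] by (intro bexI[of _ "\<Sum>i<n. x ^ i"]) auto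

text \<open>The elements \<open>1 - \<zeta>\<^sup>i\<close> are associated to each other, since each \<open>\<zeta>\<^sup>i\<close> is a power of any other one, and their
  product is the value \<open>p\<close> of the cyclotomic polynomial at \<open>1\<close>.\<close>

lemma p_assoc_pi_power:
  obtains v w where "v \<in> zint" "w \<in> zint" "v * w = 1" "of_nat p = \<pi> ^ (p - 1) * v"
proof -
  have "\<exists>v w. v \<in> zint \<and> w \<in> zint \<and> v * w = 1 \<and> 1 - \<zeta> ^ i = \<pi> * v" if i: "i \<in> {1..p-1}" for i
  proof -
    have nd: "\<not> p dvd i" using i by (auto dest!: dvd_imp_le)
    then obtain k where k: "[i * k = 1] (mod p)" by (rule inverse_mod_p)
    then have z: "(\<zeta> ^ i) ^ k = \<zeta>" using zeta_pow_cong[of "i * k" 1] by (simp add: power_mult)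
    obtain v where v: "v \<in> zint" "1 - \<zeta> ^ i = \<pi> * v"
      using one_minus_power_zdvd[of \<zeta> i] by (auto simp: zdvd_def \<pi>_def)
    obtain w where w: "w \<in> zint" "\<pi> = (1 - \<zeta> ^ i) * w"
      using one_minus_power_zdvd[of "\<zeta> ^ i" k] by (auto simp: zdvd_def \<pi>_def z)
    have "\<pi> * (v * w) = \<pi> * 1" using v w by (metis mult.assoc mult.right_neutral)
    then have "v * w = 1" by simp
    then show ?thesis using v w by blast
  qed
  then obtain v w where vw: "\<And>i. i \<in> {1..p-1} \<Longrightarrow> v i \<in> zint \<and> w i \<in> zint \<and> v i * w i = 1 \<and> 1 - \<zeta> ^ i = \<pi> * v i"
    by metis
  show ?thesis
  proof
    show "(\<Prod>i=1..p-1. v i) \<in> zint" "(\<Prod>i=1..p-1. w i) \<in> zint" using vw by blast+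
    show "(\<Prod>i=1..p-1. v i) * (\<Prod>i=1..p-1. w i) = 1" using vw by (simp flip: prod.distrib)
    have "of_nat p = (\<Prod>i=1..p-1. 1 - \<zeta> ^ i)" using prod_root_differences[of 1] by simp
    also have "\<dots> = (\<Prod>i=1..p-1. \<pi> * v i)" using vw by (intro prod.cong) auto
    finally show "of_nat p = \<pi> ^ (p - 1) * (\<Prod>i=1..p-1. v i)" by (simp add: prod.distrib)
  qed
qed

lemma pi_power_zdvd_p: "\<pi> ^ (p - 1) zdvd of_nat p"
  by (rule p_assoc_pi_power) (auto simp: zdvd_def)

lemma p_zdvd_pi_power: "of_nat p zdvd \<pi> ^ (p - 1)"
proof (rule p_assoc_pi_power)
  fix v w assume *: "v \<in> zint" "w \<in> zint" "v * w = 1" "of_nat p = \<pi> ^ (p - 1) * v"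
  then have "\<pi> ^ (p - 1) = of_nat p * w" by simp
  then show ?thesis using *(2) unfolding zdvd_def by blast
qed

lemma pi_zdvd_p: "\<pi> zdvd of_nat p"
  using zdvd_trans[OF zdvd_power_le[of 1 "p - 1" \<pi>] pi_power_zdvd_p] p_gt_2 by simp

lemma ev_cong_value_at_1: "\<pi> zdvd ev f \<zeta> - of_int (poly f 1)"
proof -
  have "poly (f - [:poly f 1:]) 1 = 0" by simp
  then obtain q where q: "f - [:poly f 1:] = [:- 1, 1:] * q"
    unfolding poly_eq_0_iff_dvd by (auto elim: dvdE)
  have "ev f \<zeta> - of_int (poly f 1) = ev (f - [:poly f 1:]) \<zeta>" by simp
  also have "\<dots> = \<pi> * (- ev q \<zeta>)" unfolding q by (simp add: ev_pCons \<pi>_def algebra_simps)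
  finally show ?thesis unfolding zdvd_def by (intro bexI[of _ "- ev q \<zeta>"]) auto
qed

lemma pi_zdvd_ev_iff: "\<pi> zdvd ev f \<zeta> \<longleftrightarrow> int p dvd poly f 1"
proof
  assume "\<pi> zdvd ev f \<zeta>"
  then obtain g where "ev f \<zeta> = \<pi> * ev g \<zeta>" by (auto simp: zdvd_def elim!: zintE)
  then have "ev (f - [:1, - 1:] * g) \<zeta> = 0" by (simp add: ev_pCons \<pi>_def algebra_simps)
  from dvd_value_at_1[OF this] show "int p dvd poly f 1" by simp
next
  assume "int p dvd poly f 1"
  then have "\<pi> zdvd of_int (poly f 1)"
    using zdvd_trans[OF pi_zdvd_p] zdvd_of_int[of "int p"] by simp
  from zdvd_add[OF ev_cong_value_at_1[of f] this] show "\<pi> zdvd ev f \<zeta>" by simp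
qed

lemma pi_zdvd_of_int_iff: "\<pi> zdvd of_int c \<longleftrightarrow> int p dvd c"
  using pi_zdvd_ev_iff[of "[:c:]"] by simp

lemma pi_prime:
  assumes "x \<in> zint" "y \<in> zint" "\<pi> zdvd x * y" shows "\<pi> zdvd x \<or> \<pi> zdvd y"
  using assms(1,2)
proof (elim zintE)
  fix f g assume fg: "x = ev f \<zeta>" "y = ev g \<zeta>"
  then have "int p dvd poly f 1 * poly g 1" using assms(3) pi_zdvd_ev_iff[of "f * g"] by simp
  then show ?thesis using fg p_prime by (simp add: prime_dvd_mult_iff pi_zdvd_ev_iff)
qed

text \<open>Since \<open>p\<close> is \<open>\<pi>\<^bsup>p-1\<^esup>\<close> up to a unit, a constant term divisible by \<open>\<pi>\<close> is divisible by \<open>\<pi>\<^bsup>p-1\<^esup>\<close>, and the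
  argument can be repeated for the next coefficient.\<close>

lemma coeffs_dvd_of_pi_power:
  "j \<le> p - 1 \<Longrightarrow> \<pi> ^ j zdvd ev g (\<zeta> - 1) \<Longrightarrow> i < j \<Longrightarrow> int p dvd coeff g i"
proof (induction j arbitrary: g i)
  case 0 then show ?case by simp
next
  case (Suc j)
  obtain c h where g: "g = pCons c h" by (cases g)
  have e: "ev g (\<zeta> - 1) = of_int c - \<pi> * ev h (\<zeta> - 1)" by (simp add: g ev_pCons \<pi>_def algebra_simps)
  have "\<pi> zdvd ev g (\<zeta> - 1)"
    using zdvd_trans[OF zdvd_power_le[of 1 "Suc j" \<pi>] Suc.prems(2)] by simp
  moreover have "\<pi> zdvd \<pi> * ev h (\<zeta> - 1)" by (intro zdvd_mult) auto
  ultimately have "\<pi> zdvd of_int c" using zdvd_add e by (metis diff_add_cancel)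
  then have pc: "int p dvd c" by (simp add: pi_zdvd_of_int_iff)
  have "\<pi> ^ Suc j zdvd \<pi> ^ (p - 1)" using Suc.prems(1) by (intro zdvd_power_le) auto
  also have "\<dots> zdvd of_int (int p)" using pi_power_zdvd_p by simp
  also have "\<dots> zdvd of_int c" by (rule zdvd_of_int[OF pc])
  finally have "\<pi> ^ Suc j zdvd \<pi> * ev h (\<zeta> - 1)"
    using zdvd_diff[OF _ Suc.prems(2)] e by (metis diff_diff_eq2 add_diff_cancel_left')
  then have "\<pi> ^ j zdvd ev h (\<zeta> - 1)" by (simp add: zdvd_mult_cancel)
  then have "\<And>i. i < j \<Longrightarrow> int p dvd coeff h i" using Suc.IH Suc.prems(1) by simp
  then show ?case using pc Suc.prems(3) by (cases i) (auto simp: g)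
qed

lemma coeffs_dvd_of_zdvd_p:
  assumes "degree f < p - 1" "of_nat p zdvd ev f \<zeta>" shows "\<exists>h. f = smult (int p) h"
proof -
  define g where "g = f \<circ>\<^sub>p [:1, 1:]"
  have dg: "degree g = degree f" by (simp add: g_def degree_pcompose)
  have "\<pi> ^ (p - 1) zdvd ev g (\<zeta> - 1)"
    using zdvd_trans[OF pi_power_zdvd_p assms(2)] by (simp add: g_def ev_pCons)
  then have "int p dvd coeff g i" if "i < p - 1" for i
    using coeffs_dvd_of_pi_power[of "p - 1" g i] that by simp
  moreover have "coeff g i = 0" if "\<not> i < p - 1" for i
    using that assms(1) dg by (intro coeff_eq_0) simp
  ultimately have "\<And>i. int p dvd coeff g i" by (metis dvd_0_right)
  then have "[:int p:] dvd g" by (simp add: const_poly_dvd_iff)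
  then obtain h where "g = smult (int p) h" by (auto elim: dvdE)
  then have "g \<circ>\<^sub>p [:- 1, 1:] = smult (int p) (h \<circ>\<^sub>p [:- 1, 1:])" by (simp add: pcompose_smult)
  moreover have "g \<circ>\<^sub>p [:- 1, 1:] = f"
    by (simp add: g_def pcompose_assoc[symmetric] pcompose_pCons)
  ultimately show ?thesis by metis
qed

text \<open>Descent: \<open>p\<close> can be cancelled from \<open>f\<close> again and again. In particular, the powers of \<open>\<zeta>\<close> below \<open>p - 1\<close> are linearly
  independent, and no nonzero element is divisible by all powers of \<open>\<pi>\<close>.\<close>

lemma coeff_eq_0_of_p_divisible:
  assumes "degree f < p - 1" "\<And>n. of_nat p ^ n zdvd ev f \<zeta>" shows "f = 0"
proof -
  have "\<exists>h. f = smult (int p ^ n) h \<and> degree h < p - 1" for n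
    using assms
  proof (induction n arbitrary: f)
    case 0 then show ?case by auto
  next
    case (Suc n)
    obtain g where g: "f = smult (int p) g"
      using coeffs_dvd_of_zdvd_p Suc.prems(1) Suc.prems(2)[of 1] by auto
    have "degree g < p - 1" using Suc.prems(1) g p_gt_2 by simp
    moreover have "of_nat p ^ k zdvd ev g \<zeta>" for k
      using Suc.prems(2)[of "Suc k"] p_gt_2 by (simp add: g zdvd_mult_cancel)
    ultimately obtain h where "g = smult (int p ^ n) h" "degree h < p - 1" using Suc.IH by blast
    then show ?case using g by (auto simp: mult.commute)
  qed
  then have "int p ^ n dvd coeff f i" for n i by (metis coeff_smult dvd_triv_left)
  then have "coeff f i = 0" for i using int_dvd_all_powers_imp_0[of p "coeff f i"] p_gt_2 by simp
  then show ?thesis by (simp add: poly_eq_iff)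
qed

lemma cyclotomic_dvd_of_root:
  assumes "ev f \<zeta> = 0" shows "cyclotomic dvd f"
proof -
  obtain q r where qr: "f = cyclotomic * q + r" "r = 0 \<or> degree r < p - 1"
    by (rule cyclotomic_division)
  have z: "ev cyclotomic \<zeta> = 0" using cyclotomic_root[of 1] p_gt_2 by (simp add: nat_dvd_1_iff_1)
  have "ev r \<zeta> = 0" using assms z by (simp add: qr(1))
  then have "r = 0" using coeff_eq_0_of_p_divisible[of r] qr(2) by auto
  then show ?thesis using qr(1) by simp
qed

lemma ev_conjugate_eq_0_iff:
  assumes "\<not> p dvd k" shows "ev f (\<zeta> ^ k) = 0 \<longleftrightarrow> ev f \<zeta> = 0"
proof
  assume "ev f \<zeta> = 0"
  then obtain q where "f = cyclotomic * q" using cyclotomic_dvd_of_root by (blast elim: dvdE)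
  then show "ev f (\<zeta> ^ k) = 0" using cyclotomic_root[OF assms] by simp
next
  assume 0: "ev f (\<zeta> ^ k) = 0"
  obtain k' where k': "[k * k' = 1] (mod p)" "\<not> p dvd k'" by (rule inverse_mod_p[OF assms])
  have "ev (f \<circ>\<^sub>p monom 1 k) \<zeta> = 0" using 0 by simp
  then obtain q where q: "f \<circ>\<^sub>p monom 1 k = cyclotomic * q"
    using cyclotomic_dvd_of_root by (blast elim: dvdE)
  have "ev (f \<circ>\<^sub>p monom 1 k) (\<zeta> ^ k') = 0"
    unfolding q using cyclotomic_root[OF k'(2)] by simp
  moreover have "(\<zeta> ^ k') ^ k = \<zeta>"
    using zeta_pow_cong[OF k'(1)] by (simp add: power_mult[symmetric] mult.commute)
  ultimately show "ev f \<zeta> = 0" by simp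
qed

lemma pi_divisible_imp_0:
  assumes "x \<in> zint" "\<And>n. \<pi> ^ n zdvd x" shows "x = 0"
proof -
  obtain f0 where f0: "x = ev f0 \<zeta>" using assms(1) by (rule zintE)
  obtain q f where qf: "f0 = cyclotomic * q + f" "f = 0 \<or> degree f < p - 1"
    by (rule cyclotomic_division)
  have x: "x = ev f \<zeta>" using cyclotomic_root[of 1] p_gt_2 by (simp add: f0 qf(1) nat_dvd_1_iff_1)
  have "of_nat p ^ n zdvd ev f \<zeta>" for n
  proof -
    have "of_nat p ^ n zdvd (\<pi> ^ (p - 1)) ^ n" by (rule zdvd_power_mono[OF p_zdvd_pi_power])
    also have "\<dots> zdvd x" using assms(2)[of "(p - 1) * n"] by (simp add: power_mult)
    finally show ?thesis by (simp add: x)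
  qed
  then have "f = 0" using qf(2) coeff_eq_0_of_p_divisible[of f] by auto
  then show ?thesis by (simp add: x)
qed

lemma pi_factorization:
  assumes "x \<in> zint" "x \<noteq> 0"
  obtains n u where "u \<in> zint" "\<not> \<pi> zdvd u" "x = \<pi> ^ n * u"
proof -
  define n where "n = (LEAST n. \<not> \<pi> ^ n zdvd x)"
  obtain m where "\<not> \<pi> ^ m zdvd x" using assms pi_divisible_imp_0 by blast
  then have n: "\<not> \<pi> ^ n zdvd x" "\<And>k. k < n \<Longrightarrow> \<pi> ^ k zdvd x"
    unfolding n_def using LeastI[of "\<lambda>n. \<not> \<pi> ^ n zdvd x" m] not_less_Least by blast+
  have "n \<noteq> 0"
  proof
    assume "n = 0"
    then have "\<pi> ^ n zdvd x" using assms(1) by (auto simp: zdvd_def)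
    then show False using n(1) by simp
  qed
  then obtain k where k: "n = Suc k" by (cases n) auto
  obtain u where u: "u \<in> zint" "x = \<pi> ^ k * u" using n(2)[of k] k by (auto simp: zdvd_def)
  have "\<not> \<pi> zdvd u"
    using n(1) u unfolding k by (auto simp: zdvd_def mult.assoc mult.left_commute)
  then show ?thesis using that u by blast
qed

end


section \<open>The cyclotomic field, its automorphisms and its valuation\<close>

lemma ring_of_type_algebra_simps [simp]:
  "carrier ring_of_type_algebra = UNIV" "\<one>\<^bsub>ring_of_type_algebra\<^esub> = 1" "\<zero>\<^bsub>ring_of_type_algebra\<^esub> = 0"
  "x \<oplus>\<^bsub>ring_of_type_algebra\<^esub> y = x + y" "x \<otimes>\<^bsub>ring_of_type_algebra\<^esub> y = x * y"
  by (simp_all add: ring_of_type_algebra_def)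

lemma ring_of_type_algebra_inverses:
  fixes x :: complex
  shows "\<ominus>\<^bsub>ring_of_type_algebra\<^esub> x = - x"
    and "x \<noteq> 0 \<Longrightarrow> inv\<^bsub>ring_of_type_algebra\<^esub> x = inverse x"
proof -
  interpret R: field "ring_of_type_algebra :: complex ring" by (rule field_from_type_algebra)
  show "\<ominus>\<^bsub>ring_of_type_algebra\<^esub> x = - x" by (rule R.minus_equality) auto
  assume "x \<noteq> 0"
  then show "inv\<^bsub>ring_of_type_algebra\<^esub> x = inverse x" by (intro R.comm_inv_char) auto
qed

context prime_cyclotomic
begin

definition cfield :: "complex set" where
  "cfield = {u / w | u w. u \<in> zint \<and> w \<in> zint \<and> w \<noteq> 0}"

lemma cfieldI: "u \<in> zint \<Longrightarrow> w \<in> zint \<Longrightarrow> w \<noteq> 0 \<Longrightarrow> u / w \<in> cfield"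
  by (auto simp: cfield_def)

lemma cfieldE:
  assumes "x \<in> cfield" obtains u w where "u \<in> zint" "w \<in> zint" "w \<noteq> 0" "x = u / w"
  using assms by (auto simp: cfield_def)

lemma zint_cfield [simp]: "x \<in> zint \<Longrightarrow> x \<in> cfield"
  using cfieldI[of x 1] by simp

lemma cfield_add [simp]: "x \<in> cfield \<Longrightarrow> y \<in> cfield \<Longrightarrow> x + y \<in> cfield"
proof (elim cfieldE)
  fix u w u' w' assume *: "u \<in> zint" "w \<in> zint" "w \<noteq> 0" "x = u / w" "u' \<in> zint" "w' \<in> zint" "w' \<noteq> 0" "y = u' / w'"
  then have "x + y = (u * w' + u' * w) / (w * w')" by (simp add: field_simps)
  then show ?thesis using * by (auto intro!: cfieldI simp del: times_divide_eq_left)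
qed

lemma cfield_mult [simp]: "x \<in> cfield \<Longrightarrow> y \<in> cfield \<Longrightarrow> x * y \<in> cfield"
  by (elim cfieldE) (auto intro!: cfieldI simp: times_divide_times_eq simp del: times_divide_eq_left times_divide_eq_right)

lemma cfield_uminus [simp]: "x \<in> cfield \<Longrightarrow> - x \<in> cfield"
  using cfield_mult[of "-1" x] by simp

lemma cfield_diff [simp]: "x \<in> cfield \<Longrightarrow> y \<in> cfield \<Longrightarrow> x - y \<in> cfield"
  using cfield_add[of x "- y"] by simp

lemma cfield_inverse [simp]: "x \<in> cfield \<Longrightarrow> inverse x \<in> cfield"
  by (elim cfieldE, cases "x = 0") (auto intro!: cfieldI)

lemma cfield_power [simp]: "x \<in> cfield \<Longrightarrow> x ^ n \<in> cfield"
  by (induction n) auto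

lemma cyc_int_carrier: "carrier (cyc_int \<zeta>) = zint"
proof -
  have "x \<in> zint" if "x \<in> generate_ring ring_of_type_algebra {\<zeta>}" for x
    using that by induction (auto simp: ring_of_type_algebra_inverses)
  moreover have "ev f \<zeta> \<in> generate_ring ring_of_type_algebra {\<zeta>}" for f
  proof -
    have one: "1 \<in> generate_ring ring_of_type_algebra {\<zeta>}"
      using generate_ring.one[of "ring_of_type_algebra :: complex ring"] by simp
    have minus: "- x \<in> generate_ring ring_of_type_algebra {\<zeta>}" if "x \<in> generate_ring ring_of_type_algebra {\<zeta>}" for x
      using generate_ring.a_inv[OF that] by (simp add: ring_of_type_algebra_inverses)
    have add: "x + y \<in> generate_ring ring_of_type_algebra {\<zeta>}"
      if "x \<in> generate_ring ring_of_type_algebra {\<zeta>}" "y \<in> generate_ring ring_of_type_algebra {\<zeta>}" for x y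
      using generate_ring.eng_add[OF that] by simp
    have c: "of_int c \<in> generate_ring ring_of_type_algebra {\<zeta>}" for c
    proof (induction c rule: int_induct[where k = 0])
      case base then show ?case using add[OF one minus[OF one]] by simp
    next
      case (step1 i) then show ?case using add[OF _ one] by simp
    next
      case (step2 i) then show ?case using add[OF _ minus[OF one]] by simp
    qed
    show ?thesis
    proof (induction f)
      case 0 then show ?case using c[of 0] by simp
    next
      case (pCons a f)
      have "\<zeta> * ev f \<zeta> \<in> generate_ring ring_of_type_algebra {\<zeta>}"
        using generate_ring.eng_mult[OF generate_ring.incl pCons.IH, of \<zeta>] by simp
      then show ?case using add c by (simp add: ev_pCons)
    qed
  qed
  ultimately show ?thesis by (auto simp: cyc_int_def elim!: zintE)
qed

lemma cyc_field_carrier: "carrier (cyc_field \<zeta>) = cfield"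
proof -
  let ?G = "generate_field ring_of_type_algebra {\<zeta>}"
  have "x \<in> cfield" if "x \<in> ?G" for x
    using that by induction (auto simp: ring_of_type_algebra_inverses)
  moreover have "x \<in> ?G" if "x \<in> cfield" for x
  proof -
    have sub: "y \<in> ?G" if "y \<in> generate_ring ring_of_type_algebra {\<zeta>}" for y
      using that by induction (blast intro: generate_field.intros)+
    have z: "zint \<subseteq> ?G" using sub cyc_int_carrier by (auto simp: cyc_int_def)
    obtain u w where uw: "u \<in> zint" "w \<in> zint" "w \<noteq> 0" "x = u / w" using \<open>x \<in> cfield\<close> by (rule cfieldE)
    have "inverse w \<in> ?G"
      using generate_field.m_inv[of w ring_of_type_algebra "{\<zeta>}"] uw z
      by (auto simp: ring_of_type_algebra_inverses)
    then have "u * inverse w \<in> ?G"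
      using generate_field.eng_mult[of u ring_of_type_algebra "{\<zeta>}" "inverse w"] uw z by auto
    then show ?thesis using uw by (simp add: divide_inverse)
  qed
  ultimately show ?thesis by (auto simp: cyc_field_def)
qed

lemma cyc_field_simps [simp]:
  "\<one>\<^bsub>cyc_field \<zeta>\<^esub> = 1" "\<zero>\<^bsub>cyc_field \<zeta>\<^esub> = 0"
  "x \<oplus>\<^bsub>cyc_field \<zeta>\<^esub> y = x + y" "x \<otimes>\<^bsub>cyc_field \<zeta>\<^esub> y = x * y"
  by (simp_all add: cyc_field_def ring_of_type_algebra_def)

lemma cyc_int_simps [simp]:
  "\<one>\<^bsub>cyc_int \<zeta>\<^esub> = 1" "\<zero>\<^bsub>cyc_int \<zeta>\<^esub> = 0"
  "x \<oplus>\<^bsub>cyc_int \<zeta>\<^esub> y = x + y" "x \<otimes>\<^bsub>cyc_int \<zeta>\<^esub> y = x * y"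
  by (simp_all add: cyc_int_def ring_of_type_algebra_def)

lemma field_cyc_field: "field (cyc_field \<zeta>)"
proof -
  interpret R: field "ring_of_type_algebra :: complex ring" by (rule field_from_type_algebra)
  show ?thesis unfolding cyc_field_def by (rule R.generate_field_is_field) auto
qed

lemma cyc_field_uminus: "x \<in> cfield \<Longrightarrow> \<ominus>\<^bsub>cyc_field \<zeta>\<^esub> x = - x"
proof -
  interpret K: field "cyc_field \<zeta>" by (rule field_cyc_field)
  show "x \<in> cfield \<Longrightarrow> \<ominus>\<^bsub>cyc_field \<zeta>\<^esub> x = - x"
    by (rule K.minus_equality) (auto simp: cyc_field_carrier)
qed

lemma cyc_field_minus: "x \<in> cfield \<Longrightarrow> y \<in> cfield \<Longrightarrow> x \<ominus>\<^bsub>cyc_field \<zeta>\<^esub> y = x - y"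
  by (simp add: a_minus_def cyc_field_uminus)

lemma cyc_field_pow: "x [^]\<^bsub>cyc_field \<zeta>\<^esub> (n :: nat) = x ^ n"
proof -
  interpret K: field "cyc_field \<zeta>" by (rule field_cyc_field)
  show ?thesis by (induction n) simp_all
qed

lemma cyc_prime_eq: "cyc_prime \<zeta> = {x. \<pi> zdvd x}"
  by (auto simp: cyc_prime_def cgenideal_def cyc_int_carrier zdvd_def \<pi>_def mult.commute)

text \<open>The value at \<open>f(\<zeta>)/g(\<zeta>)\<close> does not depend on the choice of \<open>f\<close> and \<open>g\<close>, because the conjugates of
  \<open>\<zeta>\<close> satisfy the same integral polynomial equations.\<close>

lemma conjugation_exists:
  assumes "\<not> p dvd k"
  obtains \<sigma> where "\<sigma> \<in> ring_iso (cyc_field \<zeta>) (cyc_field \<zeta>)" "\<sigma> \<in> extensional (carrier (cyc_field \<zeta>))"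
    "\<And>f g. ev g \<zeta> \<noteq> 0 \<Longrightarrow> \<sigma> (ev f \<zeta> / ev g \<zeta>) = ev f (\<zeta> ^ k) / ev g (\<zeta> ^ k)"
proof -
  define P where "P = (\<lambda>x (f, g). ev g \<zeta> \<noteq> 0 \<and> x = ev f \<zeta> / ev g \<zeta>)"
  define \<sigma> where "\<sigma> = (\<lambda>x\<in>cfield. let (f, g) = (SOME fg. P x fg) in ev f (\<zeta> ^ k) / ev g (\<zeta> ^ k))"
  have nz: "ev g (\<zeta> ^ k) = 0 \<longleftrightarrow> ev g \<zeta> = 0" for g using ev_conjugate_eq_0_iff[OF assms] .
  have \<sigma>: "\<sigma> (ev f \<zeta> / ev g \<zeta>) = ev f (\<zeta> ^ k) / ev g (\<zeta> ^ k)" if g: "ev g \<zeta> \<noteq> 0" for f g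
  proof -
    let ?x = "ev f \<zeta> / ev g \<zeta>"
    have "P ?x (SOME fg. P ?x fg)" by (rule someI[of _ "(f, g)"]) (simp add: P_def g)
    moreover obtain f' g' where fg: "(SOME fg. P ?x fg) = (f', g')" by force
    ultimately have 1: "ev g' \<zeta> \<noteq> 0" "?x = ev f' \<zeta> / ev g' \<zeta>" by (simp_all add: P_def)
    then have "ev (f * g' - f' * g) \<zeta> = 0" using g by (simp add: field_simps)
    then have "ev (f * g' - f' * g) (\<zeta> ^ k) = 0" using nz by blast
    then have "ev f (\<zeta> ^ k) / ev g (\<zeta> ^ k) = ev f' (\<zeta> ^ k) / ev g' (\<zeta> ^ k)"
      using g 1(1) nz by (simp add: field_simps)
    then show ?thesis using g by (simp add: \<sigma>_def fg cfieldI)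
  qed
  have "\<sigma> \<in> ring_hom (cyc_field \<zeta>) (cyc_field \<zeta>)"
  proof (rule ring_hom_memI)
    show "\<sigma> \<one>\<^bsub>cyc_field \<zeta>\<^esub> = \<one>\<^bsub>cyc_field \<zeta>\<^esub>" using \<sigma>[of 1 1] by simp
  next
    fix x assume "x \<in> carrier (cyc_field \<zeta>)"
    then show "\<sigma> x \<in> carrier (cyc_field \<zeta>)"
      unfolding cyc_field_carrier
    proof (elim cfieldE zintE)
      fix u w f g assume "w \<noteq> 0" "x = u / w" "u = ev f \<zeta>" "w = ev g \<zeta>"
      then show "\<sigma> x \<in> cfield" using \<sigma>[of g f] nz by (auto intro!: cfieldI)
    qed
  next
    fix x y assume "x \<in> carrier (cyc_field \<zeta>)" "y \<in> carrier (cyc_field \<zeta>)"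
    then obtain f g f' g' where *: "ev g \<zeta> \<noteq> 0" "x = ev f \<zeta> / ev g \<zeta>" "ev g' \<zeta> \<noteq> 0" "y = ev f' \<zeta> / ev g' \<zeta>"
      unfolding cyc_field_carrier by (elim cfieldE zintE) auto
    have nz': "ev g (\<zeta> ^ k) \<noteq> 0" "ev g' (\<zeta> ^ k) \<noteq> 0" using * nz by auto
    have sx: "\<sigma> x = ev f (\<zeta> ^ k) / ev g (\<zeta> ^ k)" "\<sigma> y = ev f' (\<zeta> ^ k) / ev g' (\<zeta> ^ k)"
      unfolding * by (rule \<sigma>; fact)+
    have "x * y = ev (f * f') \<zeta> / ev (g * g') \<zeta>" using * by simp
    then have "\<sigma> (x * y) = ev (f * f') (\<zeta> ^ k) / ev (g * g') (\<zeta> ^ k)"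
      using \<sigma>[of "g * g'" "f * f'"] * by simp
    then show "\<sigma> (x \<otimes>\<^bsub>cyc_field \<zeta>\<^esub> y) = \<sigma> x \<otimes>\<^bsub>cyc_field \<zeta>\<^esub> \<sigma> y"
      by (simp add: sx)
    have "x + y = ev (f * g' + f' * g) \<zeta> / ev (g * g') \<zeta>"
      unfolding *(2,4) using *(1,3) by (simp add: add_frac_eq)
    then have "\<sigma> (x + y) = ev (f * g' + f' * g) (\<zeta> ^ k) / ev (g * g') (\<zeta> ^ k)"
      using \<sigma>[of "g * g'" "f * g' + f' * g"] * by simp
    also have "\<dots> = \<sigma> x + \<sigma> y" unfolding sx using nz' by (simp add: add_frac_eq)
    finally show "\<sigma> (x \<oplus>\<^bsub>cyc_field \<zeta>\<^esub> y) = \<sigma> x \<oplus>\<^bsub>cyc_field \<zeta>\<^esub> \<sigma> y" by simp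
  qed
  moreover have "bij_betw \<sigma> cfield cfield"
  proof -
    obtain k' where k': "[k * k' = 1] (mod p)" "\<not> p dvd k'" by (rule inverse_mod_p[OF assms])
    have zk: "(\<zeta> ^ k) ^ k' = \<zeta>" using zeta_pow_cong[OF k'(1)] by (simp add: power_mult)
    have "inj_on \<sigma> cfield"
    proof (rule inj_onI)
      fix x y assume "x \<in> cfield" "y \<in> cfield" and eq: "\<sigma> x = \<sigma> y"
      then obtain f g f' g' where *: "ev g \<zeta> \<noteq> 0" "x = ev f \<zeta> / ev g \<zeta>" "ev g' \<zeta> \<noteq> 0" "y = ev f' \<zeta> / ev g' \<zeta>"
        by (elim cfieldE zintE) auto
      have "ev f (\<zeta> ^ k) / ev g (\<zeta> ^ k) = ev f' (\<zeta> ^ k) / ev g' (\<zeta> ^ k)"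
        using eq unfolding * \<sigma>[OF *(1)] \<sigma>[OF *(3)] .
      then have "ev (f * g' - f' * g) (\<zeta> ^ k) = 0" using *(1,3) nz by (simp add: frac_eq_eq)
      then have "ev (f * g' - f' * g) \<zeta> = 0" using nz by blast
      then show "x = y" unfolding *(2,4) using *(1,3) by (simp add: frac_eq_eq)
    qed
    moreover have "\<sigma> ` cfield = cfield"
    proof
      show "\<sigma> ` cfield \<subseteq> cfield"
        using calculation \<open>\<sigma> \<in> ring_hom _ _\<close> by (auto dest: ring_hom_closed simp: cyc_field_carrier)
      show "cfield \<subseteq> \<sigma> ` cfield"
      proof
        fix x assume "x \<in> cfield"
        then obtain f g where *: "ev g \<zeta> \<noteq> 0" "x = ev f \<zeta> / ev g \<zeta>" by (elim cfieldE zintE) auto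
        let ?f = "f \<circ>\<^sub>p monom 1 k'" and ?g = "g \<circ>\<^sub>p monom 1 k'"
        have g: "ev ?g \<zeta> \<noteq> 0" using * nz[of ?g] zk by simp
        have "\<sigma> (ev ?f \<zeta> / ev ?g \<zeta>) = x" using \<sigma>[OF g, of ?f] * zk by simp
        moreover have "ev ?f \<zeta> / ev ?g \<zeta> \<in> cfield" using g by (intro cfieldI) auto
        ultimately show "x \<in> \<sigma> ` cfield" by blast
      qed
    qed
    ultimately show ?thesis by (simp add: bij_betw_def)
  qed
  ultimately have "\<sigma> \<in> ring_iso (cyc_field \<zeta>) (cyc_field \<zeta>)"
    by (simp add: ring_iso_def cyc_field_carrier)
  moreover have "\<sigma> \<in> extensional (carrier (cyc_field \<zeta>))" by (simp add: \<sigma>_def cyc_field_carrier)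
  ultimately show ?thesis using that \<sigma> by blast
qed

lemma ring_hom_cyc_field_ev:
  assumes "\<tau> \<in> ring_hom (cyc_field \<zeta>) (cyc_field \<zeta>)" "\<tau> \<zeta> = \<zeta> ^ k"
  shows "\<tau> (ev f \<zeta>) = ev f (\<zeta> ^ k)"
proof -
  have add: "\<tau> (x + y) = \<tau> x + \<tau> y" and mult: "\<tau> (x * y) = \<tau> x * \<tau> y" if "x \<in> cfield" "y \<in> cfield" for x y
    using ring_hom_add[OF assms(1), of x y] ring_hom_mult[OF assms(1), of x y] that by (simp_all add: cyc_field_carrier)
  have one: "\<tau> 1 = 1" using ring_hom_one[OF assms(1)] by simp
  have zero: "\<tau> 0 = 0" using add[of 0 0] by simp
  have int: "\<tau> (of_int c) = of_int c" for c
  proof (induction c rule: int_induct[where k = 0])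
    case base then show ?case using zero by simp
  next
    case (step1 i) then show ?case using add[of "of_int i" 1] one by simp
  next
    case (step2 i)
    then have "of_int i = \<tau> (of_int (i - 1)) + 1" using add[of "of_int (i - 1)" 1] one by simp
    then show ?case by (metis add_diff_cancel_right' of_int_1 of_int_diff)
  qed
  show ?thesis
    by (induction f) (simp_all add: ev_pCons zero add mult int assms(2))
qed

lemma gal_quotient:
  assumes "\<not> p dvd k" "ev g \<zeta> \<noteq> 0"
  shows "gal \<zeta> k (ev f \<zeta> / ev g \<zeta>) = ev f (\<zeta> ^ k) / ev g (\<zeta> ^ k)"
proof -
  obtain \<sigma> where \<sigma>: "\<sigma> \<in> ring_iso (cyc_field \<zeta>) (cyc_field \<zeta>)" "\<sigma> \<in> extensional (carrier (cyc_field \<zeta>))"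
    "\<And>f g. ev g \<zeta> \<noteq> 0 \<Longrightarrow> \<sigma> (ev f \<zeta> / ev g \<zeta>) = ev f (\<zeta> ^ k) / ev g (\<zeta> ^ k)"
    using conjugation_exists[OF assms(1)] by metis
  have "gal \<zeta> k = \<sigma>" unfolding gal_def
  proof (rule the_equality)
    show "\<sigma> \<in> ring_iso (cyc_field \<zeta>) (cyc_field \<zeta>) \<and> \<sigma> \<in> extensional (carrier (cyc_field \<zeta>)) \<and> \<sigma> \<zeta> = \<zeta> ^ k"
      using \<sigma>(1,2) \<sigma>(3)[of 1 "monom 1 1"] by simp
  next
    fix \<tau> assume \<tau>: "\<tau> \<in> ring_iso (cyc_field \<zeta>) (cyc_field \<zeta>) \<and> \<tau> \<in> extensional (carrier (cyc_field \<zeta>)) \<and> \<tau> \<zeta> = \<zeta> ^ k"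
    then have hom: "\<tau> \<in> ring_hom (cyc_field \<zeta>) (cyc_field \<zeta>)" by (simp add: ring_iso_def)
    show "\<tau> = \<sigma>"
    proof (rule extensionalityI)
      fix x assume "x \<in> carrier (cyc_field \<zeta>)"
      then obtain f g where *: "ev g \<zeta> \<noteq> 0" "x = ev f \<zeta> / ev g \<zeta>"
        unfolding cyc_field_carrier by (elim cfieldE zintE) auto
      have "\<tau> (x * ev g \<zeta>) = \<tau> x * \<tau> (ev g \<zeta>)"
        using ring_hom_mult[OF hom, of x "ev g \<zeta>"] \<open>x \<in> carrier _\<close> by (simp add: cyc_field_carrier)
      then have "ev f (\<zeta> ^ k) = \<tau> x * ev g (\<zeta> ^ k)"
        using * ring_hom_cyc_field_ev[OF hom] \<tau> by simp
      then have "\<tau> x = ev f (\<zeta> ^ k) / ev g (\<zeta> ^ k)"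
        using *(1) ev_conjugate_eq_0_iff[OF assms(1)] by simp
      also have "\<dots> = \<sigma> x" unfolding *(2) by (rule sym[OF \<sigma>(3)[OF *(1)]])
      finally show "\<tau> x = \<sigma> x" .
    qed (use \<tau> \<sigma> in auto)
  qed
  then show ?thesis using \<sigma>(3) assms by simp
qed

definition punits :: "complex set" where
  "punits = {x \<in> zint. \<not> \<pi> zdvd x}"

lemma punits_zint: "x \<in> punits \<Longrightarrow> x \<in> zint" by (simp add: punits_def)

lemma punits_mult [simp]: "x \<in> punits \<Longrightarrow> y \<in> punits \<Longrightarrow> x * y \<in> punits"
  using pi_prime by (auto simp: punits_def)

lemma punits_1 [simp]: "1 \<in> punits"
  using pi_zdvd_of_int_iff[of 1] p_gt_2 by (simp add: punits_def)

lemma punits_nonzero: "x \<in> punits \<Longrightarrow> x \<noteq> 0"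
  by (auto simp: punits_def)

lemma punits_power [simp]: "x \<in> punits \<Longrightarrow> x ^ n \<in> punits"
  by (induction n) auto

lemma pi_power_zdvd_cancel:
  assumes "w \<in> punits" "x \<in> zint" "\<pi> ^ n zdvd w * x" shows "\<pi> ^ n zdvd x"
  using assms(2,3)
proof (induction n arbitrary: x)
  case 0 then show ?case by (auto simp: zdvd_def)
next
  case (Suc n)
  have "\<pi> zdvd w * x" using zdvd_trans[OF zdvd_power_le[of 1 "Suc n" \<pi>] Suc.prems(2)] by simp
  then have "\<pi> zdvd x" using assms(1) Suc.prems pi_prime by (auto simp: punits_def)
  then obtain y where y: "y \<in> zint" "x = \<pi> * y" by (auto simp: zdvd_def)
  have "\<pi> ^ n zdvd w * y"
    using Suc.prems(2)
    unfolding y power_Suc mult.left_commute[of w \<pi> y] zdvd_mult_cancel[OF pi_nonzero] .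
  then show ?case using Suc.IH y by (simp add: zdvd_mult_cancel)
qed

lemma cyc_val_unique_aux:
  assumes "u \<in> punits" "w \<in> punits" "u' \<in> punits" "w' \<in> punits"
    "\<pi> powi n * u / w = \<pi> powi m * u' / w'"
  shows "\<not> n < m"
proof
  assume "n < m"
  define k where "k = nat (m - n)"
  have k: "m = n + int k" "k > 0" using \<open>n < m\<close> by (auto simp: k_def)
  have nz: "w \<noteq> 0" "w' \<noteq> 0" using assms punits_nonzero by auto
  have "\<pi> powi n * (u * w') = \<pi> powi n * (\<pi> ^ k * (u' * w))"
    using assms(5) nz by (simp add: k power_int_add field_simps)
  then have "u * w' = \<pi> ^ k * (u' * w)" by simp
  moreover have "\<pi> zdvd \<pi> ^ k * (u' * w)"
    using zdvd_power_le[of 1 k \<pi>] k assms by (intro zdvd_mult) (auto simp: punits_zint)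
  moreover have "u * w' \<in> punits" using assms by simp
  ultimately show False by (simp add: punits_def)
qed

lemma cyc_val_eq:
  assumes "u \<in> punits" "w \<in> punits" shows "cyc_val \<zeta> (\<pi> powi n * u / w) = n"
proof -
  have S: "carrier (cyc_int \<zeta>) - cyc_prime \<zeta> = punits"
    by (auto simp: cyc_int_carrier cyc_prime_eq punits_def)
  show ?thesis unfolding cyc_val_def S \<pi>_def[symmetric]
  proof (rule the_equality)
    show "\<exists>u'\<in>punits. \<exists>w'\<in>punits. \<pi> powi n * u / w = \<pi> powi n * u' / w'" using assms by blast
    fix m assume "\<exists>u'\<in>punits. \<exists>w'\<in>punits. \<pi> powi n * u / w = \<pi> powi m * u' / w'"
    then show "m = n" using cyc_val_unique_aux assms by (metis linorder_neqE)
  qed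
qed

lemma cfield_decompose:
  assumes "x \<in> cfield" "x \<noteq> 0"
  obtains n u w where "u \<in> punits" "w \<in> punits" "x = \<pi> powi n * u / w"
proof -
  obtain u w where uw: "u \<in> zint" "w \<in> zint" "w \<noteq> 0" "x = u / w" using assms(1) by (rule cfieldE)
  then have "u \<noteq> 0" using assms(2) by auto
  obtain n u' where u': "u' \<in> zint" "\<not> \<pi> zdvd u'" "u = \<pi> ^ n * u'" using pi_factorization[OF uw(1) \<open>u \<noteq> 0\<close>] .
  obtain m w' where w': "w' \<in> zint" "\<not> \<pi> zdvd w'" "w = \<pi> ^ m * w'" using pi_factorization[OF uw(2,3)] .
  have "x = \<pi> powi (int n - int m) * u' / w'"
    using uw u' w' by (simp add: power_int_diff field_simps)
  then show ?thesis using that u' w' by (auto simp: punits_def)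
qed

lemma cyc_abs_eq:
  assumes "u \<in> punits" "w \<in> punits" shows "cyc_abs p \<zeta> (\<pi> powi n * u / w) = real p powi (- n)"
  using cyc_val_eq[OF assms, of n] assms punits_nonzero by (auto simp: cyc_abs_def)

text \<open>Elements of value at most \<open>p\<^sup>-\<^sup>n\<close> have the common denominators \<open>punits\<close> after division by \<open>\<pi>\<^sup>n\<close>, from which the ultrametric
  inequality is immediate.\<close>

lemma cyc_abs_le_iff:
  assumes "x \<in> cfield"
  shows "cyc_abs p \<zeta> x \<le> real p powi (- n) \<longleftrightarrow> (\<exists>u\<in>zint. \<exists>w\<in>punits. x = \<pi> powi n * u / w)"
proof (cases "x = 0")
  case True
  have "0 = \<pi> powi n * 0 / 1" by simp
  then have "\<exists>u\<in>zint. \<exists>w\<in>punits. x = \<pi> powi n * u / w" using True punits_1 zint_0 by blast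
  then show ?thesis using True by (simp add: cyc_abs_def)
next
  case False
  have mono: "real p powi (- k) \<le> real p powi (- n) \<longleftrightarrow> n \<le> k" for k
    using power_int_increasing[of "- k" "- n" "real p"] power_int_strict_increasing[of "- n" "- k" "real p"] p_gt_2
    by (cases "n \<le> k") auto
  show ?thesis
  proof
    assume le: "cyc_abs p \<zeta> x \<le> real p powi (- n)"
    obtain k u w where d: "u \<in> punits" "w \<in> punits" "x = \<pi> powi k * u / w" using cfield_decompose[OF assms False] .
    then have "n \<le> k" using le cyc_abs_eq mono by simp
    then have "x = \<pi> powi n * (\<pi> ^ nat (k - n) * u) / w"
      using d(3) power_int_add[of \<pi> n "k - n"] by (simp add: power_int_def mult.assoc)
    then show "\<exists>u\<in>zint. \<exists>w\<in>punits. x = \<pi> powi n * u / w"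
      using d punits_zint by (intro bexI[of _ "\<pi> ^ nat (k - n) * u"] bexI[of _ w]) auto
  next
    assume "\<exists>u\<in>zint. \<exists>w\<in>punits. x = \<pi> powi n * u / w"
    then obtain u w where uw: "u \<in> zint" "w \<in> punits" "x = \<pi> powi n * u / w" by blast
    then have "u \<noteq> 0" using False by auto
    then obtain k v where v: "v \<in> zint" "\<not> \<pi> zdvd v" "u = \<pi> ^ k * v" using pi_factorization[OF uw(1)] by metis
    have "x = \<pi> powi (n + int k) * v / w"
      unfolding uw(3) v(3) by (simp add: power_int_add[of \<pi> n "int k"])
    moreover have "v \<in> punits" using v by (simp add: punits_def)
    ultimately have "cyc_abs p \<zeta> x = real p powi (- (n + int k))"
      using cyc_abs_eq[OF _ uw(2), of v "n + int k"] by simp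
    then show "cyc_abs p \<zeta> x \<le> real p powi (- n)" using mono[of "n + int k"] by simp
  qed
qed

lemma ultrametric_cyc_field: "ultrametric_ring (cyc_field \<zeta>) (cyc_abs p \<zeta>)"
proof -
  interpret K: field "cyc_field \<zeta>" by (rule field_cyc_field)
  have mult: "cyc_abs p \<zeta> (x * y) = cyc_abs p \<zeta> x * cyc_abs p \<zeta> y" if xy: "x \<in> cfield" "y \<in> cfield" for x y
  proof (cases "x = 0 \<or> y = 0")
    case True then show ?thesis by (auto simp: cyc_abs_def)
  next
    case False
    obtain n u w where d: "u \<in> punits" "w \<in> punits" "x = \<pi> powi n * u / w" using cfield_decompose False xy by metis
    obtain m u' w' where d': "u' \<in> punits" "w' \<in> punits" "y = \<pi> powi m * u' / w'" using cfield_decompose False xy by metis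
    have "x * y = \<pi> powi (n + m) * (u * u') / (w * w')"
      unfolding d(3) d'(3) by (simp add: power_int_add[of \<pi> n m])
    then have "cyc_abs p \<zeta> (x * y) = real p powi (- (n + m))"
      using cyc_abs_eq[of "u * u'" "w * w'" "n + m"] d(1,2) d'(1,2) by simp
    moreover have "cyc_abs p \<zeta> x = real p powi (- n)" "cyc_abs p \<zeta> y = real p powi (- m)"
      unfolding d(3) d'(3) by (intro cyc_abs_eq d d')+
    ultimately show ?thesis using p_gt_2 power_int_add[of "real p" "- n" "- m"] by simp
  qed
  have le: "cyc_abs p \<zeta> (x + y) \<le> cyc_abs p \<zeta> y" if xy: "x \<in> cfield" "y \<in> cfield" and le: "cyc_abs p \<zeta> x \<le> cyc_abs p \<zeta> y" for x y
  proof (cases "y = 0")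
    case True
    moreover have "real p powi (- cyc_val \<zeta> x) > 0" using p_gt_2 by simp
    ultimately have "x = 0" using le by (auto simp: cyc_abs_def split: if_splits)
    then show ?thesis by simp
  next
    case False
    then obtain n where n: "cyc_abs p \<zeta> y = real p powi (- n)" using p_gt_2 by (auto simp: cyc_abs_def)
    obtain u w where d: "u \<in> zint" "w \<in> punits" "x = \<pi> powi n * u / w" using le n cyc_abs_le_iff[OF xy(1), of n] by auto
    obtain u' w' where d': "u' \<in> zint" "w' \<in> punits" "y = \<pi> powi n * u' / w'" using n cyc_abs_le_iff[OF xy(2), of n] by auto
    have "x + y = \<pi> powi n * (u * w' + u' * w) / (w * w')"
      using d d' punits_nonzero by (simp add: field_simps)
    moreover have "u * w' + u' * w \<in> zint" "w * w' \<in> punits" using d d' by (auto simp: punits_zint)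
    ultimately show ?thesis using cyc_abs_le_iff[of "x + y" n] xy n by (metis cfield_add)
  qed
  show ?thesis
  proof (unfold_locales, unfold cyc_field_carrier cyc_field_simps)
    fix x y assume xy: "x \<in> cfield" "y \<in> cfield"
    show "cyc_abs p \<zeta> (x + y) \<le> max (cyc_abs p \<zeta> x) (cyc_abs p \<zeta> y)"
      using le[OF xy] le[OF xy(2,1)] by (cases "cyc_abs p \<zeta> x \<le> cyc_abs p \<zeta> y") (auto simp: add.commute)
    show "cyc_abs p \<zeta> (x * y) = cyc_abs p \<zeta> x * cyc_abs p \<zeta> y" by (rule mult[OF xy])
  next
    fix x assume x: "x \<in> cfield"
    have "cyc_abs p \<zeta> (- 1) = 1"
      using cyc_abs_eq[of "- 1" 1 0] punits_1 by (simp add: punits_def)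
    then show "cyc_abs p \<zeta> (\<ominus>\<^bsub>cyc_field \<zeta>\<^esub> x) = cyc_abs p \<zeta> x"
      using mult[of "- 1" x] x by (simp add: cyc_field_uminus)
  qed (auto simp: cyc_abs_def)
qed

end


section \<open>Local p-th powers\<close>

context prime_cyclotomic
begin

lemma local_pth_power_iff:
  assumes "x \<in> cfield"
  shows "local_pth_power p \<zeta> x \<longleftrightarrow>
    (\<exists>s. ultrametric_ring.is_cauchy (cyc_field \<zeta>) (cyc_abs p \<zeta>) s \<and> (\<lambda>n. cyc_abs p \<zeta> (s n ^ p - x)) \<longlonglongrightarrow> 0)"
proof -
  interpret U: ultrametric_ring "cyc_field \<zeta>" "cyc_abs p \<zeta>" by (rule ultrametric_cyc_field)
  have eq: "s n [^]\<^bsub>cyc_field \<zeta>\<^esub> p \<ominus>\<^bsub>cyc_field \<zeta>\<^esub> x = s n ^ p - x" if "U.is_cauchy s" for s n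
    using U.is_cauchyD[OF that] assms by (simp add: cyc_field_pow cyc_field_minus cyc_field_carrier)
  then show ?thesis
    unfolding local_pth_power_def using U.completion_root_iff[of x p] assms
    by (simp add: cyc_field_carrier eq cong: conj_cong)
qed

lemma local_pth_power_mult_pth_power:
  assumes "x \<in> cfield" "c \<in> cfield" "local_pth_power p \<zeta> x"
  shows "local_pth_power p \<zeta> (x * c ^ p)"
proof -
  interpret U: ultrametric_ring "cyc_field \<zeta>" "cyc_abs p \<zeta>" by (rule ultrametric_cyc_field)
  obtain s where s: "U.is_cauchy s" "(\<lambda>n. cyc_abs p \<zeta> (s n ^ p - x)) \<longlonglongrightarrow> 0"
    using local_pth_power_iff[OF assms(1)] assms(3) by blast
  have sc: "s n \<in> cfield" for n using U.is_cauchyD[OF s(1)] by (simp add: cyc_field_carrier)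
  have "U.is_cauchy (\<lambda>n. s n * c)"
    using U.is_cauchy_mult[OF s(1) U.is_cauchy_const[of c]] assms(2) by (simp add: cyc_field_carrier)
  moreover have "(\<lambda>n. cyc_abs p \<zeta> ((s n * c) ^ p - x * c ^ p)) \<longlonglongrightarrow> 0"
  proof -
    have "cyc_abs p \<zeta> ((s n * c) ^ p - x * c ^ p) = cyc_abs p \<zeta> (s n ^ p - x) * cyc_abs p \<zeta> (c ^ p)" for n
    proof -
      have "(s n * c) ^ p - x * c ^ p = (s n ^ p - x) * c ^ p" by (simp add: algebra_simps power_mult_distrib)
      then show ?thesis using U.N_mult[of "s n ^ p - x" "c ^ p"] assms sc by (simp add: cyc_field_carrier)
    qed
    then show ?thesis using tendsto_mult_left_zero[OF s(2), of "cyc_abs p \<zeta> (c ^ p)"] by simp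
  qed
  ultimately show ?thesis using local_pth_power_iff[of "x * c ^ p"] assms by auto
qed

lemma local_pth_power_mult_pth_power_iff:
  assumes "x \<in> cfield" "c \<in> cfield" "c \<noteq> 0"
  shows "local_pth_power p \<zeta> (x * c ^ p) \<longleftrightarrow> local_pth_power p \<zeta> x"
proof
  assume "local_pth_power p \<zeta> (x * c ^ p)"
  from local_pth_power_mult_pth_power[OF _ cfield_inverse[OF assms(2)] this]
  show "local_pth_power p \<zeta> x" using assms by (simp add: mult.assoc flip: power_mult_distrib)
qed (rule local_pth_power_mult_pth_power[OF assms(1,2)])

lemma local_pth_power_1: "local_pth_power p \<zeta> 1"
proof -
  interpret U: ultrametric_ring "cyc_field \<zeta>" "cyc_abs p \<zeta>" by (rule ultrametric_cyc_field)
  have "U.is_cauchy (\<lambda>n. 1)" using U.is_cauchy_const[of 1] by (simp add: cyc_field_carrier)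
  moreover have "(\<lambda>n. cyc_abs p \<zeta> ((1 :: complex) ^ p - 1)) \<longlonglongrightarrow> 0" by (simp add: cyc_abs_def)
  ultimately show ?thesis using local_pth_power_iff[of 1] by auto
qed

lemma zint_frobenius_add:
  assumes "x \<in> zint" "y \<in> zint" shows "of_nat p zdvd (x + y) ^ p - (x ^ p + y ^ p)"
proof -
  have "(x + y) ^ p = (\<Sum>k\<le>p. of_nat (p choose k) * x ^ k * y ^ (p - k))" by (rule binomial_ring)
  also have "{..p} = insert 0 (insert p {1..<p})" using p_gt_2 by auto
  also have "(\<Sum>k\<in>insert 0 (insert p {1..<p}). of_nat (p choose k) * x ^ k * y ^ (p - k)) =
      y ^ p + x ^ p + (\<Sum>k\<in>{1..<p}. of_nat (p choose k) * x ^ k * y ^ (p - k))"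
    using p_gt_2 by (subst sum.insert) auto
  finally have "(x + y) ^ p - (x ^ p + y ^ p) = (\<Sum>k\<in>{1..<p}. of_nat (p choose k) * x ^ k * y ^ (p - k))"
    by simp
  also have "of_nat p zdvd \<dots>"
  proof (rule zdvd_sum)
    fix k assume "k \<in> {1..<p}"
    then have "p dvd (p choose k)" using p_prime by (intro dvd_choose_prime) auto
    then have "(of_nat p :: complex) zdvd of_nat (p choose k)" using zdvd_of_int[of "int p" "int (p choose k)"] by simp
    then show "of_nat p zdvd of_nat (p choose k) * x ^ k * y ^ (p - k)" using assms by (intro zdvd_mult) auto
  qed
  finally show ?thesis .
qed

text \<open>Modulo \<open>p\<close>, the \<open>p\<close>-th power of \<open>\<Sum>\<^sub>i c\<^sub>i \<zeta>\<^sup>i\<close> is \<open>\<Sum>\<^sub>i c\<^sub>i\<^sup>p\<close>, because \<open>\<zeta>\<^sup>p = 1\<close>.\<close>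

lemma zint_pth_power_cong_int:
  assumes "x \<in> zint" obtains r :: int where "of_nat p zdvd x ^ p - of_int r"
proof -
  have "\<exists>r :: int. of_nat p zdvd ev f \<zeta> ^ p - of_int r" for f
  proof (induction f)
    case 0 then show ?case using p_gt_2 by (intro exI[of _ 0]) (simp add: power_0_left)
  next
    case (pCons c f)
    then obtain r :: int where r: "of_nat p zdvd ev f \<zeta> ^ p - of_int r" by blast
    have 1: "of_nat p zdvd (of_int c + \<zeta> * ev f \<zeta>) ^ p - (of_int c ^ p + (\<zeta> * ev f \<zeta>) ^ p)"
      by (rule zint_frobenius_add) auto
    have e: "(of_int c + \<zeta> * ev f \<zeta>) ^ p - of_int (c ^ p + r) =
      ((of_int c + \<zeta> * ev f \<zeta>) ^ p - (of_int c ^ p + (\<zeta> * ev f \<zeta>) ^ p)) + (ev f \<zeta> ^ p - of_int r)"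
      by (simp add: power_mult_distrib zeta_pow_p)
    have "of_nat p zdvd (of_int c + \<zeta> * ev f \<zeta>) ^ p - of_int (c ^ p + r)"
      by (subst e) (rule zdvd_add[OF 1 r])
    then show ?case unfolding ev_pCons by blast
  qed
  then show ?thesis using assms that by (metis zintE)
qed

text \<open>Approximate a root by \<open>u/w\<close> with \<open>u\<close> and \<open>w\<close> in \<open>\<int>[\<zeta>]\<close>, up to \<open>\<pi>\<^bsup>p-1\<^esup>\<close>. Then \<open>u\<^sup>p\<close> and \<open>w\<^sup>p\<close> are congruent to
  rational integers modulo \<open>p\<close>.\<close>

lemma local_pth_power_imp_cong_int:
  assumes "x \<in> punits" "local_pth_power p \<zeta> x"
  obtains r :: int where "of_nat p zdvd x - of_int r"
proof -
  interpret U: ultrametric_ring "cyc_field \<zeta>" "cyc_abs p \<zeta>" by (rule ultrametric_cyc_field)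
  have x: "x \<in> zint" "\<not> \<pi> zdvd x" using assms(1) by (auto simp: punits_def)
  obtain s where s: "U.is_cauchy s" "(\<lambda>n. cyc_abs p \<zeta> (s n ^ p - x)) \<longlonglongrightarrow> 0"
    using local_pth_power_iff[of x] x assms(2) by auto
  have "real p powi (- int (p - 1)) > 0" using p_gt_2 by simp
  from order_tendstoD(2)[OF s(2) this]
  obtain n where n: "cyc_abs p \<zeta> (s n ^ p - x) < real p powi (- int (p - 1))"
    unfolding eventually_sequentially by blast
  define y where "y = s n"
  have y: "y \<in> cfield" using U.is_cauchyD[OF s(1)] by (simp add: y_def cyc_field_carrier)
  obtain u w where uw: "u \<in> zint" "w \<in> punits" "y ^ p - x = \<pi> powi int (p - 1) * u / w"
    using n y x cyc_abs_le_iff[of "y ^ p - x" "int (p - 1)"] by (auto simp: y_def)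
  have w: "w \<in> zint" "w \<noteq> 0" using uw(2) punits_zint punits_nonzero by auto
  have "cyc_abs p \<zeta> y \<le> 1"
  proof (cases "y = 0")
    case True then show ?thesis by (simp add: cyc_abs_def)
  next
    case False
    obtain k u' w' where d: "u' \<in> punits" "w' \<in> punits" "y = \<pi> powi k * u' / w'"
      using cfield_decompose[OF y False] .
    have "y ^ p = \<pi> powi 0 * (\<pi> ^ (p - 1) * u + x * w) / w"
    proof -
      have "y ^ p = \<pi> ^ (p - 1) * u / w + x * w / w" using uw(3) w(2) by (simp add: diff_eq_eq)
      then show ?thesis by (simp only: add_divide_distrib power_int_0_right mult_1)
    qed
    moreover have "\<pi> ^ (p - 1) * u + x * w \<in> zint" using uw w x by simp
    ultimately have "\<exists>u\<in>zint. \<exists>w\<in>punits. y ^ p = \<pi> powi 0 * u / w" using uw(2) by blast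
    then have "cyc_abs p \<zeta> (y ^ p) \<le> 1" using cyc_abs_le_iff[OF cfield_power[OF y], of p 0] by simp
    moreover have "y ^ p = \<pi> powi (k * int p) * u' ^ p / w' ^ p"
      unfolding d(3) by (simp add: power_mult_distrib power_divide power_int_mult)
    then have "cyc_abs p \<zeta> (y ^ p) = real p powi (- (k * int p))" using cyc_abs_eq d by simp
    moreover have "real p powi (- (k * int p)) > 1" if "k < 0"
      using that p_gt_2 one_less_power_int[of "real p" "- (k * int p)"] by (simp add: mult_less_0_iff)
    ultimately have "k \<ge> 0" by force
    then have "real p powi (- k) \<le> real p powi 0" using p_gt_2 by (intro power_int_increasing) auto
    then show ?thesis using cyc_abs_eq d by simp
  qed
  then obtain u' w' where d: "u' \<in> zint" "w' \<in> punits" "y = u' / w'"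
    using cyc_abs_le_iff[OF y, of 0] by auto
  have w': "w' \<in> zint" "w' \<noteq> 0" using d(2) punits_zint punits_nonzero by auto
  have "w * (u' ^ p - x * w' ^ p) = \<pi> ^ (p - 1) * (u * w' ^ p)"
  proof -
    have "u' ^ p / w' ^ p - x = \<pi> ^ (p - 1) * u / w" using uw(3) by (simp add: d(3) power_divide)
    then have "(u' ^ p / w' ^ p - x) * (w * w' ^ p) = \<pi> ^ (p - 1) * u / w * (w * w' ^ p)" by simp
    then show ?thesis using w(2) w'(2) by (simp add: left_diff_distrib right_diff_distrib mult_ac)
  qed
  then have "\<pi> ^ (p - 1) zdvd w * (u' ^ p - x * w' ^ p)"
    using zdvd_mult[OF zdvd_refl, of "u * w' ^ p" "\<pi> ^ (p - 1)"] uw(1) w' by simp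
  then have "\<pi> ^ (p - 1) zdvd u' ^ p - x * w' ^ p"
    using pi_power_zdvd_cancel[OF uw(2)] d w' x by auto
  then have A: "of_nat p zdvd u' ^ p - x * w' ^ p" using zdvd_trans[OF p_zdvd_pi_power] by blast
  obtain r1 :: int where r1: "of_nat p zdvd u' ^ p - of_int r1" using zint_pth_power_cong_int d(1) by blast
  obtain r2 :: int where r2: "of_nat p zdvd w' ^ p - of_int r2" using zint_pth_power_cong_int w'(1) by blast
  have "\<not> int p dvd r2"
  proof
    assume "int p dvd r2"
    then have "\<pi> zdvd of_int r2" by (simp add: pi_zdvd_of_int_iff)
    moreover have "\<pi> zdvd w' ^ p - of_int r2" using zdvd_trans[OF pi_zdvd_p r2] .
    ultimately have "\<pi> zdvd w' ^ p" using zdvd_add by fastforce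
    moreover have "w' ^ p \<in> punits" using d(2) by simp
    ultimately show False by (simp add: punits_def)
  qed
  then have "coprime r2 (int p)" using p_prime prime_imp_coprime[of "int p" r2] by (simp add: coprime_commute)
  then obtain r3 where "[r2 * r3 = 1] (mod int p)" using cong_solve_coprime_int by blast
  then have r3: "of_nat p zdvd of_int (r2 * r3 - 1)"
    using zdvd_of_int[of "int p" "r2 * r3 - 1"] by (simp add: cong_iff_dvd_diff)
  have "x - of_int (r1 * r3) = - ((u' ^ p - x * w' ^ p) * of_int r3) + (u' ^ p - of_int r1) * of_int r3
     - x * of_int r3 * (w' ^ p - of_int r2) - x * of_int (r2 * r3 - 1)"
    by (simp add: algebra_simps)
  moreover have "of_nat p zdvd \<dots>"
    using A r1 r2 r3 x by (intro zdvd_diff zdvd_add) auto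
  ultimately have "of_nat p zdvd x - of_int (r1 * r3)" by simp
  then show ?thesis by (rule that)
qed

lemma punit_fermat:
  assumes "y \<in> punits" shows "\<pi> zdvd 1 - y ^ (p - 1)"
proof -
  have y: "y \<in> zint" "\<not> \<pi> zdvd y" using assms by (auto simp: punits_def)
  obtain f where f: "y = ev f \<zeta>" using y(1) by (rule zintE)
  have "\<not> int p dvd poly f 1" using y f pi_zdvd_ev_iff by simp
  then have "int p dvd 1 - poly f 1 ^ (p - 1)"
    using fermat_little_int[OF p_prime] by (simp add: cong_iff_dvd_diff dvd_diff_commute)
  then have "int p dvd poly (1 - f ^ (p - 1)) 1" by simp
  then have "\<pi> zdvd ev (1 - f ^ (p - 1)) \<zeta>" using pi_zdvd_ev_iff by blast
  then show ?thesis by (simp add: f)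
qed

text \<open>One step of Newton's iteration, in which \<open>p\<close> may stand for the derivative \<open>p y\<^bsup>p-1\<^esup>\<close>: by Fermat's little
  theorem in the residue field, \<open>y\<^bsup>p-1\<^esup>\<close> is congruent to \<open>1\<close> modulo \<open>\<pi>\<close>.\<close>

lemma hensel_step:
  assumes "x \<in> zint" "y \<in> punits" "n \<ge> 2" "of_nat p * \<pi> ^ n zdvd x - y ^ p"
  obtains y' where "y' \<in> punits" "\<pi> ^ n zdvd y' - y" "of_nat p * \<pi> ^ Suc n zdvd x - y' ^ p"
proof -
  have y: "y \<in> zint" using assms(2) by (rule punits_zint)
  obtain z where z: "z \<in> zint" "x - y ^ p = of_nat p * \<pi> ^ n * z" using assms(4) by (auto simp: zdvd_def)
  define y' where "y' = \<pi> ^ n * z + y"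
  define M where "M = of_nat p * \<pi> ^ Suc n"
  have y': "y' \<in> zint" using y z by (simp add: y'_def)
  have 1: "\<pi> ^ n zdvd y' - y" using z by (auto simp: y'_def zdvd_def)
  have pn: "\<pi> zdvd \<pi> ^ n * z" using zdvd_power_le[of 1 n \<pi>] assms(3) z by (intro zdvd_mult) auto
  have "\<not> \<pi> zdvd y'"
    using zdvd_diff[OF _ pn, of y'] assms(2) by (auto simp: y'_def punits_def)
  then have 2: "y' \<in> punits" using y' by (simp add: punits_def)
  have "y' ^ p = (\<Sum>k\<le>p. of_nat (p choose k) * (\<pi> ^ n * z) ^ k * y ^ (p - k))"
    unfolding y'_def by (rule binomial_ring)
  also have "{..p} = insert 0 (insert 1 {2..p})" using p_gt_2 by auto
  also have "(\<Sum>k\<in>insert 0 (insert 1 {2..p}). of_nat (p choose k) * (\<pi> ^ n * z) ^ k * y ^ (p - k)) =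
      y ^ p + (of_nat p * \<pi> ^ n * z * y ^ (p - 1) + (\<Sum>k=2..p. of_nat (p choose k) * (\<pi> ^ n * z) ^ k * y ^ (p - k)))"
    by (subst sum.insert) auto
  finally have e: "x - y' ^ p = of_nat p * \<pi> ^ n * (1 - y ^ (p - 1)) * z -
      (\<Sum>k=2..p. of_nat (p choose k) * (\<pi> ^ n * z) ^ k * y ^ (p - k))"
    using z(2) by (simp add: algebra_simps)
  have 3: "M zdvd of_nat p * \<pi> ^ n * (1 - y ^ (p - 1)) * z"
  proof -
    have "M = of_nat p * \<pi> ^ n * \<pi>" by (simp add: M_def)
    also have "\<dots> zdvd of_nat p * \<pi> ^ n * (1 - y ^ (p - 1))"
      by (rule zdvd_mult_mono[OF zdvd_refl punit_fermat[OF assms(2)]])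
    finally show ?thesis using z(1) by (rule zdvd_mult)
  qed
  have "M zdvd (\<Sum>k=2..p. of_nat (p choose k) * (\<pi> ^ n * z) ^ k * y ^ (p - k))"
  proof (rule zdvd_sum)
    fix k assume k: "k \<in> {2..p}"
    have pk: "\<pi> ^ (n * k) zdvd (\<pi> ^ n * z) ^ k"
      using z(1) zdvd_mult[OF zdvd_refl, of "z ^ k" "(\<pi> ^ n) ^ k"] by (simp add: power_mult power_mult_distrib)
    have "M zdvd of_nat (p choose k) * (\<pi> ^ n * z) ^ k"
    proof (cases "k = p")
      case False
      then have "p dvd (p choose k)" using p_prime k by (intro dvd_choose_prime) auto
      then have a: "(of_nat p :: complex) zdvd of_nat (p choose k)"
        using zdvd_of_int[of "int p" "int (p choose k)"] by simp
      have "Suc n \<le> n * 2" using assms(3) by simp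
      also have "\<dots> \<le> n * k" using k by simp
      finally have "\<pi> ^ Suc n zdvd \<pi> ^ (n * k)" by (intro zdvd_power_le) auto
      from zdvd_mult_mono[OF a zdvd_trans[OF this pk]] show ?thesis by (simp add: M_def)
    next
      case True
      \<comment> \<open>Here \<open>p\<close> itself has to be paid for by \<open>\<pi>\<^bsup>p-1\<^esup>\<close>: \<open>n p \<ge> (p - 1) + (n + 1)\<close> because \<open>n \<ge> 2\<close>.\<close>
      have "(p - 1) + Suc n \<le> n * p"
      proof -
        obtain m where m: "n = Suc (Suc m)" using assms(3) by (metis add_2_eq_Suc le_Suc_ex)
        have "m \<le> m * p" using p_gt_2 by simp
        then have "Suc (Suc m) \<le> p + m * p" using p_gt_2 by linarith
        then show ?thesis using p_gt_2 by (simp add: m)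
      qed
      then have "\<pi> ^ ((p - 1) + Suc n) zdvd \<pi> ^ (n * p)" by (intro zdvd_power_le) auto
      moreover have "M zdvd \<pi> ^ ((p - 1) + Suc n)"
        unfolding M_def power_add by (rule zdvd_mult_mono[OF p_zdvd_pi_power zdvd_refl])
      ultimately have "M zdvd (\<pi> ^ n * z) ^ k" using pk[unfolded True] zdvd_trans True by blast
      then show ?thesis by (intro zdvd_mult2) auto
    qed
    then show "M zdvd of_nat (p choose k) * (\<pi> ^ n * z) ^ k * y ^ (p - k)" by (rule zdvd_mult) (use y in auto)
  qed
  with 3 have "M zdvd x - y' ^ p" unfolding e by (rule zdvd_diff)
  then show ?thesis using that 1 2 by (simp add: M_def)
qed

lemma cyc_abs_le_of_zdvd:
  assumes "\<pi> ^ n zdvd x" shows "cyc_abs p \<zeta> x \<le> real p powi (- int n)"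
proof -
  obtain u where u: "u \<in> zint" "x = \<pi> ^ n * u" using assms by (auto simp: zdvd_def)
  then have "x = \<pi> powi int n * u / 1" by simp
  moreover have "x \<in> cfield" using u by simp
  ultimately show ?thesis using cyc_abs_le_iff u punits_1 by blast
qed

text \<open>Starting from a congruence modulo \<open>p \<pi>\<^sup>2\<close> the iteration gains one power of \<open>\<pi>\<close> per step, because on \<open>1 + \<pi>\<^sup>2 z\<close> the
  \<open>p\<close>-th power is \<open>1 + p \<pi>\<^sup>2 z\<close> up to terms of higher order.\<close>

lemma hensel_pth_power:
  assumes "x \<in> zint" "y \<in> punits" "of_nat p * \<pi> ^ 2 zdvd x - y ^ p"
  shows "local_pth_power p \<zeta> x"
proof -
  interpret U: ultrametric_ring "cyc_field \<zeta>" "cyc_abs p \<zeta>" by (rule ultrametric_cyc_field)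
  define P where "P = (\<lambda>n z. z \<in> punits \<and> of_nat p * \<pi> ^ (n + 2) zdvd x - z ^ p)"
  have "\<exists>s. \<forall>n. P n (s n) \<and> \<pi> ^ (n + 2) zdvd s (Suc n) - s n"
  proof (rule dependent_nat_choice)
    show "\<exists>z. P 0 z" using assms by (auto simp: P_def power2_eq_square)
  next
    fix z n assume "P n z"
    then have z: "z \<in> punits" "of_nat p * \<pi> ^ (n + 2) zdvd x - z ^ p" by (simp_all add: P_def)
    obtain z' where "z' \<in> punits" "\<pi> ^ (n + 2) zdvd z' - z" "of_nat p * \<pi> ^ Suc (n + 2) zdvd x - z' ^ p"
      by (rule hensel_step[OF assms(1) z(1) _ z(2)]) simp
    then show "\<exists>z'. P (Suc n) z' \<and> \<pi> ^ (n + 2) zdvd z' - z" by (auto simp: P_def)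
  qed
  then obtain s where s: "\<And>n. s n \<in> punits" "\<And>n. of_nat p * \<pi> ^ (n + 2) zdvd x - s n ^ p"
    "\<And>n. \<pi> ^ (n + 2) zdvd s (Suc n) - s n" unfolding P_def by blast
  have diff: "\<pi> ^ i zdvd s (i + k) - s i" for i k
  proof (induction k)
    case (Suc k)
    have "\<pi> ^ i zdvd \<pi> ^ (i + k + 2)" by (intro zdvd_power_le) auto
    then have "\<pi> ^ i zdvd s (Suc (i + k)) - s (i + k)" using zdvd_trans s(3) by blast
    from zdvd_add[OF this Suc] show ?case by simp
  qed simp
  have lim: "(\<lambda>n. real p powi (- int n)) \<longlonglongrightarrow> 0"
  proof -
    have "(\<lambda>n. (1 / real p) ^ n) \<longlonglongrightarrow> 0" using p_gt_2 by (intro LIMSEQ_power_zero) simp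
    then show ?thesis by (simp add: power_int_minus power_one_over inverse_eq_divide)
  qed
  have "U.is_cauchy s" unfolding U.is_cauchy_def
  proof (intro conjI allI impI)
    fix e :: real assume "e > 0"
    then obtain M where M: "\<And>n. n \<ge> M \<Longrightarrow> real p powi (- int n) < e"
      using order_tendstoD(2)[OF lim] unfolding eventually_sequentially by blast
    have ord: "cyc_abs p \<zeta> (s i - s j) < e" if ij: "i \<ge> M" "i \<ge> j" "j \<ge> M" for i j
    proof -
      have "\<pi> ^ j zdvd s i - s j" using diff[of j "i - j"] ij by simp
      from cyc_abs_le_of_zdvd[OF this] M[OF ij(3)] show ?thesis by simp
    qed
    have sc: "s i \<in> cfield" for i using s(1)[of i] punits_zint by simp
    have "cyc_abs p \<zeta> (s i - s j) < e" if ij: "i \<ge> M" "j \<ge> M" for i j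
    proof (cases "i \<ge> j")
      case False
      have "cyc_abs p \<zeta> (s i - s j) = cyc_abs p \<zeta> (- (s j - s i))" by simp
      also have "\<dots> = cyc_abs p \<zeta> (s j - s i)"
        using U.N_uminus[of "s j - s i"] sc by (simp only: cyc_field_carrier cyc_field_uminus cfield_diff)
      finally show ?thesis using ord[of j i] False ij by simp
    qed (use ord ij in simp)
    then show "\<exists>M. \<forall>i\<ge>M. \<forall>j\<ge>M. cyc_abs p \<zeta> (s i \<ominus>\<^bsub>cyc_field \<zeta>\<^esub> s j) < e"
      using sc by (auto simp: cyc_field_minus)
  qed (use s(1) punits_zint in \<open>auto simp: cyc_field_carrier\<close>)
  moreover have "(\<lambda>n. cyc_abs p \<zeta> (s n ^ p - x)) \<longlonglongrightarrow> 0"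
  proof (rule tendsto_sandwich[OF _ _ tendsto_const lim])
    have "\<pi> ^ n zdvd s n ^ p - x" for n
    proof -
      have "\<pi> ^ n zdvd \<pi> ^ (n + 2)" by (intro zdvd_power_le) auto
      also have "\<dots> zdvd of_nat p * \<pi> ^ (n + 2)" by (rule zdvd_mult2) auto
      also have "\<dots> zdvd x - s n ^ p" by (rule s(2))
      finally show ?thesis using zdvd_uminus_iff[of "\<pi> ^ n" "x - s n ^ p"] by simp
    qed
    then show "\<forall>\<^sub>F n in sequentially. cyc_abs p \<zeta> (s n ^ p - x) \<le> real p powi (- int n)"
      by (intro always_eventually) (auto intro: cyc_abs_le_of_zdvd)
    show "\<forall>\<^sub>F n in sequentially. 0 \<le> cyc_abs p \<zeta> (s n ^ p - x)"
      by (intro always_eventually) (auto simp: cyc_abs_def)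
  qed
  ultimately show ?thesis using local_pth_power_iff[of x] assms(1) by auto
qed

end


section \<open>Ideals that are p-th powers\<close>

context prime_cyclotomic
begin

text \<open>The finite sums of products form an associative and commutative operation on arbitrary sets of complex
  numbers. This makes \<open>J \<mapsto> J\<^sup>p\<close> multiplicative.\<close>

abbreviation iprod :: "complex set \<Rightarrow> complex set \<Rightarrow> complex set" (infixl "\<odot>" 70) where
  "A \<odot> B \<equiv> ideal_prod (cyc_field \<zeta>) A B"

lemma iprod_prod: "a \<in> A \<Longrightarrow> b \<in> B \<Longrightarrow> a * b \<in> A \<odot> B"
  using ideal_prod.prod[of a A b B "cyc_field \<zeta>"] by simp

lemma iprod_add: "x \<in> A \<odot> B \<Longrightarrow> y \<in> A \<odot> B \<Longrightarrow> x + y \<in> A \<odot> B"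
  using ideal_prod.sum[of x "cyc_field \<zeta>" A B y] by simp

lemma iprod_induct [consumes 1, case_names prod add]:
  assumes "x \<in> A \<odot> B" "\<And>a b. a \<in> A \<Longrightarrow> b \<in> B \<Longrightarrow> P (a * b)"
    "\<And>x y. x \<in> A \<odot> B \<Longrightarrow> y \<in> A \<odot> B \<Longrightarrow> P x \<Longrightarrow> P y \<Longrightarrow> P (x + y)"
  shows "P x"
  using assms(1) by induction (use assms(2,3) in auto)

lemma iprod_commute: "A \<odot> B = B \<odot> A"
proof -
  have "x \<in> B \<odot> A" if "x \<in> A \<odot> B" for x and A B :: "complex set"
    using that
  proof (induction rule: iprod_induct)
    case (prod a b) then show ?case using iprod_prod[of b B a A] by (simp add: mult.commute)
  next
    case (add x y) then show ?case by (intro iprod_add)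
  qed
  then show ?thesis by blast
qed

lemma iprod_assoc: "(A \<odot> B) \<odot> C = A \<odot> (B \<odot> C)"
proof -
  have sub: "(A \<odot> B) \<odot> C \<subseteq> A \<odot> (B \<odot> C)" for A B C :: "complex set"
  proof
    fix x assume "x \<in> (A \<odot> B) \<odot> C"
    then show "x \<in> A \<odot> (B \<odot> C)"
    proof (induction rule: iprod_induct)
      case (prod y c)
      from prod(1) show ?case
      proof (induction rule: iprod_induct)
        case (prod a b)
        then show ?case using iprod_prod[of a A "b * c" "B \<odot> C"] iprod_prod[of b B c C] \<open>c \<in> C\<close>
          by (simp add: mult.assoc)
      next
        case (add y z) then show ?case by (simp add: distrib_right iprod_add)
      qed
    next
      case (add x y) then show ?case by (intro iprod_add)
    qed
  qed
  have "A \<odot> (B \<odot> C) = (C \<odot> B) \<odot> A" by (simp add: iprod_commute)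
  also have "\<dots> \<subseteq> C \<odot> (B \<odot> A)" by (rule sub)
  also have "\<dots> = (A \<odot> B) \<odot> C" by (simp add: iprod_commute)
  finally show ?thesis using sub by blast
qed

definition principal :: "complex \<Rightarrow> complex set" where
  "principal x = (\<lambda>z. x * z) ` zint"

lemma iprod_principal: "principal x \<odot> principal y = principal (x * y)"
proof
  show "principal x \<odot> principal y \<subseteq> principal (x * y)"
  proof
    fix z assume "z \<in> principal x \<odot> principal y"
    then show "z \<in> principal (x * y)"
    proof (induction rule: iprod_induct)
      case (prod a b)
      then obtain u v where "u \<in> zint" "v \<in> zint" "a = x * u" "b = y * v" by (auto simp: principal_def)
      then show ?case unfolding principal_def by (intro image_eqI[of _ _ "u * v"]) auto
    next
      case (add a b)
      then obtain u v where "u \<in> zint" "v \<in> zint" "a = x * y * u" "b = x * y * v" by (auto simp: principal_def)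
      then show ?case unfolding principal_def by (intro image_eqI[of _ _ "u + v"]) (auto simp: distrib_left)
    qed
  qed
  show "principal (x * y) \<subseteq> principal x \<odot> principal y"
  proof
    fix z assume "z \<in> principal (x * y)"
    then obtain u where u: "u \<in> zint" "z = (x * 1) * (y * u)" by (auto simp: principal_def)
    then show "z \<in> principal x \<odot> principal y" unfolding u(2) principal_def by (intro iprod_prod imageI) auto
  qed
qed

lemma principal_1: "principal 1 = zint"
  by (auto simp: principal_def)

lemma frac_ideal_power_0: "frac_ideal_power \<zeta> J 0 = zint"
  and frac_ideal_power_Suc: "frac_ideal_power \<zeta> J (Suc n) = J \<odot> frac_ideal_power \<zeta> J n"
  by (simp_all add: frac_ideal_power_def cyc_int_carrier)

lemma frac_ideal_power_iprod:
  "frac_ideal_power \<zeta> (A \<odot> B) n = frac_ideal_power \<zeta> A n \<odot> frac_ideal_power \<zeta> B n"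
proof (induction n)
  case 0 then show ?case using iprod_principal[of 1 1] by (simp add: frac_ideal_power_0 principal_1)
next
  case (Suc n)
  then show ?case unfolding frac_ideal_power_Suc
    by (metis iprod_assoc iprod_commute)
qed

lemma frac_ideal_power_principal: "frac_ideal_power \<zeta> (principal x) n = principal (x ^ n)"
  by (induction n) (simp_all add: frac_ideal_power_0 frac_ideal_power_Suc principal_1 iprod_principal)

lemma fractional_ideal_iff:
  "fractional_ideal \<zeta> J \<longleftrightarrow> J \<subseteq> cfield \<and> 0 \<in> J \<and> (\<exists>x\<in>J. x \<noteq> 0) \<and> (\<forall>x\<in>J. \<forall>y\<in>J. x + y \<in> J) \<and>
     (\<forall>x\<in>zint. \<forall>y\<in>J. x * y \<in> J) \<and> (\<exists>d\<in>zint - {0}. \<forall>y\<in>J. d * y \<in> zint)"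
  (is "_ \<longleftrightarrow> ?R")
proof
  assume f: "fractional_ideal \<zeta> J"
  then interpret additive_subgroup J "cyc_field \<zeta>" by (simp add: fractional_ideal_def)
  have "J \<subseteq> cfield" using a_subset by (simp add: cyc_field_carrier)
  moreover have zero: "0 \<in> J" using zero_closed by simp
  moreover have "x + y \<in> J" if "x \<in> J" "y \<in> J" for x y using a_closed[OF that] by simp
  moreover have "\<exists>x\<in>J. x \<noteq> 0" using f zero unfolding fractional_ideal_def by blast
  ultimately show ?R using f unfolding fractional_ideal_def cyc_int_carrier by blast
next
  assume R: ?R
  interpret K: field "cyc_field \<zeta>" by (rule field_cyc_field)
  have "additive_subgroup J (cyc_field \<zeta>)"
  proof (rule additive_subgroup.intro, rule subgroup.intro)
    fix x assume x: "x \<in> J"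
    have "(- 1) * x \<in> J" using R x zint_uminus[OF zint_1] by blast
    then show "inv\<^bsub>add_monoid (cyc_field \<zeta>)\<^esub> x \<in> J"
      using R x cyc_field_uminus[of x] by (auto simp: a_inv_def)
  qed (use R in \<open>auto simp: cyc_field_carrier\<close>)
  then show "fractional_ideal \<zeta> J" using R unfolding fractional_ideal_def cyc_int_carrier by auto
qed

lemma fractional_ideal_iprod:
  assumes "fractional_ideal \<zeta> A" "fractional_ideal \<zeta> B" shows "fractional_ideal \<zeta> (A \<odot> B)"
proof -
  note A = assms(1)[unfolded fractional_ideal_iff] and B = assms(2)[unfolded fractional_ideal_iff]
  have sub: "x \<in> cfield" if "x \<in> A \<odot> B" for x
    using that
  proof (induction rule: iprod_induct)
    case (prod a b)
    then have "a \<in> cfield" "b \<in> cfield" using A B by blast+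
    then show ?case by simp
  qed simp
  have zero: "0 \<in> A \<odot> B" using iprod_prod[of 0 A 0 B] A B by simp
  obtain a b where "a \<in> A" "a \<noteq> 0" "b \<in> B" "b \<noteq> 0" using A B by blast
  then have nz: "\<exists>x\<in>A \<odot> B. x \<noteq> 0" using iprod_prod[of a A b B] by (intro bexI[of _ "a * b"]) auto
  have mul: "x * y \<in> A \<odot> B" if "x \<in> zint" "y \<in> A \<odot> B" for x y
    using that(2)
  proof (induction rule: iprod_induct)
    case (prod a b)
    then show ?case using iprod_prod[of "x * a" A b B] A that(1) by (auto simp: mult.assoc)
  qed (simp add: distrib_left iprod_add)
  obtain d e where de: "d \<in> zint - {0}" "\<forall>y\<in>A. d * y \<in> zint" "e \<in> zint - {0}" "\<forall>y\<in>B. e * y \<in> zint"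
    using A B by blast
  have "(d * e) * y \<in> zint" if "y \<in> A \<odot> B" for y
    using that
  proof (induction rule: iprod_induct)
    case (prod a b)
    have "(d * a) * (e * b) \<in> zint" using prod de by blast
    then show ?case by (simp add: mult_ac)
  qed (simp add: distrib_left)
  then have den: "\<exists>d\<in>zint - {0}. \<forall>y\<in>A \<odot> B. d * y \<in> zint" using de by (intro bexI[of _ "d * e"]) auto
  show ?thesis unfolding fractional_ideal_iff
    by (intro conjI ballI subsetI sub zero nz mul den iprod_add)
qed

lemma fractional_ideal_principal:
  assumes "x \<in> cfield" "x \<noteq> 0" shows "fractional_ideal \<zeta> (principal x)"
proof -
  obtain u w where uw: "u \<in> zint" "w \<in> zint" "w \<noteq> 0" "x = u / w" using assms(1) by (rule cfieldE)
  have "\<exists>d\<in>zint - {0}. \<forall>y\<in>principal x. d * y \<in> zint"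
    using uw by (intro bexI[of _ w]) (auto simp: principal_def)
  moreover have "x + y \<in> principal z" if xy: "x \<in> principal z" "y \<in> principal z" for x y z
  proof -
    obtain v v' where "v \<in> zint" "x = z * v" "v' \<in> zint" "y = z * v'" using xy by (auto simp: principal_def)
    then show ?thesis unfolding principal_def by (intro image_eqI[of _ _ "v + v'"]) (auto simp: distrib_left)
  qed
  moreover have "x * y \<in> principal z" if xy: "x \<in> zint" "y \<in> principal z" for x y z
  proof -
    obtain v where "v \<in> zint" "y = z * v" using xy(2) by (auto simp: principal_def)
    then show ?thesis using xy(1) unfolding principal_def by (intro image_eqI[of _ _ "x * v"]) (auto simp: mult_ac)
  qed
  moreover have "0 \<in> principal x" "x \<in> principal x" unfolding principal_def
    by (intro image_eqI[of _ _ 0] image_eqI[of _ _ 1]; simp)+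
  moreover have "principal x \<subseteq> cfield" using assms(1) by (auto simp: principal_def)
  ultimately show ?thesis unfolding fractional_ideal_iff using assms(2) by blast
qed

definition ideal_pth_power :: "complex \<Rightarrow> bool" where
  "ideal_pth_power x \<longleftrightarrow> (\<exists>J. fractional_ideal \<zeta> J \<and> principal x = frac_ideal_power \<zeta> J p)"

lemma ideal_pth_power_mult:
  "ideal_pth_power x \<Longrightarrow> ideal_pth_power y \<Longrightarrow> ideal_pth_power (x * y)"
  unfolding ideal_pth_power_def
  by (metis fractional_ideal_iprod frac_ideal_power_iprod iprod_principal)

lemma ideal_pth_power_pth_power:
  "x \<in> cfield \<Longrightarrow> x \<noteq> 0 \<Longrightarrow> ideal_pth_power (x ^ p)"
  unfolding ideal_pth_power_def using fractional_ideal_principal frac_ideal_power_principal by metis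

lemma ideal_pth_power_1: "ideal_pth_power 1"
  using ideal_pth_power_pth_power[of 1] by simp

lemma ideal_pth_power_power: "ideal_pth_power x \<Longrightarrow> ideal_pth_power (x ^ n)"
  by (induction n) (auto intro: ideal_pth_power_1 ideal_pth_power_mult)

lemma ideal_pth_power_prod:
  "(\<And>k. k \<in> A \<Longrightarrow> ideal_pth_power (f k)) \<Longrightarrow> ideal_pth_power (\<Prod>k\<in>A. f k)"
  by (induction A rule: infinite_finite_induct) (auto intro: ideal_pth_power_1 ideal_pth_power_mult)

text \<open>If \<open>x y\<close> is a \<open>p\<close>-th power \<open>z\<^sup>p\<close> and \<open>x\<close>, \<open>y\<close> are comaximal, then \<open>(x) = (x, z)\<^sup>p\<close>: the inclusion of the
  right-hand side is clear, and \<open>x = u x\<^sup>p + v z\<^sup>p\<close> if \<open>u x\<^bsup>p-1\<^esup> + v y = 1\<close>.\<close>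

lemma ideal_pth_power_comaximal:
  assumes "x \<in> zint" "y \<in> zint" "z \<in> zint" "x \<noteq> 0" "x * y = z ^ p"
    and "u \<in> zint" "v \<in> zint" "u * x + v * y = 1"
  shows "ideal_pth_power x"
proof -
  define J where "J = {x * s + z * t | s t. s \<in> zint \<and> t \<in> zint}"
  have JI: "x * s + z * t \<in> J" if "s \<in> zint" "t \<in> zint" for s t using that by (auto simp: J_def)
  have xz: "x \<in> J" "z \<in> J" using JI[of 1 0] JI[of 0 1] by auto
  have "J \<subseteq> zint" using assms by (auto simp: J_def)
  moreover have "r + s \<in> J" if rs: "r \<in> J" "s \<in> J" for r s
  proof -
    obtain s1 t1 s2 t2 where "s1 \<in> zint" "t1 \<in> zint" "r = x * s1 + z * t1" "s2 \<in> zint" "t2 \<in> zint" "s = x * s2 + z * t2"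
      using rs by (auto simp: J_def)
    then show ?thesis using JI[of "s1 + s2" "t1 + t2"] by (simp add: algebra_simps)
  qed
  moreover have "r * s \<in> J" if rs: "r \<in> zint" "s \<in> J" for r s
  proof -
    obtain s2 t2 where "s2 \<in> zint" "t2 \<in> zint" "s = x * s2 + z * t2" using rs by (auto simp: J_def)
    then show ?thesis using JI[of "r * s2" "r * t2"] rs(1) by (simp add: algebra_simps)
  qed
  moreover have "0 \<in> J" using JI[of 0 0] by simp
  moreover have "\<exists>d\<in>zint - {0}. \<forall>y\<in>J. d * y \<in> zint"
    using \<open>J \<subseteq> zint\<close> by (intro bexI[of _ 1]) auto
  moreover have "J \<subseteq> cfield" using \<open>J \<subseteq> zint\<close> by auto
  ultimately have frac: "fractional_ideal \<zeta> J"
    unfolding fractional_ideal_iff using xz(1) assms(4) by blast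
  have upper: "\<exists>s\<in>zint. \<exists>t\<in>zint. r = x * s + z ^ n * t" if "r \<in> frac_ideal_power \<zeta> J n" for r n
    using that
  proof (induction n arbitrary: r)
    case 0 then show ?case by (intro bexI[of _ 0] bexI[of _ r]) (auto simp: frac_ideal_power_0)
  next
    case (Suc n)
    from Suc.prems[unfolded frac_ideal_power_Suc] show ?case
    proof (induction rule: iprod_induct)
      case (prod a b)
      obtain s t where st: "s \<in> zint" "t \<in> zint" "a = x * s + z * t" using prod(1) by (auto simp: J_def)
      obtain s' t' where st': "s' \<in> zint" "t' \<in> zint" "b = x * s' + z ^ n * t'" using Suc.IH prod(2) by blast
      have "a * b = x * (s * b + z * t * s') + z ^ Suc n * (t * t')" unfolding st(3) st'(3) by (simp add: algebra_simps)
      moreover have "b \<in> zint" using st' assms by simp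
      ultimately show ?case using st st' assms(3)
        by (intro bexI[of _ "s * b + z * t * s'"] bexI[of _ "t * t'"]) auto
    next
      case (add r r')
      then obtain s t s' t' where "s \<in> zint" "t \<in> zint" "s' \<in> zint" "t' \<in> zint"
        "r = x * s + z ^ Suc n * t" "r' = x * s' + z ^ Suc n * t'" by blast
      then show ?case by (intro bexI[of _ "s + s'"] bexI[of _ "t + t'"]) (auto simp: algebra_simps)
    qed
  qed
  have lower: "w ^ n * r \<in> frac_ideal_power \<zeta> J n" if "w \<in> J" "r \<in> zint" for w r n
  proof (induction n)
    case 0 then show ?case using that by (simp add: frac_ideal_power_0)
  next
    case (Suc n)
    then show ?case unfolding frac_ideal_power_Suc using iprod_prod[OF that(1), of "w ^ n * r"] by (simp add: mult.assoc)
  qed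
  have comax: "\<exists>u\<in>zint. \<exists>v\<in>zint. u * x ^ n + v * y = 1" for n
  proof (induction n)
    case 0 show ?case by (intro bexI[of _ 1] bexI[of _ 0]) auto
  next
    case (Suc n)
    then obtain u' v' where uv: "u' \<in> zint" "v' \<in> zint" "u' * x ^ n + v' * y = 1" by blast
    have "(u * u') * x ^ Suc n + (u * x * v' + v) * y = u * x * (u' * x ^ n + v' * y) + v * y"
      by (simp add: algebra_simps)
    also have "\<dots> = 1" using uv(3) assms(8) by simp
    finally show ?case using uv assms by (intro bexI[of _ "u * u'"] bexI[of _ "u * x * v' + v"]) auto
  qed
  obtain n where n: "p = Suc n" using p_gt_2 by (cases p) auto
  have "principal x = frac_ideal_power \<zeta> J p"
  proof
    show "frac_ideal_power \<zeta> J p \<subseteq> principal x"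
    proof
      fix r assume "r \<in> frac_ideal_power \<zeta> J p"
      then obtain s t where st: "s \<in> zint" "t \<in> zint" "r = x * s + z ^ p * t" using upper by blast
      then have "r = x * (s + y * t)" by (simp add: assms(5)[symmetric] algebra_simps)
      then show "r \<in> principal x" using st assms(2) unfolding principal_def by blast
    qed
    show "principal x \<subseteq> frac_ideal_power \<zeta> J p"
    proof
      fix r assume "r \<in> principal x"
      then obtain s where s: "s \<in> zint" "r = x * s" by (auto simp: principal_def)
      obtain u' v' where uv: "u' \<in> zint" "v' \<in> zint" "u' * x ^ n + v' * y = 1" using comax by blast
      have "r = x * (u' * x ^ n + v' * y) * s" using uv s by simp
      also have "\<dots> = x ^ p * (u' * s) + (x * y) * (v' * s)" by (simp add: n algebra_simps)
      also have "\<dots> = x ^ p * (u' * s) + z ^ p * (v' * s)" by (simp only: assms(5))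
      also have "\<dots> \<in> frac_ideal_power \<zeta> J p"
        using lower[OF xz(1), of "u' * s" p] lower[OF xz(2), of "v' * s" p] uv s iprod_add
        unfolding n frac_ideal_power_Suc by blast
      finally show "r \<in> frac_ideal_power \<zeta> J p" .
    qed
  qed
  then show ?thesis using frac unfolding ideal_pth_power_def by blast
qed

definition local_units :: "complex set" where
  "local_units = {u / w | u w. u \<in> punits \<and> w \<in> punits}"

lemma local_unitsI: "u \<in> punits \<Longrightarrow> w \<in> punits \<Longrightarrow> u / w \<in> local_units"
  by (auto simp: local_units_def)

lemma punits_local_units: "u \<in> punits \<Longrightarrow> u \<in> local_units"
  using local_unitsI[of u 1] by simp

lemma local_units_nonzero: "x \<in> local_units \<Longrightarrow> x \<noteq> 0"
  by (auto simp: local_units_def dest: punits_nonzero)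

lemma local_units_cfield: "x \<in> local_units \<Longrightarrow> x \<in> cfield"
  by (auto simp: local_units_def intro!: cfieldI dest: punits_nonzero punits_zint)

lemma local_units_mult [simp]: "x \<in> local_units \<Longrightarrow> y \<in> local_units \<Longrightarrow> x * y \<in> local_units"
  unfolding local_units_def using punits_mult times_divide_times_eq by blast

lemma local_units_1 [simp]: "1 \<in> local_units"
  using punits_local_units by simp

lemma local_units_inverse [simp]: "x \<in> local_units \<Longrightarrow> inverse x \<in> local_units"
  unfolding local_units_def using inverse_divide by blast

lemma local_units_power [simp]: "x \<in> local_units \<Longrightarrow> x ^ n \<in> local_units"
  by (induction n) auto

lemma local_units_powi [simp]: "x \<in> local_units \<Longrightarrow> x powi n \<in> local_units"
  by (auto simp: power_int_def)

lemma local_units_prod: "(\<And>k. k \<in> A \<Longrightarrow> f k \<in> local_units) \<Longrightarrow> (\<Prod>k\<in>A. f k) \<in> local_units"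
  by (induction A rule: infinite_finite_induct) auto

lemma pseudo_unit_iff: 
  assumes "x \<in> local_units" shows "pseudo_unit p \<zeta> x \<longleftrightarrow> ideal_pth_power x"
proof -
  obtain u w where uw: "u \<in> punits" "w \<in> punits" "x = u / w" using assms by (auto simp: local_units_def)
  have "cyc_val \<zeta> x = 0" using cyc_val_eq[OF uw(1,2), of 0] uw(3) by simp
  then show ?thesis using local_units_cfield[OF assms] local_units_nonzero[OF assms]
    by (simp add: pseudo_unit_def ideal_pth_power_def principal_def cyc_int_carrier cyc_field_carrier)
qed

end


section \<open>Congruences modulo p and first-order expansions\<close>

context prime_cyclotomic
begin

text \<open>Peel off one factor \<open>T - 1\<close> of \<open>f - f(1)\<close> at a time. All moments of \<open>T - 1\<close> of positive order are \<open>1\<close>, so the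
  moment of order \<open>i + 1\<close> of \<open>(T - 1) g\<close> is \<open>i + 1\<close> times the moment of order \<open>i\<close> of \<open>g\<close> plus a combination of
  lower ones, and \<open>i + 1\<close> is invertible modulo \<open>p\<close>.\<close>

lemma pi_power_zdvd_of_moments:
  "j \<le> p - 1 \<Longrightarrow> (\<And>i. i < j \<Longrightarrow> int p dvd moment i f) \<Longrightarrow> \<pi> ^ j zdvd ev f \<zeta>"
proof (induction j arbitrary: f)
  case 0 then show ?case by (auto simp: zdvd_def)
next
  case (Suc j)
  have pr: "prime (int p)" using p_prime by simp
  have p1: "int p dvd poly f 1" using Suc.prems(2)[of 0] by (simp add: moment_0)
  have "poly (f - [:poly f 1:]) 1 = 0" by simp
  then obtain g where g: "f - [:poly f 1:] = [:- 1, 1:] * g"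
    unfolding poly_eq_0_iff_dvd by (auto elim: dvdE)
  have T: "moment l [:- 1, 1:] = (if l = 0 then 0 else 1)" for l
  proof -
    have "[:- 1, 1:] = monom 1 1 - [:1 :: int:]" by (simp add: monom_altdef)
    then show ?thesis by (simp add: moment_diff moment_monom moment_const)
  qed
  have h: "int p dvd moment i ([:- 1, 1:] * g)" if "i \<le> j" for i
    unfolding g[symmetric] using Suc.prems(2)[of i] that p1 by (simp add: moment_diff moment_const)
  have "int p dvd moment i g" if "i < j" for i
    using that
  proof (induction i rule: less_induct)
    case (less i)
    let ?t = "\<lambda>l. int (Suc i choose l) * moment l [:- 1, 1:] * moment (Suc i - l) g"
    have "moment (Suc i) ([:- 1, 1:] * g) = (\<Sum>l\<le>Suc i. ?t l)" by (rule moment_mult)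
    also have "{..Suc i} = insert 0 (insert 1 {2..Suc i})" by auto
    also have "(\<Sum>l\<in>insert 0 (insert 1 {2..Suc i}). ?t l) = int (Suc i) * moment i g + (\<Sum>l=2..Suc i. ?t l)"
      by (subst sum.insert) (auto simp: T)
    finally have e: "moment (Suc i) ([:- 1, 1:] * g) = int (Suc i) * moment i g + (\<Sum>l=2..Suc i. ?t l)" .
    have "int p dvd (\<Sum>l=2..Suc i. ?t l)"
      by (intro dvd_sum dvd_mult less.IH) (use less.prems in auto)
    then have "int p dvd int (Suc i) * moment i g"
      using h[of "Suc i"] less.prems unfolding e by (simp add: dvd_add_left_iff)
    moreover have "\<not> int p dvd int (Suc i)"
      using less.prems Suc.prems(1) by (auto dest!: zdvd_imp_le)
    ultimately show ?case using pr prime_dvd_mult_iff by blast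
  qed
  then have "\<pi> ^ j zdvd ev g \<zeta>" using Suc.IH Suc.prems(1) by simp
  then have "\<pi> ^ Suc j zdvd \<pi> * ev g \<zeta>" by (simp add: zdvd_mult_cancel)
  then have a: "\<pi> ^ Suc j zdvd - (\<pi> * ev g \<zeta>)" by simp
  have b: "\<pi> ^ Suc j zdvd of_int (poly f 1)"
  proof -
    have "\<pi> ^ Suc j zdvd \<pi> ^ (p - 1)" using Suc.prems(1) by (intro zdvd_power_le) auto
    also have "\<dots> zdvd of_int (int p)" using pi_power_zdvd_p by simp
    also have "\<dots> zdvd of_int (poly f 1)" by (rule zdvd_of_int[OF p1])
    finally show ?thesis .
  qed
  have "ev f \<zeta> = ev (f - [:poly f 1:]) \<zeta> + of_int (poly f 1)" by simp
  also have "ev (f - [:poly f 1:]) \<zeta> = - (\<pi> * ev g \<zeta>)" unfolding g by (simp add: ev_pCons \<pi>_def algebra_simps)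
  finally show ?case using zdvd_add[OF a b] by simp
qed

lemma moment_cyclotomic: "i \<le> p - 2 \<Longrightarrow> int p dvd moment i cyclotomic"
proof -
  assume i: "i \<le> p - 2"
  have "moment i cyclotomic = (\<Sum>n<p. int n ^ i)" by (simp add: cyclotomic_def moment_sum moment_monom)
  also have "int p dvd \<dots>"
  proof (cases "i = 0")
    case False
    have "{..<p} = insert 0 {1..p-1}" using p_gt_2 by auto
    then have "(\<Sum>n<p. int n ^ i) = (\<Sum>n=1..p-1. int n ^ i)" using False by simp
    moreover have "\<not> (p - 1) dvd i" using False i p_gt_2 by (auto dest!: dvd_imp_le)
    ultimately show ?thesis using sum_powers_mod_prime[OF p_prime, of i] by (simp add: cong_0_iff)
  qed simp
  finally show ?thesis .
qed

text \<open>Multiples of the cyclotomic polynomial, which account for the choice of \<open>f\<close>, have moments divisible by \<open>p\<close> up to the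
  order \<open>p - 2\<close>, and so have multiples of \<open>p\<close>. Conversely, such moments of \<open>f - f(1)\<close> make its value at \<open>\<zeta>\<close>
  divisible by \<open>\<pi>\<^bsup>p-1\<^esup>\<close>, that is, by \<open>p\<close>.\<close>

lemma cong_int_iff_moments:
  "(\<exists>r :: int. of_nat p zdvd ev f \<zeta> - of_int r) \<longleftrightarrow> (\<forall>i\<in>{1..p-2}. int p dvd moment i f)"
proof
  assume "\<exists>r :: int. of_nat p zdvd ev f \<zeta> - of_int r"
  then obtain r h where "ev f \<zeta> - of_int r = of_nat p * ev h \<zeta>" by (auto simp: zdvd_def elim!: zintE)
  then have "ev (f - [:r:] - smult (int p) h) \<zeta> = 0" by simp
  then obtain q where q: "f - [:r:] - smult (int p) h = cyclotomic * q"
    using cyclotomic_dvd_of_root by (blast elim: dvdE)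
  show "\<forall>i\<in>{1..p-2}. int p dvd moment i f"
  proof
    fix i assume i: "i \<in> {1..p-2}"
    have f: "f = cyclotomic * q + smult (int p) h + [:r:]" by (simp flip: q)
    have "int p dvd (\<Sum>j\<le>i. int (i choose j) * moment j cyclotomic * moment (i - j) q)"
      by (intro dvd_sum dvd_mult2 dvd_mult moment_cyclotomic) (use i in auto)
    then show "int p dvd moment i f"
      unfolding f using i by (simp add: moment_add moment_smult moment_const moment_mult)
  qed
next
  assume m: "\<forall>i\<in>{1..p-2}. int p dvd moment i f"
  have "\<pi> ^ (p - 1) zdvd ev (f - [:poly f 1:]) \<zeta>"
  proof (rule pi_power_zdvd_of_moments)
    fix i assume "i < p - 1"
    then show "int p dvd moment i (f - [:poly f 1:])"
      using m by (cases "i = 0") (auto simp: moment_diff moment_const moment_0)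
  qed simp
  then have "of_nat p zdvd ev f \<zeta> - of_int (poly f 1)" using zdvd_trans[OF p_zdvd_pi_power] by simp
  then show "\<exists>r :: int. of_nat p zdvd ev f \<zeta> - of_int r" by blast
qed

text \<open>This is why exponents in \<open>\<int>\<^sub>p\<close> make sense modulo \<open>p\<close>-th powers of units at \<open>\<pp>\<close>.\<close>

lemma prod_powi_cong_mod_pth_powers:
  fixes l l' :: "nat \<Rightarrow> int"
  assumes "finite A" "\<And>k. k \<in> A \<Longrightarrow> y k \<in> local_units" "\<And>k. k \<in> A \<Longrightarrow> [l k = l' k] (mod int p)"
  obtains c where "c \<in> local_units" "(\<Prod>k\<in>A. y k powi l k) = (\<Prod>k\<in>A. y k powi l' k) * c ^ p"
proof -
  define t where "t = (\<lambda>k. (l k - l' k) div int p)"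
  have t: "l k = l' k + t k * int p" if "k \<in> A" for k
    using assms(3)[OF that] by (simp add: t_def cong_iff_dvd_diff)
  have "(\<Prod>k\<in>A. y k powi l k) = (\<Prod>k\<in>A. y k powi l' k * (y k powi t k) ^ p)"
  proof (rule prod.cong)
    fix k assume k: "k \<in> A"
    have "y k \<noteq> 0" using assms(2)[OF k] local_units_nonzero by blast
    then show "y k powi l k = y k powi l' k * (y k powi t k) ^ p"
      unfolding t[OF k] by (simp add: power_int_add power_int_mult)
  qed simp
  then have "(\<Prod>k\<in>A. y k powi l k) = (\<Prod>k\<in>A. y k powi l' k) * (\<Prod>k\<in>A. y k powi t k) ^ p"
    by (simp add: prod.distrib prod_power_distrib)
  moreover have "(\<Prod>k\<in>A. y k powi t k) \<in> local_units" using assms(2) by (intro local_units_prod) auto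
  ultimately show ?thesis using that by blast
qed

text \<open>The automorphism \<open>s\<^sub>k\<close> fixes the constant term and multiplies \<open>\<pi>\<close> by \<open>k\<close> modulo \<open>\<pi>\<^sup>2\<close>.\<close>

lemma ev_conjugate_linear_cong:
  "\<exists>d :: int. \<forall>k. \<pi> ^ 2 zdvd ev h (\<zeta> ^ k) - (of_int (poly h 1) - of_int d * of_nat k * \<pi>)"
proof -
  have zk: "\<pi> ^ 2 zdvd \<zeta> ^ k - (1 - of_nat k * \<pi>)" for k
  proof (induction k)
    case (Suc k)
    have "\<zeta> ^ Suc k - (1 - of_nat (Suc k) * \<pi>) = (1 - \<pi>) * (\<zeta> ^ k - (1 - of_nat k * \<pi>)) + \<pi> ^ 2 * of_nat k"
      by (simp add: \<pi>_def power2_eq_square algebra_simps)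
    also have "\<pi> ^ 2 zdvd \<dots>"
      by (intro zdvd_add zdvd_mult2[OF Suc] zdvd_mult[OF zdvd_refl]) auto
    finally show ?case .
  qed simp
  show ?thesis
  proof (induction h)
    case 0 then show ?case by (intro exI[of _ 0]) simp
  next
    case (pCons c h)
    then obtain d where d: "\<And>k. \<pi> ^ 2 zdvd ev h (\<zeta> ^ k) - (of_int (poly h 1) - of_int d * of_nat k * \<pi>)" by blast
    have "\<pi> ^ 2 zdvd ev (pCons c h) (\<zeta> ^ k) - (of_int (poly (pCons c h) 1) - of_int (poly h 1 + d) * of_nat k * \<pi>)" for k
    proof -
      have "ev (pCons c h) (\<zeta> ^ k) - (of_int (poly (pCons c h) 1) - of_int (poly h 1 + d) * of_nat k * \<pi>) =
        (\<zeta> ^ k - (1 - of_nat k * \<pi>)) * ev h (\<zeta> ^ k) +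
        (1 - of_nat k * \<pi>) * (ev h (\<zeta> ^ k) - (of_int (poly h 1) - of_int d * of_nat k * \<pi>)) +
        \<pi> ^ 2 * (of_nat k * of_nat k * of_int d)"
        by (simp add: ev_pCons power2_eq_square algebra_simps)
      also have "\<pi> ^ 2 zdvd \<dots>"
        by (intro zdvd_add zdvd_mult2[OF d] zdvd_mult[OF zk] zdvd_mult[OF zdvd_refl]) auto
      finally show ?thesis .
    qed
    then show ?case by blast
  qed
qed

text \<open>The additional factor \<open>r\<close> on the left avoids the exponent \<open>\<Sum>\<^sub>k n\<^sub>k - 1\<close> in the linear term.\<close>

lemma prod_first_order_expansion:
  fixes n :: "nat \<Rightarrow> nat"
  assumes "finite A" "r \<in> zint" "\<And>k. k \<in> A \<Longrightarrow> w k \<in> zint"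
  shows "of_nat p ^ 2 zdvd r * (\<Prod>k\<in>A. (r + of_nat p * w k) ^ n k) -
           r ^ (\<Sum>k\<in>A. n k) * (r + of_nat p * (\<Sum>k\<in>A. of_nat (n k) * w k))"
  using assms(1,3)
proof (induction A rule: finite_induct)
  case empty then show ?case by simp
next
  case (insert i A)
  let ?X = "\<Prod>k\<in>A. (r + of_nat p * w k) ^ n k" and ?N = "\<Sum>k\<in>A. n k" and ?S = "\<Sum>k\<in>A. of_nat (n k) * w k"
  let ?q = "of_nat p :: complex"
  have Z: "?X \<in> zint" "?S \<in> zint" "w i \<in> zint" using insert.prems assms(2) by (auto intro!: zint_prod zint_sum)
  have "?q ^ 2 zdvd r * ?X * (r + ?q * w i) ^ j - r ^ (?N + j) * (r + ?q * (?S + of_nat j * w i))" for j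
  proof (induction j)
    case 0 then show ?case using insert by simp
  next
    case (Suc j)
    let ?Y = "r * ?X * (r + ?q * w i) ^ j" and ?R = "r ^ (?N + j)" and ?T = "?S + of_nat j * w i"
    have "r * ?X * (r + ?q * w i) ^ Suc j - r ^ (?N + Suc j) * (r + ?q * (?S + of_nat (Suc j) * w i)) =
       (?Y - ?R * (r + ?q * ?T)) * (r + ?q * w i) + ?q ^ 2 * (?R * ?T * w i)"
      by (simp add: power2_eq_square algebra_simps)
    also have "?q ^ 2 zdvd \<dots>"
      by (intro zdvd_add zdvd_mult[OF Suc] zdvd_mult[OF zdvd_refl]) (use Z assms(2) in auto)
    finally show ?case .
  qed
  from this[of "n i"] show ?case using insert.hyps by (simp add: mult_ac add_ac)
qed

end


section \<open>The first case of Fermat's equation\<close>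

lemma binomial_pred_prime_cong:
  assumes "prime p" "j \<le> p - 1" shows "[int ((p - 1) choose j) = (- 1) ^ j] (mod int p)"
  using assms(2)
proof (induction j)
  case 0 then show ?case by simp
next
  case (Suc j)
  have p: "p = Suc (p - 1)" using assms(1) prime_gt_0_nat by simp
  have "p choose Suc j = (p - 1 choose j) + (p - 1 choose Suc j)" by (subst p) simp
  moreover have "int p dvd int (p choose Suc j)"
    using dvd_choose_prime[of "Suc j" p] assms(1) Suc.prems p by simp
  ultimately have "[int (p - 1 choose j) + int (p - 1 choose Suc j) = 0] (mod int p)"
    by (simp add: cong_0_iff)
  from cong_diff[OF this Suc.IH] Suc.prems show ?case by simp
qed

text \<open>This is the classical expansion \<open>((1-x)\<^sup>p - 1 + x\<^sup>p)/p \<equiv> - \<Sum>\<^sub>k x\<^sup>k/k\<close>, the inverse of \<open>k\<close> being \<open>k\<^bsup>p-2\<^esup>\<close>.\<close>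

lemma binomial_expansion_mod_p_squared:
  fixes x :: int
  assumes "prime p" "p > 2"
  shows "int p ^ 2 dvd (1 - x) ^ p - 1 + x ^ p + int p * (\<Sum>k=1..p-1. int k ^ (p - 2) * x ^ k)"
proof -
  define q where "q = (\<lambda>k. int (p choose k) div int p)"
  have pq: "int (p choose k) = int p * q k" if "k \<in> {1..p-1}" for k
    using dvd_choose_prime[of k p] assms that by (auto simp: q_def)
  have q: "[q k * (- x) ^ k = - (int k ^ (p - 2) * x ^ k)] (mod int p)" if k: "k \<in> {1..p-1}" for k
  proof -
    have "Suc (k - 1) * (Suc (p - 1) choose Suc (k - 1)) = Suc (p - 1) * ((p - 1) choose (k - 1))"
      by (rule Suc_times_binomial)
    moreover have "Suc (k - 1) = k" "Suc (p - 1) = p" using k by auto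
    ultimately have "k * (p choose k) = p * ((p - 1) choose (k - 1))" by (simp only:)
    then have "int k * int (p choose k) = int p * int ((p - 1) choose (k - 1))"
      by (metis of_nat_mult)
    then have "int k * q k = int ((p - 1) choose (k - 1))" using pq[OF k] assms by simp
    moreover have "[int ((p - 1) choose (k - 1)) = (- 1) ^ (k - 1)] (mod int p)"
      using k by (intro binomial_pred_prime_cong assms) auto
    ultimately have "[int k ^ (p - 2) * (int k * q k) = int k ^ (p - 2) * (- 1) ^ (k - 1)] (mod int p)"
      by (intro cong_mult) auto
    moreover have "int k ^ (p - 2) * int k = int k ^ (p - 1)"
      using power_minus_mult[of "p - 1" "int k"] assms(2) by (simp add: numeral_2_eq_2)
    ultimately have "[int k ^ (p - 1) * q k = int k ^ (p - 2) * (- 1) ^ (k - 1)] (mod int p)"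
      by (simp flip: mult.assoc)
    moreover have "[int k ^ (p - 1) * q k = 1 * q k] (mod int p)"
      using k by (intro cong_mult fermat_little_int assms) (auto dest!: dvd_imp_le)
    ultimately have "[q k = int k ^ (p - 2) * (- 1) ^ (k - 1)] (mod int p)"
      by (metis cong_sym cong_trans mult_1)
    then have "[q k * (- x) ^ k = int k ^ (p - 2) * (- 1) ^ (k - 1) * (- x) ^ k] (mod int p)"
      by (rule cong_mult) simp
    moreover have "(- 1) ^ (k - 1) * (- x) ^ k = - (x ^ k)"
    proof -
      obtain i where i: "k = Suc i" using k by (cases k) auto
      have "(- x) ^ k = - ((- 1) ^ i * x ^ k)" unfolding power_minus[of x k] by (simp add: i)
      then have "(- 1) ^ (k - 1) * (- x) ^ k = - ((- 1) ^ i * ((- 1) ^ i * x ^ k))"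
        by (simp only: i diff_Suc_1 mult_minus_right)
      then show ?thesis by (simp only: left_minus_one_mult_self)
    qed
    ultimately show ?thesis by (simp add: mult.assoc)
  qed
  have "(1 - x) ^ p = (- x + 1) ^ p" by simp
  also have "\<dots> = (\<Sum>k\<le>p. int (p choose k) * (- x) ^ k)" by (subst binomial_ring) simp
  also have "{..p} = insert 0 (insert p {1..p-1})" using assms by auto
  also have "(\<Sum>k\<in>insert 0 (insert p {1..p-1}). int (p choose k) * (- x) ^ k) =
      1 + (- x) ^ p + (\<Sum>k=1..p-1. int (p choose k) * (- x) ^ k)"
    using assms by (subst sum.insert) auto
  also have "(\<Sum>k=1..p-1. int (p choose k) * (- x) ^ k) = int p * (\<Sum>k=1..p-1. q k * (- x) ^ k)"
    by (simp add: pq sum_distrib_left mult.assoc)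
  also have "(- x) ^ p = - (x ^ p)" using assms prime_odd_nat by auto
  finally have "(1 - x) ^ p - 1 + x ^ p + int p * (\<Sum>k=1..p-1. int k ^ (p - 2) * x ^ k) =
     int p * ((\<Sum>k=1..p-1. q k * (- x) ^ k) - (\<Sum>k=1..p-1. - (int k ^ (p - 2) * x ^ k)))"
    by (simp add: sum_negf distrib_left)
  moreover have "int p dvd (\<Sum>k=1..p-1. q k * (- x) ^ k) - (\<Sum>k=1..p-1. - (int k ^ (p - 2) * x ^ k))"
    using cong_sum[of "{1..p-1}" "\<lambda>k. q k * (- x) ^ k" "\<lambda>k. - (int k ^ (p - 2) * x ^ k)" "int p"] q
    by (simp add: cong_iff_dvd_diff)
  ultimately show ?thesis by (simp add: power2_eq_square)
qed

locale fermat_first_case = prime_cyclotomic +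
  fixes a b c :: int
  assumes coprime_ab: "coprime a b" and coprime_ac: "coprime a c"
    and fermat: "a ^ p + b ^ p + c ^ p = 0" and first_case: "\<not> int p dvd a * b * c"
begin

lemma odd_p: "odd p"
  using p_prime p_gt_2 prime_odd_nat by auto

lemma prime_int_p: "prime (int p)"
  using p_prime by simp

lemma p_ndvd: "\<not> int p dvd a" "\<not> int p dvd b" "\<not> int p dvd c"
  using first_case by auto

lemma sum_cong: "[a + b = - c] (mod int p)"
proof -
  have "[a ^ p + b ^ p = a + b] (mod int p)" by (intro cong_add power_prime_cong p_prime)
  moreover have "[(- c) ^ p = - c] (mod int p)" by (rule power_prime_cong[OF p_prime])
  moreover have "a ^ p + b ^ p = (- c) ^ p" using fermat odd_p by simp
  ultimately show ?thesis by (metis cong_sym cong_trans)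
qed

lemma p_ndvd_sum: "\<not> int p dvd a + b"
  using sum_cong p_ndvd(3) cong_dvd_iff by fastforce

text \<open>Multiplied by \<open>a\<^sup>p\<close>, the expression \<open>(1-x)\<^sup>p - 1 + x\<^sup>p\<close> becomes \<open>(a+b)\<^sup>p - a\<^sup>p - b\<^sup>p = (a+b)\<^sup>p - (-c)\<^sup>p\<close> modulo
  \<open>p\<^sup>2\<close>, and the bases \<open>a + b\<close> and \<open>-c\<close> agree modulo \<open>p\<close>.\<close>

lemma sum_kth_inverse_powers_dvd:
  assumes "[a * x = - b] (mod int p)"
  shows "int p dvd (\<Sum>k=1..p-1. int k ^ (p - 2) * x ^ k)"
proof -
  let ?S = "\<Sum>k=1..p-1. int k ^ (p - 2) * x ^ k"
  have lift: "[u ^ p = v ^ p] (mod int p ^ 2)" if "[u = v] (mod int p)" for u v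
    using cong_prime_power_lift[OF p_prime that, of 1] by (simp add: numeral_2_eq_2)
  have "[a - a * x = a - (- b)] (mod int p)" using assms by (intro cong_diff) auto
  then have "[a - a * x = - c] (mod int p)" using cong_trans[OF _ sum_cong] by simp
  then have "[(a - a * x) ^ p - a ^ p + (a * x) ^ p = (- c) ^ p - a ^ p + (- b) ^ p] (mod int p ^ 2)"
    by (intro cong_add cong_diff lift assms) auto
  moreover have "(- c) ^ p - a ^ p + (- b) ^ p = 0" using fermat odd_p by simp
  moreover have "(a - a * x) ^ p - a ^ p + (a * x) ^ p = a ^ p * ((1 - x) ^ p - 1 + x ^ p)"
  proof -
    have "a - a * x = a * (1 - x)" by (simp add: right_diff_distrib)
    then have "(a - a * x) ^ p = a ^ p * (1 - x) ^ p" by (simp only: power_mult_distrib)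
    then show ?thesis by (simp add: power_mult_distrib distrib_left right_diff_distrib)
  qed
  ultimately have "int p ^ 2 dvd a ^ p * ((1 - x) ^ p - 1 + x ^ p)" by (simp add: cong_0_iff)
  moreover have "coprime (int p ^ 2) (a ^ p)"
    using prime_imp_coprime[OF prime_int_p p_ndvd(1)] by simp
  ultimately have "int p ^ 2 dvd (1 - x) ^ p - 1 + x ^ p" by (simp add: coprime_dvd_mult_right_iff)
  then have "int p ^ 2 dvd int p * ?S"
    using binomial_expansion_mod_p_squared[OF p_prime p_gt_2, of x] dvd_add_right_iff by blast
  then show ?thesis using p_gt_2 by (simp add: power2_eq_square)
qed

definition factor :: "nat \<Rightarrow> complex" where
  "factor k = of_int a + of_int b * \<zeta> ^ k"

lemma factor_ev: "factor k = ev ([:a:] + monom b k) \<zeta>"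
  by (simp add: factor_def)

lemma factor_punits: "factor k \<in> punits"
  using p_ndvd_sum pi_zdvd_ev_iff[of "[:a:] + monom b k"] ev_in_zint[of "[:a:] + monom b k"]
  by (simp add: factor_ev poly_monom punits_def)

lemma coprime_p_a_c: "coprime (int p * a ^ (p - 1)) ((- c) ^ p)"
  using coprime_ac prime_imp_coprime[OF prime_int_p p_ndvd(3)] by simp

text \<open>Modulo \<open>a - y\<close>, the cofactor \<open>(a\<^sup>p - y\<^sup>p)/(a - y)\<close> is \<open>p a\<^bsup>p-1\<^esup>\<close>, which is prime to \<open>c\<close>. So each linear
  factor is comaximal with its cofactor.\<close>

lemma factor_ideal_pth_power: "ideal_pth_power (factor k)"
proof -
  define y where "y = - (of_int b * \<zeta> ^ k)"
  define Y where "Y = (\<Sum>i<p. y ^ (p - Suc i) * of_int a ^ i)"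
  have y: "y \<in> zint" by (auto simp: y_def)
  have f: "factor k = of_int a - y" by (simp add: factor_def y_def)
  have Y: "Y \<in> zint" using y by (auto simp: Y_def)
  have fY: "factor k * Y = of_int (- c) ^ p"
  proof -
    have "factor k * Y = of_int a ^ p - y ^ p"
      unfolding f Y_def by (rule power_diff_sumr2[symmetric])
    also have "y ^ p = - (of_int b ^ p)"
    proof -
      have "(\<zeta> ^ k) ^ p = (\<zeta> ^ p) ^ k" by (simp add: power_mult[symmetric] mult.commute)
      then show ?thesis using odd_p by (simp add: y_def power_mult_distrib zeta_pow_p)
    qed
    also have "of_int a ^ p - - (of_int b ^ p) = (of_int (a ^ p + b ^ p) :: complex)" by simp
    also have "a ^ p + b ^ p = (- c) ^ p" using fermat odd_p by simp
    finally show ?thesis by simp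
  qed
  have "factor k zdvd (\<Sum>i<p. y ^ (p - Suc i) * of_int a ^ i - of_int a ^ (p - 1))"
  proof (rule zdvd_sum)
    fix i assume "i \<in> {..<p}"
    then have e: "of_int a ^ (p - 1) = (of_int a ^ (p - Suc i) * of_int a ^ i :: complex)"
      by (simp flip: power_add)
    have "factor k zdvd of_int a ^ j - y ^ j" for j
      unfolding zdvd_def f power_diff_sumr2 using y
      by (intro bexI[of _ "\<Sum>i<j. y ^ (j - Suc i) * of_int a ^ i"]) auto
    then have "factor k zdvd - (of_int a ^ (p - Suc i) - y ^ (p - Suc i)) * of_int a ^ i"
      by (intro zdvd_mult) (simp_all only: zdvd_uminus_iff zint_power zint_of_int)
    then show "factor k zdvd y ^ (p - Suc i) * of_int a ^ i - of_int a ^ (p - 1)"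
      unfolding e by (simp add: left_diff_distrib)
  qed
  also have "(\<Sum>i<p. y ^ (p - Suc i) * of_int a ^ i - of_int a ^ (p - 1)) = Y - of_int (int p * a ^ (p - 1))"
    by (simp add: Y_def sum_subtractf)
  finally obtain t where t: "t \<in> zint" "Y - of_int (int p * a ^ (p - 1)) = factor k * t"
    by (auto simp: zdvd_def)
  obtain r s where rs: "r * (int p * a ^ (p - 1)) + s * (- c) ^ p = 1"
    using bezout_int[of "int p * a ^ (p - 1)" "(- c) ^ p"] coprime_p_a_c by (auto simp: coprime_iff_gcd_eq_1)
  have "(of_int s * Y - of_int r * t) * factor k + of_int r * Y =
      of_int r * (Y - factor k * t) + of_int s * (factor k * Y)" by (simp add: algebra_simps)
  also have "\<dots> = of_int (r * (int p * a ^ (p - 1)) + s * (- c) ^ p)"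
    unfolding fY t(2)[symmetric] by simp
  finally have "(of_int s * Y - of_int r * t) * factor k + of_int r * Y = 1" by (simp only: rs of_int_1)
  then show ?thesis
    using ideal_pth_power_comaximal[OF _ Y zint_of_int[of "- c"] _ fY, of "of_int s * Y - of_int r * t" "of_int r"]
      factor_punits[of k] punits_zint punits_nonzero Y t(1) by auto
qed

text \<open>The argument for the linear factors, at \<open>\<zeta>\<^sup>0 = 1\<close>, where unique factorization is available.\<close>

lemma sum_is_pth_power: obtains d where "a + b = d ^ p"
proof -
  define Y where "Y = (\<Sum>i<p. (- b) ^ (p - Suc i) * a ^ i)"
  have fY: "(a + b) * Y = (- c) ^ p"
    using power_diff_sumr2[of a p "- b"] fermat odd_p by (simp add: Y_def)
  have "(a + b) dvd (\<Sum>i<p. (- b) ^ (p - Suc i) * a ^ i - a ^ (p - 1))"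
  proof (rule dvd_sum)
    fix i assume "i \<in> {..<p}"
    then have e: "a ^ (p - 1) = a ^ (p - Suc i) * a ^ i" by (simp flip: power_add)
    have "(a + b) dvd a ^ (p - Suc i) - (- b) ^ (p - Suc i)"
      using power_diff_sumr2[of a "p - Suc i" "- b"] by simp
    then have "(a + b) dvd - (a ^ (p - Suc i) - (- b) ^ (p - Suc i)) * a ^ i" by (simp only: dvd_mult2 dvd_minus_iff)
    then show "(a + b) dvd (- b) ^ (p - Suc i) * a ^ i - a ^ (p - 1)"
      unfolding e by (simp add: left_diff_distrib)
  qed
  then have Y: "(a + b) dvd Y - int p * a ^ (p - 1)" by (simp add: Y_def sum_subtractf)
  have "coprime (a + b) Y"
  proof (rule coprimeI)
    fix g assume g: "g dvd a + b" "g dvd Y"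
    from dvd_diff[OF g(2) dvd_trans[OF g(1) Y]]
    have "g dvd int p * a ^ (p - 1)" by simp
    moreover have "g dvd (- c) ^ p" using g(1) by (simp flip: fY)
    ultimately show "is_unit g" using coprime_p_a_c coprime_common_divisor by blast
  qed
  then have cop: "coprime (nat \<bar>a + b\<bar>) (nat \<bar>Y\<bar>)"
    by (simp flip: coprime_int_iff)
  have "(a + b) * Y \<noteq> 0" unfolding fY using p_ndvd(3) by auto
  then have nz: "nat \<bar>a + b\<bar> > 0" "nat \<bar>Y\<bar> > 0" by auto
  have "nat \<bar>a + b\<bar> * nat \<bar>Y\<bar> = nat \<bar>c\<bar> ^ p"
  proof -
    have "\<bar>a + b\<bar> * \<bar>Y\<bar> = \<bar>c\<bar> ^ p" using fY by (metis abs_minus_cancel abs_mult power_abs)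
    then show ?thesis by (metis abs_ge_zero nat_mult_distrib nat_power_eq)
  qed
  then have "is_nth_power p (nat \<bar>a + b\<bar> * nat \<bar>Y\<bar>)" by (auto simp: is_nth_power_def)
  then have "is_nth_power p (nat \<bar>a + b\<bar>)" using is_nth_power_mult_coprime_natD(1)[OF cop _ nz] by blast
  then obtain n where n: "nat \<bar>a + b\<bar> = n ^ p" by (auto simp: is_nth_power_def)
  then have "\<bar>a + b\<bar> = int n ^ p" by (metis abs_ge_zero int_nat_eq of_nat_power)
  then have "a + b = int n ^ p \<or> a + b = (- int n) ^ p" using odd_p by auto
  then show ?thesis using that by blast
qed

text \<open>The factorization of \<open>a\<^sup>p + b\<^sup>p\<close>, from that of \<open>z\<^sup>p - 1\<close> at \<open>z = -a/b\<close>.\<close>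

lemma prod_factors: "of_int (a + b) * (\<Prod>k=1..p-1. factor k) = of_int (- c) ^ p"
proof -
  define z :: complex where "z = - of_int a / of_int b"
  have b: "(of_int b :: complex) \<noteq> 0" using p_ndvd(2) by auto
  have bz: "of_int b * z = - of_int a" using b by (simp add: z_def)
  have "(\<Prod>k=1..p-1. factor k) = (\<Prod>k=1..p-1. (- of_int b) * (z - \<zeta> ^ k))"
    by (rule prod.cong) (simp_all add: factor_def right_diff_distrib bz)
  also have "\<dots> = (- of_int b) ^ (p - 1) * (\<Sum>i<p. z ^ i)"
    unfolding prod_root_differences[symmetric] prod.distrib by simp
  finally have P: "(\<Prod>k=1..p-1. factor k) = (- of_int b) ^ (p - 1) * (\<Sum>i<p. z ^ i)" .
  have "of_int (a + b) = (- of_int b) * (z - 1)" by (simp add: right_diff_distrib bz)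
  then have "of_int (a + b) * (\<Prod>k=1..p-1. factor k) =
      (- of_int b) * (- of_int b) ^ (p - 1) * ((z - 1) * (\<Sum>i<p. z ^ i))"
    unfolding P by (simp only: mult_ac)
  also have "(- of_int b) * (- of_int b) ^ (p - 1) = (- of_int b :: complex) ^ p"
    using p_gt_2 by (metis power_minus_mult mult.commute gr_implies_not0 neq0_conv)
  also have "(z - 1) * (\<Sum>i<p. z ^ i) = z ^ p - 1" by (rule power_diff_1_eq[symmetric])
  also have "(- of_int b) ^ p * (z ^ p - 1) = (- (of_int b * z)) ^ p - (- of_int b) ^ p"
    by (simp add: right_diff_distrib power_mult_distrib[symmetric])
  also have "\<dots> = of_int (a ^ p + b ^ p)" using odd_p by (simp add: bz)
  also have "a ^ p + b ^ p = (- c) ^ p" using fermat odd_p by simp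
  finally show ?thesis by simp
qed

text \<open>A natural number congruent to \<open>-k\<^sup>-\<^sup>m\<close>, the coefficient of \<open>s\<^sub>k\<close> in the idempotent, which moreover depends
  multiplicatively on \<open>k\<close> up to the factor \<open>p - 1\<close>.\<close>

definition expo :: "nat \<Rightarrow> nat \<Rightarrow> nat" where
  "expo m k = (p - 1) * k ^ (p - 1 - m)"

definition component :: "nat \<Rightarrow> complex" where
  "component m = (\<Prod>k=1..p-1. factor k ^ expo m k)"

definition component_poly :: "nat \<Rightarrow> int poly" where
  "component_poly m = (\<Prod>k=1..p-1. ([:a:] + monom b k) ^ expo m k)"

lemma component_ev: "component m = ev (component_poly m) \<zeta>"
  by (simp add: component_def component_poly_def factor_def)

lemma ev_component_poly_conjugate:
  "ev (component_poly m) (\<zeta> ^ k) = (\<Prod>j=1..p-1. factor (k * j) ^ expo m j)"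
  by (simp add: component_poly_def factor_def power_mult)

lemma component_punits: "component m \<in> punits"
proof -
  have "(\<Prod>k\<in>A. factor k ^ expo m k) \<in> punits" for A
    by (induction A rule: infinite_finite_induct) (auto simp: factor_punits)
  then show ?thesis by (simp add: component_def)
qed

lemma component_ideal_pth_power: "ideal_pth_power (component m)"
  unfolding component_def by (intro ideal_pth_power_prod ideal_pth_power_power factor_ideal_pth_power)

text \<open>The idempotent reproduces \<^term>\<open>component m\<close>: one has \<open>expo m j * expo m k = (p-1) * expo m (j*k)\<close>,
  multiplication by \<open>k\<close> permutes the residues \<open>j\<close>, and the resulting exponent \<open>(p-1)\<^sup>2\<close> is congruent to \<open>1\<close>.\<close>

lemma component_idempotent:
  obtains t where "t \<in> local_units"
    "(\<Prod>k=1..p-1. ev (component_poly m) (\<zeta> ^ k) ^ expo m k) = component m * t ^ p"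
proof -
  have "\<exists>t\<in>local_units. (\<Prod>j=1..p-1. factor (k * j) ^ expo m (k * j)) = component m * t ^ p" if k: "k \<in> {1..p-1}" for k
  proof -
    have nd: "\<not> p dvd k" using k by (auto dest!: dvd_imp_le)
    have "[int (expo m (k * j)) = int (expo m (k * j mod p))] (mod int p)" for j
    proof -
      have "[k * j = k * j mod p] (mod p)" by (simp add: cong_def)
      then have "[expo m (k * j) = expo m (k * j mod p)] (mod p)"
        unfolding expo_def by (intro cong_mult cong_pow cong_refl)
      then show ?thesis by (simp only: cong_int_iff)
    qed
    then obtain t where t: "t \<in> local_units"
      "(\<Prod>j=1..p-1. factor (k * j) powi int (expo m (k * j))) = (\<Prod>j=1..p-1. factor (k * j) powi int (expo m (k * j mod p))) * t ^ p"
      using prod_powi_cong_mod_pth_powers[of "{1..p-1}" "\<lambda>j. factor (k * j)" "\<lambda>j. int (expo m (k * j))" "\<lambda>j. int (expo m (k * j mod p))"]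
        punits_local_units[OF factor_punits] by blast
    have "component m = (\<Prod>j=1..p-1. factor (k * j mod p) ^ expo m (k * j mod p))"
      unfolding component_def
      by (rule prod.reindex_bij_betw[OF bij_betw_mult_mod_prime[OF p_prime nd], symmetric])
    also have "\<dots> = (\<Prod>j=1..p-1. factor (k * j) powi int (expo m (k * j mod p)))"
      by (simp add: factor_def zeta_pow_mod)
    finally show ?thesis using t by (intro bexI[of _ t]) simp_all
  qed
  then obtain t where t: "\<And>k. k \<in> {1..p-1} \<Longrightarrow> t k \<in> local_units \<and>
      (\<Prod>j=1..p-1. factor (k * j) ^ expo m (k * j)) = component m * t k ^ p" by metis
  let ?C = "component m"
  have "(\<Prod>k=1..p-1. ev (component_poly m) (\<zeta> ^ k) ^ expo m k) = (\<Prod>k=1..p-1. (?C * t k ^ p) ^ (p - 1))"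
  proof (rule prod.cong)
    fix k assume k: "k \<in> {1..p-1}"
    have e: "expo m j * expo m k = expo m (k * j) * (p - 1)" for j
      by (simp add: expo_def power_mult_distrib)
    have "ev (component_poly m) (\<zeta> ^ k) ^ expo m k = (\<Prod>j=1..p-1. factor (k * j) ^ expo m (k * j)) ^ (p - 1)"
      by (simp add: ev_component_poly_conjugate prod_power_distrib power_mult[symmetric] e)
    then show "ev (component_poly m) (\<zeta> ^ k) ^ expo m k = (?C * t k ^ p) ^ (p - 1)" using t[OF k] by simp
  qed simp
  also have "\<dots> = ?C ^ ((p - 1) * (p - 1)) * (\<Prod>k=1..p-1. t k ^ (p - 1)) ^ p"
    by (simp add: power_mult_distrib prod.distrib prod_power_distrib[symmetric] power_mult[symmetric] mult.commute)
  also have "(p - 1) * (p - 1) = 1 + (p - 2) * p"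
  proof -
    obtain q where "p = Suc (Suc q)" using p_gt_2 by (metis add_2_eq_Suc le_Suc_ex less_imp_le)
    then show ?thesis by simp
  qed
  finally have "(\<Prod>k=1..p-1. ev (component_poly m) (\<zeta> ^ k) ^ expo m k) =
      ?C * (?C ^ (p - 2) * (\<Prod>k=1..p-1. t k ^ (p - 1))) ^ p"
    by (simp add: power_add power_mult power_mult_distrib mult.assoc)
  moreover have "?C ^ (p - 2) * (\<Prod>k=1..p-1. t k ^ (p - 1)) \<in> local_units"
    using t punits_local_units[OF component_punits] by (intro local_units_mult local_units_power local_units_prod) auto
  ultimately show ?thesis using that by blast
qed

text \<open>If \<open>component m = r + p h(\<zeta>)\<close>, the idempotent turns it into \<open>B = \<Prod>\<^sub>k (r + p h(\<zeta>\<^sup>k))\<^bsup>expo m k\<^esup>\<close>. Modulo \<open>p \<pi>\<^sup>2\<close> the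
  linear term of \<open>B\<close> in \<open>p\<close> is a combination of \<open>\<Sum>\<^sub>k expo m k\<close> and \<open>\<pi> \<Sum>\<^sub>k k expo m k\<close>. These are divisible by \<open>p\<close>, as \<open>m \<noteq> p - 1\<close>
  and \<open>m \<noteq> 1\<close> respectively. What is left is \<open>r\<close> to the power \<open>\<Sum>\<^sub>k expo m k\<close>, a \<open>p\<close>-th power.\<close>

lemma local_pth_power_of_cong_int:
  assumes m: "2 \<le> m" "m \<le> p - 2" and r: "of_nat p zdvd component m - of_int r"
  shows "local_pth_power p \<zeta> (component m)"
proof -
  let ?F = "component_poly m" and ?A = "{1..p-1}" and ?l = "expo m"
  let ?M = "of_nat p * \<pi> ^ 2"
  obtain h where h: "component m - of_int r = of_nat p * ev h \<zeta>" using r by (auto simp: zdvd_def elim!: zintE)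
  define w where "w = (\<lambda>k. ev h (\<zeta> ^ k))"
  have conj: "ev ?F (\<zeta> ^ k) = of_int r + of_nat p * w k" if k: "k \<in> ?A" for k
  proof -
    have nd: "\<not> p dvd k" using k by (auto dest!: dvd_imp_le)
    have "ev (?F - [:r:] - smult (int p) h) \<zeta> = 0" using h by (simp add: component_ev)
    then have "ev (?F - [:r:] - smult (int p) h) (\<zeta> ^ k) = 0" using ev_conjugate_eq_0_iff[OF nd] by blast
    then show ?thesis by (simp add: w_def algebra_simps)
  qed
  define B where "B = (\<Prod>k\<in>?A. (of_int r + of_nat p * w k) ^ ?l k)"
  have w: "w k \<in> zint" for k by (auto simp: w_def)
  have B: "B \<in> zint" using w by (auto simp: B_def)
  have pi2_p: "\<pi> ^ 2 zdvd of_nat p"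
    using zdvd_trans[OF zdvd_power_le[of 2 "p - 1" \<pi>] pi_power_zdvd_p] p_gt_2 by simp
  have ppi2_p2: "?M zdvd of_nat p ^ 2"
    using zdvd_mult_mono[OF zdvd_refl pi2_p] by (simp add: power2_eq_square)
  have L: "int p dvd (\<Sum>k\<in>?A. int (?l k))"
  proof -
    have "\<not> (p - 1) dvd (p - 1 - m)" using m by (auto dest!: dvd_imp_le)
    then have "int p dvd (\<Sum>k\<in>?A. int k ^ (p - 1 - m))"
      using sum_powers_mod_prime[OF p_prime, of "p - 1 - m"] by (simp add: cong_0_iff)
    then show ?thesis by (simp add: expo_def flip: sum_distrib_left)
  qed
  have L1: "int p dvd (\<Sum>k\<in>?A. int (?l k) * int k)"
  proof -
    have "\<not> (p - 1) dvd (p - m)" using m by (auto dest!: dvd_imp_le)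
    then have "int p dvd (\<Sum>k\<in>?A. int k ^ (p - m))"
      using sum_powers_mod_prime[OF p_prime, of "p - m"] by (simp add: cong_0_iff)
    moreover have "int (?l k) * int k = int (p - 1) * int k ^ (p - m)" for k
    proof -
      have "p - m = Suc (p - 1 - m)" using m by simp
      then show ?thesis by (simp add: expo_def)
    qed
    ultimately show ?thesis by (simp flip: sum_distrib_left)
  qed
  have W: "\<pi> ^ 2 zdvd (\<Sum>k\<in>?A. of_nat (?l k) * w k)"
  proof -
    obtain d where d: "\<And>k. \<pi> ^ 2 zdvd w k - (of_int (poly h 1) - of_int d * of_nat k * \<pi>)"
      using ev_conjugate_linear_cong[of h] unfolding w_def by blast
    have "(\<Sum>k\<in>?A. of_nat (?l k) * w k) =
      (\<Sum>k\<in>?A. of_nat (?l k) * (w k - (of_int (poly h 1) - of_int d * of_nat k * \<pi>))) +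
      (\<Sum>k\<in>?A. of_nat (?l k)) * of_int (poly h 1) - (\<Sum>k\<in>?A. of_nat (?l k) * of_nat k) * (of_int d * \<pi>)"
      by (simp add: sum.distrib sum_subtractf sum_distrib_left sum_distrib_right algebra_simps)
    moreover have "\<pi> ^ 2 zdvd (\<Sum>k\<in>?A. of_nat (?l k) * (w k - (of_int (poly h 1) - of_int d * of_nat k * \<pi>)))"
      by (intro zdvd_sum zdvd_mult2 d) auto
    moreover have "\<pi> ^ 2 zdvd (\<Sum>k\<in>?A. of_nat (?l k))"
      using zdvd_trans[OF pi2_p] zdvd_of_int[OF L] by simp
    moreover have "\<pi> ^ 2 zdvd (\<Sum>k\<in>?A. of_nat (?l k) * of_nat k)"
      using zdvd_trans[OF pi2_p] zdvd_of_int[OF L1] by simp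
    ultimately show ?thesis by (auto intro!: zdvd_add zdvd_diff zdvd_mult)
  qed
  let ?N = "\<Sum>k\<in>?A. ?l k"
  have rB: "?M zdvd of_int r * B - of_int r ^ Suc ?N"
  proof -
    have "?M zdvd of_int r * B - of_int r ^ ?N * (of_int r + of_nat p * (\<Sum>k\<in>?A. of_nat (?l k) * w k))"
      unfolding B_def using w by (intro zdvd_trans[OF ppi2_p2 prod_first_order_expansion]) auto
    moreover have "?M zdvd of_int r ^ ?N * (of_nat p * (\<Sum>k\<in>?A. of_nat (?l k) * w k))"
      by (intro zdvd_mult2 zdvd_mult_mono zdvd_refl W) auto
    ultimately have "?M zdvd (of_int r * B - of_int r ^ ?N * (of_int r + of_nat p * (\<Sum>k\<in>?A. of_nat (?l k) * w k)))
       + of_int r ^ ?N * (of_nat p * (\<Sum>k\<in>?A. of_nat (?l k) * w k))" by (rule zdvd_add)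
    then show ?thesis by (simp add: algebra_simps)
  qed
  have rp: "\<not> int p dvd r"
  proof
    assume "int p dvd r"
    then have "\<pi> zdvd of_int r" by (simp add: pi_zdvd_of_int_iff)
    then have "\<pi> zdvd (component m - of_int r) + of_int r" using zdvd_trans[OF pi_zdvd_p r] by (intro zdvd_add)
    then show False using component_punits[of m] by (simp add: punits_def)
  qed
  have cr: "coprime r (int p ^ 2)" using prime_imp_coprime[OF prime_int_p rp] by (simp add: coprime_commute)
  then obtain r' where r': "[r * r' = 1] (mod int p ^ 2)" using cong_solve_coprime_int by blast
  have BN: "?M zdvd B - of_int r ^ ?N"
  proof -
    have "(of_nat p ^ 2 :: complex) zdvd of_int (r * r' - 1)"
      using zdvd_of_int[of "int p ^ 2" "r * r' - 1"] r' by (simp add: cong_iff_dvd_diff)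
    then have "?M zdvd of_int (r * r' - 1) * (B - of_int r ^ ?N)"
      using zdvd_trans[OF ppi2_p2] B by (intro zdvd_mult) auto
    moreover have "?M zdvd (of_int r * B - of_int r ^ Suc ?N) * of_int r'" using rB by (intro zdvd_mult) auto
    ultimately have "?M zdvd (of_int r * B - of_int r ^ Suc ?N) * of_int r' - of_int (r * r' - 1) * (B - of_int r ^ ?N)"
      by (intro zdvd_diff)
    also have "(of_int r * B - of_int r ^ Suc ?N) * of_int r' - of_int (r * r' - 1) * (B - of_int r ^ ?N) = B - of_int r ^ ?N"
      by (simp add: algebra_simps)
    finally show ?thesis .
  qed
  have "p dvd ?N" using L by (metis int_dvd_int_iff of_nat_sum)
  then obtain q where "?N = p * q" by (rule dvdE)
  then have q: "?N = q * p" by (simp only: mult.commute)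
  have "(of_int r :: complex) \<in> punits" using rp by (simp add: punits_def pi_zdvd_of_int_iff)
  then have "of_int r ^ q \<in> punits" by simp
  then have "local_pth_power p \<zeta> B" by (rule hensel_pth_power[OF B _ BN[unfolded q power_mult]])
  moreover obtain t where t: "t \<in> local_units" "B = component m * t ^ p"
    using component_idempotent[of m] unfolding B_def by (metis (no_types, lifting) conj prod.cong)
  ultimately show ?thesis
    using local_pth_power_mult_pth_power_iff[of "component m" t] component_punits punits_zint
      local_units_cfield local_units_nonzero by auto
qed

text \<open>For \<open>m = p - 1\<close> both sides are true, the left one because the exponents are constant and the norm of
  \<open>a + b \<zeta>\<close> is the \<open>p\<close>-th power \<open>(-c)\<^sup>p/(a+b)\<close>.\<close>

lemma local_pth_power_component_iff:
  assumes m: "m \<in> {1..p-1}" "m \<noteq> 1" and x: "[a * x = - b] (mod int p)"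
  shows "local_pth_power p \<zeta> (component m) \<longleftrightarrow> int p dvd (\<Sum>k=1..p-1. int k ^ (m - 1) * x ^ k)"
proof (cases "m = p - 1")
  case True
  obtain d where d: "a + b = d ^ p" by (rule sum_is_pth_power)
  have d0: "d \<noteq> 0" using d p_ndvd_sum p_gt_2 by (auto simp: power_0_left)
  let ?u = "of_int (- c) / of_int d :: complex"
  have "of_int d ^ p * (\<Prod>k=1..p-1. factor k) = of_int (- c) ^ p" using prod_factors d by simp
  then have "(\<Prod>k=1..p-1. factor k) = ?u ^ p"
    unfolding power_divide using d0 by (simp add: eq_divide_eq mult.commute)
  moreover have "component m = (\<Prod>k=1..p-1. factor k) ^ (p - 1)"
    by (simp add: component_def expo_def True prod_power_distrib)
  ultimately have "component m = 1 * (?u ^ (p - 1)) ^ p" by (simp add: power_mult[symmetric] mult.commute)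
  moreover have "?u \<in> cfield" using d0 by (intro cfieldI) auto
  then have "local_pth_power p \<zeta> (1 * (?u ^ (p - 1)) ^ p)"
    by (intro local_pth_power_mult_pth_power local_pth_power_1 cfield_power) auto
  ultimately have "local_pth_power p \<zeta> (component m)" by simp
  moreover have "m - 1 = p - 2" using True by simp
  ultimately show ?thesis using sum_kth_inverse_powers_dvd[OF x] by simp
next
  case False
  then have m': "2 \<le> m" "m \<le> p - 2" using m by auto
  have "local_pth_power p \<zeta> (component m) \<longleftrightarrow> (\<exists>r :: int. of_nat p zdvd component m - of_int r)"
    using local_pth_power_imp_cong_int[OF component_punits] local_pth_power_of_cong_int[OF m'] by metis
  also have "\<dots> \<longleftrightarrow> (\<forall>i\<in>{1..p-2}. int p dvd moment i (component_poly m))"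
    unfolding component_ev by (rule cong_int_iff_moments)
  also have "\<dots> \<longleftrightarrow> int p dvd (\<Sum>k=1..p-1. int k ^ (m - 1) * x ^ k)"
    unfolding component_poly_def expo_def by (rule moments_of_eigencomponent[OF p_prime x p_ndvd_sum m'])
  finally show ?thesis .
qed

end


section \<open>The criterion\<close>

text \<open>Both sides are inverse to \<open>(p-1) k\<^sup>m\<close> modulo \<open>p\<close>.\<close>

lemma idem_coeff_cong:
  assumes "prime p" "k \<in> {1..p-1}" "m \<le> p - 1"
    and "Zp_cong p (Zp_of_int p l) (idem_coeff p (teichmueller_char p m) k)"
  shows "[l = int ((p - 1) * k ^ (p - 1 - m))] (mod int p)"
proof -
  have p0: "p > 0" and p1: "p > 1" using assms(1) prime_gt_0_nat prime_gt_1_nat by auto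
  interpret Z: cring "Zp p" by (rule Zp_cring[OF p0])
  note T = teichmueller_properties[OF assms(1,2)]
  define t where "t = teichmueller p k [^]\<^bsub>Zp p\<^esub> m"
  have tc: "t \<in> carrier (Zp p)" using T(1) by (simp add: t_def)
  have t1: "t 1 = int k ^ m mod int p" using Zp_pow_entry[OF p0, of "teichmueller p k" m 1] T(2) by (simp add: t_def)
  have nk: "\<not> int p dvd int k" using assms(2) by (auto dest!: dvd_imp_le)
  then have nt: "\<not> int p dvd t 1"
    unfolding t1 using assms(1) prime_dvd_power[of "int p" "int k" m] by (auto simp: dvd_mod_iff)
  define q where "q = Zp_of_int p (int p - 1)"
  have qc: "q \<in> carrier (Zp p)" unfolding q_def by (rule Zp_of_int_carrier[OF p0])
  have q1: "q 1 = int p - 1"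
    unfolding q_def Zp_of_int_def power_one_right by (rule mod_pos_pos_trivial) (use p1 in auto)
  have nq: "\<not> int p dvd q 1" unfolding q1 using p1 by (auto dest!: zdvd_imp_le)
  note Q = Zp_inv_entry[OF assms(1) qc nq] and I = Zp_inv_entry[OF assms(1) tc nt]
  have ic: "idem_coeff p (teichmueller_char p m) k = inv\<^bsub>Zp p\<^esub> q \<otimes>\<^bsub>Zp p\<^esub> inv\<^bsub>Zp p\<^esub> t"
    using assms(2) by (simp add: idem_coeff_def teichmueller_char_def t_def q_def)
  have "Zp_of_int p l 1 = (inv\<^bsub>Zp p\<^esub> q \<otimes>\<^bsub>Zp p\<^esub> inv\<^bsub>Zp p\<^esub> t) 1"
    using assms(4) Q(1) I(1) Zp_of_int_carrier[OF p0] unfolding ic by (simp add: Zp_cong_iff[OF p0])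
  then have l: "[l = (inv\<^bsub>Zp p\<^esub> q) 1 * (inv\<^bsub>Zp p\<^esub> t) 1] (mod int p)"
    by (simp add: Zp_sel Zp_of_int_def cong_def)
  let ?P = "(int p - 1) * int k ^ m"
  have tk: "[t 1 = int k ^ m] (mod int p)" unfolding t1 by (simp add: cong_def)
  have "[?P * l = ?P * ((inv\<^bsub>Zp p\<^esub> q) 1 * (inv\<^bsub>Zp p\<^esub> t) 1)] (mod int p)" by (intro cong_mult cong_refl l)
  also have "?P * ((inv\<^bsub>Zp p\<^esub> q) 1 * (inv\<^bsub>Zp p\<^esub> t) 1) = (q 1 * (inv\<^bsub>Zp p\<^esub> q) 1) * (int k ^ m * (inv\<^bsub>Zp p\<^esub> t) 1)"
    unfolding q1 by (simp only: mult_ac)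
  also have "[\<dots> = 1 * (t 1 * (inv\<^bsub>Zp p\<^esub> t) 1)] (mod int p)" by (intro cong_mult Q(2) cong_refl cong_sym[OF tk])
  also have "[1 * (t 1 * (inv\<^bsub>Zp p\<^esub> t) 1) = 1 * 1] (mod int p)" by (intro cong_mult I(2) cong_refl)
  finally have A: "[?P * l = 1] (mod int p)" by simp
  have e: "int ((p - 1) * k ^ (p - 1 - m)) = (int p - 1) * int k ^ (p - 1 - m)" using p1 by (simp add: of_nat_diff)
  have "?P * int ((p - 1) * k ^ (p - 1 - m)) = (int p - 1) * (int p - 1) * int k ^ (m + (p - 1 - m))"
    unfolding e by (simp only: power_add mult_ac)
  also have "m + (p - 1 - m) = p - 1" using assms(3) by simp
  also have "[(int p - 1) * (int p - 1) * int k ^ (p - 1) = (- 1) * (- 1) * 1] (mod int p)"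
    by (intro cong_mult fermat_little_int assms(1) nk) (simp_all add: cong_iff_dvd_diff)
  finally have B: "[?P * int ((p - 1) * k ^ (p - 1 - m)) = 1] (mod int p)" by simp
  have "coprime ?P (int p)"
    using A by (metis cong_imp_coprime cong_sym coprime_1_left coprime_mult_left_iff)
  then show ?thesis using cong_trans[OF A cong_sym[OF B]] by (simp add: cong_mult_lcancel)
qed

text \<open>Only the residues modulo \<open>p\<close> matter: \<open>x\<close> is that of \<open>-b/a\<close>, and the Teichmueller representative of \<open>k\<close> is
  congruent to \<open>k\<close>.\<close>

lemma Zp_character_sum_cong_iff:
  assumes "prime p" "\<not> int p dvd a"
  obtains x where "[a * x = - b] (mod int p)"
    "Zp_cong p
       (\<Oplus>\<^bsub>Zp p\<^esub>k\<in>{1..p-1}. teichmueller_char p n k \<otimes>\<^bsub>Zp p\<^esub>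
          (Zp_of_int p (- b) \<otimes>\<^bsub>Zp p\<^esub> inv\<^bsub>Zp p\<^esub> (Zp_of_int p a)) [^]\<^bsub>Zp p\<^esub> k) \<zero>\<^bsub>Zp p\<^esub>
     \<longleftrightarrow> int p dvd (\<Sum>k=1..p-1. int k ^ n * x ^ k)"
proof -
  have p0: "p > 0" using assms(1) prime_gt_0_nat by auto
  interpret Z: cring "Zp p" by (rule Zp_cring[OF p0])
  define A where "A = Zp_of_int p a"
  define q where "q = Zp_of_int p (- b) \<otimes>\<^bsub>Zp p\<^esub> inv\<^bsub>Zp p\<^esub> A"
  have Ac: "A \<in> carrier (Zp p)" unfolding A_def by (rule Zp_of_int_carrier[OF p0])
  have A1: "A 1 = a mod int p" by (simp add: A_def Zp_of_int_def)
  then have "\<not> int p dvd A 1" using assms(2) by (simp add: dvd_mod_iff)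
  note I = Zp_inv_entry[OF assms(1) Ac this]
  have qc: "q \<in> carrier (Zp p)" using I(1) Zp_of_int_carrier[OF p0] by (simp add: q_def)
  have "[a * q 1 = A 1 * (- b * (inv\<^bsub>Zp p\<^esub> A) 1)] (mod int p)"
    unfolding A1 by (intro cong_mult) (simp_all add: q_def Zp_sel Zp_of_int_def cong_def mod_simps)
  also have "A 1 * (- b * (inv\<^bsub>Zp p\<^esub> A) 1) = - b * (A 1 * (inv\<^bsub>Zp p\<^esub> A) 1)" by (simp only: mult_ac)
  also have "[\<dots> = - b * 1] (mod int p)" by (intro cong_mult cong_refl I(2))
  finally have ax: "[a * q 1 = - b] (mod int p)" by simp
  define f where "f = (\<lambda>k. teichmueller_char p n k \<otimes>\<^bsub>Zp p\<^esub> q [^]\<^bsub>Zp p\<^esub> k)"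
  have fc: "f k \<in> carrier (Zp p)" and f1: "[f k 1 = int k ^ n * q 1 ^ k] (mod int p)" if k: "k \<in> {1..p-1}" for k
  proof -
    note T = teichmueller_properties[OF assms(1) k]
    show "f k \<in> carrier (Zp p)" using T(1) qc k by (simp add: f_def teichmueller_char_def)
    have "f k 1 = ((teichmueller p k [^]\<^bsub>Zp p\<^esub> n) 1 * (q [^]\<^bsub>Zp p\<^esub> k) 1) mod int p"
      using k by (simp add: f_def teichmueller_char_def Zp_sel)
    also have "\<dots> = (int k ^ n * q 1 ^ k) mod int p"
      using Zp_pow_entry[OF p0, of _ _ 1] T(2) by (simp add: mod_simps)
    finally show "[f k 1 = int k ^ n * q 1 ^ k] (mod int p)" by (simp add: cong_def)
  qed
  let ?S = "\<Oplus>\<^bsub>Zp p\<^esub>k\<in>{1..p-1}. f k"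
  have Sc: "?S \<in> carrier (Zp p)" using fc by (intro Z.finsum_closed) auto
  have "Zp_cong p ?S \<zero>\<^bsub>Zp p\<^esub> \<longleftrightarrow> ?S 1 = 0"
    using Zp_cong_iff[OF p0 Sc Z.zero_closed] by (simp add: Zp_sel)
  also have "?S 1 = (\<Sum>k=1..p-1. f k 1) mod int p"
    using Zp_finsum_entry[OF p0, of "{1..p-1}" f 1] fc by simp
  also have "\<dots> = 0 \<longleftrightarrow> int p dvd (\<Sum>k=1..p-1. f k 1)" by (rule dvd_eq_mod_eq_0[symmetric])
  also have "\<dots> \<longleftrightarrow> int p dvd (\<Sum>k=1..p-1. int k ^ n * q 1 ^ k)"
    by (rule cong_dvd_iff[OF cong_sum[OF f1]])
  finally have "Zp_cong p ?S \<zero>\<^bsub>Zp p\<^esub> \<longleftrightarrow> int p dvd (\<Sum>k=1..p-1. int k ^ n * q 1 ^ k)" .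
  from that[OF ax[unfolded q_def A_def] this[unfolded f_def q_def A_def]] show ?thesis .
qed

context fermat_first_case
begin

lemma gal_factor: "\<not> p dvd k \<Longrightarrow> gal \<zeta> k (factor 1) = factor k"
  using gal_quotient[of k 1 "[:a:] + monom b 1"] by (simp add: factor_def)

lemma gal_normalized_factor:
  assumes "\<not> p dvd k"
  shows "gal \<zeta> k (1 + of_int b / of_int (a + b) * (\<zeta> - 1)) = factor k / of_int (a + b)"
proof -
  have nz: "(of_int (a + b) :: complex) \<noteq> 0" using p_ndvd_sum by (metis dvd_0_right of_int_eq_0_iff)
  then have "1 + of_int b / of_int (a + b) * (\<zeta> - 1) = ev ([:a:] + monom b 1) \<zeta> / ev [:a + b:] \<zeta>"
    by (simp add: field_simps)
  then show ?thesis using gal_quotient[OF assms, of "[:a + b:]" "[:a:] + monom b 1"] nz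
    by (simp add: factor_def)
qed

text \<open>Whatever integers represent the coefficients of the idempotent, and whichever of the two elements it
  is applied to, the result is \<^term>\<open>component m\<close> up to the \<open>p\<close>-th power of a local unit; for the
  second element, this holds because \<open>a + b\<close> is a \<open>p\<close>-th power.\<close>

lemma idem_powers_eq_component:
  assumes "m \<le> p - 1" "\<chi> = teichmueller_char p m"
    and "\<alpha> \<in> {of_int a + of_int b * \<zeta>, 1 + of_int b / of_int (a + b) * (\<zeta> - 1)}"
    and "\<beta> \<in> idem_powers p \<zeta> \<chi> \<alpha>"
  obtains t where "t \<in> local_units" "\<beta> = component m * t ^ p"
proof -
  obtain d where d: "a + b = d ^ p" by (rule sum_is_pth_power)
  have dp: "(of_int d :: complex) \<in> punits"
    using p_ndvd_sum d p_gt_2 prime_dvd_power_iff[OF prime_int_p, of p d]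
    by (simp add: punits_def pi_zdvd_of_int_iff)
  have nd: "\<not> p dvd k" if "k \<in> {1..p-1}" for k using that by (auto dest!: dvd_imp_le)
  obtain g where g: "g \<in> local_units" "\<And>k. k \<in> {1..p-1} \<Longrightarrow> gal \<zeta> k \<alpha> = factor k * g ^ p"
  proof (cases "\<alpha> = factor 1")
    case True
    have "gal \<zeta> k \<alpha> = factor k * 1 ^ p" if "k \<in> {1..p-1}" for k
      using gal_factor[OF nd[OF that]] True by simp
    then show ?thesis using that[of 1] by simp
  next
    case False
    then have "\<alpha> = 1 + of_int b / of_int (a + b) * (\<zeta> - 1)" using assms(3) by (simp add: factor_def)
    then have "gal \<zeta> k \<alpha> = factor k * (1 / of_int d) ^ p" if "k \<in> {1..p-1}" for k
      using gal_normalized_factor[OF nd[OF that]]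
      by (simp add: d power_inverse divide_inverse del: of_int_add)
    then show ?thesis using that[of "1 / of_int d"] local_unitsI[OF punits_1 dp] by blast
  qed
  obtain l where l: "\<beta> = (\<Prod>k=1..p-1. gal \<zeta> k \<alpha> powi l k)"
    "\<And>k. k \<in> {1..p-1} \<Longrightarrow> Zp_cong p (Zp_of_int p (l k)) (idem_coeff p \<chi> k)"
    using assms(4) by (auto simp: idem_powers_def)
  have "[l k = int (expo m k)] (mod int p)" if "k \<in> {1..p-1}" for k
    using idem_coeff_cong[OF p_prime that assms(1)] l(2)[OF that] assms(2) by (simp add: expo_def)
  then obtain s where s: "s \<in> local_units"
    "(\<Prod>k=1..p-1. factor k powi l k) = (\<Prod>k=1..p-1. factor k powi int (expo m k)) * s ^ p"
    using prod_powi_cong_mod_pth_powers[of "{1..p-1}" factor l "\<lambda>k. int (expo m k)"]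
      punits_local_units[OF factor_punits] by blast
  have "\<beta> = (\<Prod>k=1..p-1. factor k powi l k * (g powi l k) ^ p)"
    unfolding l(1)
    by (rule prod.cong) (simp_all add: g(2) power_int_mult_distrib power_int_power' power_int_power mult.commute)
  also have "\<dots> = component m * (s * (\<Prod>k=1..p-1. g powi l k)) ^ p"
    unfolding prod.distrib s(2)
    by (simp add: component_def prod_power_distrib power_mult_distrib mult.assoc)
  finally have "\<beta> = component m * (s * (\<Prod>k=1..p-1. g powi l k)) ^ p" .
  moreover have "s * (\<Prod>k=1..p-1. g powi l k) \<in> local_units" using s(1) g(1) by (simp add: local_units_prod)
  ultimately show ?thesis using that by blast
qed

end

theorem theorem3p5:
  fixes p m :: nat and a b c :: int and \<zeta> e :: complex and \<chi> :: "nat \<Rightarrow> (nat \<Rightarrow> int)"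
  assumes "prime p" and "p > 2"
    and "\<zeta> ^ p = 1" and "\<forall>j\<in>{1..<p}. \<zeta> ^ j \<noteq> 1"
    and "a \<noteq> 0" and "b \<noteq> 0" and "c \<noteq> 0"
    and "coprime a b" and "coprime b c" and "coprime a c"
    and "a ^ p + b ^ p + c ^ p = 0"
    and "\<not> int p dvd a * b * c"
    and "e = of_int b / of_int (a + b)"
    and "m \<in> {1..p-1}"
    and "\<chi> = teichmueller_char p m"
    and "\<chi> \<noteq> teichmueller_char p 1"
  shows "\<forall>\<alpha> \<in> {of_int a + of_int b * \<zeta>, 1 + e * (\<zeta> - 1)}.
           \<forall>\<beta> \<in> idem_powers p \<zeta> \<chi> \<alpha>.
             pseudo_unit p \<zeta> \<beta> \<and>
             (local_pth_power p \<zeta> \<beta> \<longleftrightarrow>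
              Zp_cong p
                (\<Oplus>\<^bsub>Zp p\<^esub>k\<in>{1..p-1}. teichmueller_char p (m - 1) k \<otimes>\<^bsub>Zp p\<^esub>
                   (Zp_of_int p (- b) \<otimes>\<^bsub>Zp p\<^esub> inv\<^bsub>Zp p\<^esub> (Zp_of_int p a)) [^]\<^bsub>Zp p\<^esub> k)
                \<zero>\<^bsub>Zp p\<^esub>)"
proof (intro ballI)
  interpret fermat_first_case p \<zeta> a b c
    using assms by unfold_locales auto
  fix \<alpha> \<beta> assume \<alpha>: "\<alpha> \<in> {of_int a + of_int b * \<zeta>, 1 + e * (\<zeta> - 1)}" and \<beta>: "\<beta> \<in> idem_powers p \<zeta> \<chi> \<alpha>"
  have m: "m \<le> p - 1" "m \<noteq> 1" using assms(14-16) by auto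
  obtain t where t: "t \<in> local_units" "\<beta> = component m * t ^ p"
    using idem_powers_eq_component[OF m(1) assms(15) _ \<beta>] \<alpha> assms(13) by blast
  have comp: "component m \<in> local_units" by (rule punits_local_units[OF component_punits])
  have tK: "t \<in> cfield" "t \<noteq> 0" using t(1) local_units_cfield local_units_nonzero by auto
  have "ideal_pth_power \<beta>"
    unfolding t(2) by (intro ideal_pth_power_mult component_ideal_pth_power ideal_pth_power_pth_power tK)
  then have "pseudo_unit p \<zeta> \<beta>" using pseudo_unit_iff[of \<beta>] t comp by simp
  moreover obtain x where x: "[a * x = - b] (mod int p)"
    "Zp_cong p
       (\<Oplus>\<^bsub>Zp p\<^esub>k\<in>{1..p-1}. teichmueller_char p (m - 1) k \<otimes>\<^bsub>Zp p\<^esub>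
          (Zp_of_int p (- b) \<otimes>\<^bsub>Zp p\<^esub> inv\<^bsub>Zp p\<^esub> (Zp_of_int p a)) [^]\<^bsub>Zp p\<^esub> k) \<zero>\<^bsub>Zp p\<^esub>
     \<longleftrightarrow> int p dvd (\<Sum>k=1..p-1. int k ^ (m - 1) * x ^ k)"
    using Zp_character_sum_cong_iff[OF p_prime p_ndvd(1), where b = b and n = "m - 1"] .
  moreover have "local_pth_power p \<zeta> \<beta> \<longleftrightarrow> local_pth_power p \<zeta> (component m)"
    unfolding t(2) by (rule local_pth_power_mult_pth_power_iff[OF local_units_cfield[OF comp] tK])
  ultimately show "pseudo_unit p \<zeta> \<beta> \<and> (local_pth_power p \<zeta> \<beta> \<longleftrightarrow>
      Zp_cong p
        (\<Oplus>\<^bsub>Zp p\<^esub>k\<in>{1..p-1}. teichmueller_char p (m - 1) k \<otimes>\<^bsub>Zp p\<^esub>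
           (Zp_of_int p (- b) \<otimes>\<^bsub>Zp p\<^esub> inv\<^bsub>Zp p\<^esub> (Zp_of_int p a)) [^]\<^bsub>Zp p\<^esub> k)
        \<zero>\<^bsub>Zp p\<^esub>)"
    using local_pth_power_component_iff[OF assms(14) m(2) x(1)] by blast
qed

end
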